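(* Let $n \ge 2$, let $\mathcal{S} = \{p_1,\dots,p_r\}$ be a finite set of distinct primes, and let $\mu_1,\dots,\mu_r$ be partitions of $n$. For integer $B \ge 1$ let $\mathcal{F}_n(B)$ be the set of monic degree-$n$ polynomials $f(x) = x^n + \sum_{j=0}^{n-1} a_j x^j \in \mathbb{Z}[x]$ with $-B < a_j \le B$ for all $j$. (1) Let $\mathcal{F}_n(B;\mathcal{S})$ be the set of $f \in \mathcal{F}_n(B)$ with $\gcd(\mathrm{Disc}(f), \prod_{i=1}^r p_i) = 1$. Then $$\lim_{B\to\infty}\frac{\#\mathcal{F}_n(B;\mathcal{S})}{\#\mathcal{F}_n(B)} = \prod_{i=1}^r\Big(1 - \frac{1}{p_i}\Big).$$ (2) Let $\mathcal{F}_n(B;\{\mathcal{S},\mathfrak{U}\})$ be the set of $f \in \mathcal{F}_n(B;\mathcal{S})$ such that (i) the splitting field of $f$ over $\mathbb{Q}$ has Galois group $S_n$, and (ii) the splitting type of $f \bmod p_i$ is $\mu_i$ for $1 \le i \le r$. Then $$\lim_{B\to\infty}\frac{\#\mathcal{F}_n(B;\{\mathcal{S},\mathfrak{U}\})}{\#\mathcal{F}_n(B;\mathcal{S})} = \prod_{i=1}^r \nu_{n,p_i}^{\ast}(C_{\mu_i}).$$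
   Context: $\mathrm{Disc}(f)$ is the polynomial discriminant. When $p\nmid \mathrm{Disc}(f)$, $f \bmod p$ is a product of distinct monic irreducible factors in $\mathbb{F}_p[x]$, and its splitting type is the partition of $n$ formed by their degrees. For $m\ge1$, $M_m(X) = \frac{1}{m}\sum_{d\mid m}\mu(d)X^{m/d}$ ($\mu(d)$ the Möbius function); $\binom{w}{k} = \frac{w(w-1)\cdots(w-k+1)}{k!}$; $c_i(\mu)$ is the number of parts of $\mu$ equal to $i$; $C_\mu$ is the conjugacy class of $S_n$ of cycle type $\mu$; and $\nu_{n,p}^{\ast}(C_\mu) = \frac{1}{p^{n-1}(p-1)}\prod_{i=1}^n\binom{M_i(p)}{c_i(\mu)}$. *)

theory Defs
  imports
    Complex_Main
    "HOL-Computational_Algebra.Squarefree"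
    "HOL-Algebra.Bij"
    "HOL-Algebra.Generated_Fields"
    "HOL-Algebra.Sym_Groups"
    "Subresultants.Resultant_Prelim"
    "Berlekamp_Zassenhaus.Poly_Mod"
begin

hide_const (open) UnivPoly.coeff UnivPoly.monom Module.smult

definition discriminant :: "int poly \<Rightarrow> int" where
  "discriminant f =
     ((-1) ^ (degree f * (degree f - 1) div 2) * resultant f (pderiv f)) div lead_coeff f"

text \<open>
  The splitting field over \<open>\<rat>\<close> is realised inside \<open>\<complex>\<close>. A subfield of
  \<open>\<complex>\<close> generated by any set contains \<open>\<rat>\<close>, so no separate adjunction of
  \<open>\<rat>\<close> is needed.
\<close>

definition complex_field :: "complex ring" where
  "complex_field = \<lparr>carrier = UNIV, mult = (*), one = 1, zero = 0, add = (+)\<rparr>"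

definition splitting_field :: "int poly \<Rightarrow> complex set" where
  "splitting_field f = generate_field complex_field {z. poly (map_poly of_int f) z = 0}"

definition galois_group :: "int poly \<Rightarrow> (complex \<Rightarrow> complex) monoid" where
  "galois_group f =
     (let K = splitting_field f; L = complex_field\<lparr>carrier := K\<rparr>
      in (BijGroup K)\<lparr>carrier := {\<sigma> \<in> Bij K. \<sigma> \<in> Ring.ring_hom L L \<and> (\<forall>q\<in>\<rat>. \<sigma> q = q)}\<rparr>)"

definition nat_partition :: "nat \<Rightarrow> nat multiset \<Rightarrow> bool" where
  "nat_partition n \<mu> \<longleftrightarrow> 0 \<notin># \<mu> \<and> sum_mset \<mu> = n"

text \<open>
  Elements of \<open>\<bbbF>\<^sub>p[x]\<close> are represented by integer polynomials whose
  coefficients are reduced modulo \<open>p\<close>. Multiplicities of the factors are ignored, which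
  is the splitting type only if \<open>f\<close> is squarefree modulo \<open>p\<close>, that is, if \<open>p\<close> does not
  divide the discriminant of the monic polynomial \<open>f\<close>.
\<close>

definition monic_irreducible_factors_mod :: "nat \<Rightarrow> int poly \<Rightarrow> int poly set" where
  "monic_irreducible_factors_mod p f =
     {g. poly_mod.Mp (int p) g = g \<and> lead_coeff g = 1 \<and>
         poly_mod.irreducible_m (int p) g \<and> poly_mod.dvdm (int p) g f}"

definition splitting_type :: "nat \<Rightarrow> int poly \<Rightarrow> nat multiset" where
  "splitting_type p f = image_mset degree (mset_set (monic_irreducible_factors_mod p f))"

definition moebius_mu :: "nat \<Rightarrow> int" where
  "moebius_mu d = (if squarefree d then (-1) ^ card (prime_factors d) else 0)"

definition necklace :: "nat \<Rightarrow> real \<Rightarrow> real" where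
  "necklace m X = 1 / real m * (\<Sum>d | d dvd m. of_int (moebius_mu d) * X ^ (m div d))"

text \<open>
  The value \<open>\<nu>\<^sup>*(C\<^sub>\<mu>)\<close>; the conjugacy class \<open>C\<^sub>\<mu>\<close> of \<open>S\<^sub>n\<close> is given by its cycle
  type \<open>\<mu>\<close>.
\<close>

definition nu_star :: "nat \<Rightarrow> nat \<Rightarrow> nat multiset \<Rightarrow> real" where
  "nu_star n p \<mu> =
     1 / (real p ^ (n - 1) * (real p - 1)) *
     (\<Prod>i=1..n. necklace i (real p) gchoose count \<mu> i)"

definition monic_box :: "nat \<Rightarrow> nat \<Rightarrow> int poly set" where
  "monic_box n B =
     {f. degree f = n \<and> lead_coeff f = 1 \<and>
         (\<forall>j<n. - int B < coeff f j \<and> coeff f j \<le> int B)}"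

definition monic_box_coprime :: "nat \<Rightarrow> nat \<Rightarrow> (nat \<Rightarrow> nat) \<Rightarrow> nat \<Rightarrow> int poly set" where
  "monic_box_coprime n r p B =
     {f \<in> monic_box n B. gcd (discriminant f) (\<Prod>i=1..r. int (p i)) = 1}"

definition monic_box_split ::
    "nat \<Rightarrow> nat \<Rightarrow> (nat \<Rightarrow> nat) \<Rightarrow> (nat \<Rightarrow> nat multiset) \<Rightarrow> nat \<Rightarrow> int poly set" where
  "monic_box_split n r p \<mu> B =
     {f \<in> monic_box_coprime n r p B.
        galois_group f \<cong> sym_group n \<and> (\<forall>i\<in>{1..r}. splitting_type (p i) f = \<mu> i)}"

end

theory Submission
  imports
    Defs
    "HOL-Number_Theory.Cong"
    "HOL-Computational_Algebra.Fundamental_Theorem_Algebra"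
    "Jordan_Normal_Form.Char_Poly"
    "Subresultants.Subresultant"
begin

text \<open>
  Both conditions at the primes \<open>p\<^sub>i\<close> depend only on \<open>f\<close> modulo \<open>\<Prod>p\<^sub>i\<close>, and the box is
  equidistributed modulo any fixed integer, so the local densities can be counted in
  \<open>\<bbbF>\<^sub>p[x]\<close>. There unique factorization identifies monic polynomials with finite multisets of
  irreducible ones, which yields the necklace formula, the number \<open>p\<^sup>n - p\<^bsup>n-1\<^esup>\<close> of squarefree
  polynomials, and the number of squarefree polynomials of a given splitting type.

  The Galois condition does not change the density. By Dedekind, a squarefree splitting type
  \<open>\<mu>\<close> of \<open>f\<close> modulo \<open>q\<close> forces the Galois group to contain a permutation of cycle type \<open>\<mu>\<close> of
  the roots; here the Frobenius element is obtained modulo a maximal ideal \<open>\<mm>\<close> of the ring of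
  all algebraic integers. An \<open>n\<close>-cycle, an \<open>(n-1)\<close>-cycle and a transposition generate \<open>S\<^sub>n\<close>. For
  each of the three types the proportion of polynomials modulo \<open>q\<close> having it is bounded below
  uniformly in large \<open>q\<close>, so the polynomials missing one of the types at all primes of a large
  finite set have small density.
\<close>

hide_const (open) UnivPoly.coeff UnivPoly.monom Module.smult


section \<open>Counting words in a weighted free commutative monoid\<close>

text \<open>In the ring of all algebraic integers one prime ideal \<open>\<mm>\<close> above p
  serves every f at once, and congruences modulo \<open>\<mm>\<close> stand for equations in the
  residue field. The Frobenius element comes from the polynomial with roots
  \<open>\<Theta> \<sigma>\<close>, one for each \<sigma> in the Galois group: it is
  Galois-invariant, hence integral, so Frobenius sends its roots to roots modulo
  \<open>\<mm>\<close>, and primality selects one \<sigma>. Its cycles are found by counting: a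
  stable set of roots over an irreducible factor g has at least deg g elements, while these degrees
  add up to the number of roots, so equality holds throughout. The uniform lower bound holds because
  there are about q^i / i irreducible polynomials of degree i, so that the product of binomials
  grows like q^n, the exponent being the sum of the parts. No rate of convergence is tracked: if
  each type has proportion at least delta, m independent primes leave density at most (1 - delta)^m
  for missing it, and m is chosen after epsilon. The three types suffice since the n-cycle is
  transitive, the (n-1)-cycle is transitive off one root, and conjugation spreads the
  transposition.\<close>

lemma sum_mset_image_eq_sum_count:
  fixes w :: "'a \<Rightarrow> nat"
  assumes "finite J" "set_mset A \<subseteq> J"
  shows "sum_mset (image_mset w A) = (\<Sum>x\<in>J. count A x * w x)"
  using assms(2)
proof (induction A)
  case (add x A)
  have "(\<Sum>y\<in>J. count (add_mset x A) y * w y) = (\<Sum>y\<in>J. count A y * w y + (if y = x then w y else 0))"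
    by (rule sum.cong) auto
  also have "\<dots> = (\<Sum>y\<in>J. count A y * w y) + w x"
    using add.prems assms(1) by (simp add: sum.distrib)
  finally show ?case using add by simp
qed simp

lemma mset_eq_mset_set:
  assumes "\<And>x. count A x \<le> 1"
  shows "A = mset_set (set_mset A)"
proof (rule multiset_eqI)
  fix x
  show "count A x = count (mset_set (set_mset A)) x"
  proof (cases "x \<in># A")
    case True
    then have "count A x = 1" using assms[of x] by (intro le_antisym) (auto simp: Suc_le_eq)
    then show ?thesis using True by simp
  qed (simp add: not_in_iff)
qed

text \<open>With irreducible polynomials as letters and degree as weight, \<open>card_words\<close>
  is unique factorization in the form of the Euler product: the zeta function of F_q[x] equals 1/(1
  - qt). All counts below follow from this one identity.\<close>

locale weighted_alphabet =
  fixes I :: "'a set" and w :: "'a \<Rightarrow> nat" and q :: nat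
  assumes w_pos: "x \<in> I \<Longrightarrow> w x > 0"
    and q_pos: "q > 0"
    and card_words: "card {A. set_mset A \<subseteq> I \<and> sum_mset (image_mset w A) = n} = q ^ n"
begin

definition words :: "nat \<Rightarrow> 'a multiset set" where
  "words n = {A. set_mset A \<subseteq> I \<and> sum_mset (image_mset w A) = n}"

definition letters :: "nat \<Rightarrow> 'a set" where
  "letters d = {x \<in> I. w x = d}"

definition squarefree_words :: "nat \<Rightarrow> 'a multiset set" where
  "squarefree_words n = {A \<in> words n. \<forall>x. count A x \<le> 1}"

lemma card_words_eq: "card (words n) = q ^ n"
  unfolding words_def by (rule card_words)

text \<open>An infinite set has \<open>card\<close> 0, so the nonzero count q^n already yields
  finiteness.\<close>

lemma finite_words: "finite (words n)"
  using card_words_eq[of n] q_pos by (intro card_ge_0_finite) auto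

lemma finite_letters: "finite (letters d)"
proof -
  have "(\<lambda>x. {#x#}) ` letters d \<subseteq> words d"
    by (auto simp: letters_def words_def)
  then have "finite ((\<lambda>x. {#x#}) ` letters d)"
    using finite_words finite_subset by blast
  then show ?thesis
    by (rule finite_imageD) (auto simp: inj_on_def)
qed

lemma words_weight_le: "A \<in> words n \<Longrightarrow> x \<in># A \<Longrightarrow> w x \<le> n"
  unfolding words_def by (auto dest!: multi_member_split)

text \<open>Removing \<open>j\<close> copies of \<open>x\<close> is a bijection onto the words of
  weight \<open>n - j * w x\<close>.\<close>

lemma card_words_containing:
  assumes "x \<in> I"
  shows "card {A \<in> words n. j \<le> count A x} = (if j * w x \<le> n then q ^ (n - j * w x) else 0)"
proof (cases "j * w x \<le> n")
  case True
  have "bij_betw (\<lambda>A. A + replicate_mset j x) (words (n - j * w x)) {A \<in> words n. j \<le> count A x}"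
  proof (rule bij_betwI[where g = "\<lambda>A. A - replicate_mset j x"])
    show "(\<lambda>A. A + replicate_mset j x) \<in> words (n - j * w x) \<rightarrow> {A \<in> words n. j \<le> count A x}"
      using assms True by (auto simp: words_def image_replicate_mset sum_mset_replicate_mset)
    show "(\<lambda>A. A - replicate_mset j x) \<in> {A \<in> words n. j \<le> count A x} \<rightarrow> words (n - j * w x)"
    proof
      fix A assume "A \<in> {A \<in> words n. j \<le> count A x}"
      then have A: "A \<in> words n" "replicate_mset j x \<subseteq># A"
        by (auto simp: count_le_replicate_mset_subset_eq)
      then obtain B where B: "A = replicate_mset j x + B"
        by (meson subset_mset.le_iff_add)
      show "A - replicate_mset j x \<in> words (n - j * w x)"
        using A(1) unfolding B words_def by (auto simp: image_replicate_mset)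
    qed
  qed (auto simp: count_le_replicate_mset_subset_eq subset_mset.diff_add)
  from bij_betw_same_card[OF this] True show ?thesis
    by (simp add: card_words_eq)
next
  case False
  have empty: "{A \<in> words n. j \<le> count A x} = {}"
  proof safe
    fix A assume A: "A \<in> words n" "j \<le> count A x"
    then have "replicate_mset j x \<subseteq># A"
      by (auto simp: count_le_replicate_mset_subset_eq)
    then obtain B where B: "A = replicate_mset j x + B"
      by (meson subset_mset.le_iff_add)
    have "sum_mset (image_mset w A) = n" using A by (simp add: words_def)
    then have "j * w x \<le> n" unfolding B by (auto simp: image_replicate_mset)
    then show "A \<in> {}" using False by simp
  qed
  show ?thesis unfolding empty using False by simp
qed

text \<open>Counting pairs of a word and a prime power dividing it, weighted by the weight of the
  prime: this is the von Mangoldt identity \<open>\<Sum>\<^bsub>g dvd f\<^esub> \<Lambda> g = deg f\<close> summed over all \<open>f\<close>.\<close>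

lemma sum_divisors_words: "(\<Sum>k=1..n. q ^ (n - k) * (\<Sum>d | d dvd k. d * card (letters d))) = n * q ^ n"
proof -
  define J where "J = {x \<in> I. w x \<le> n}"
  have J_UN: "J = (\<Union>d\<in>{..n}. letters d)" by (auto simp: J_def letters_def)
  have finJ: "finite J" unfolding J_UN using finite_letters by blast
  \<comment> \<open>Bounds every multiplicity by n, so that the sum over occurrences can run over
    the same range 1..n for every word and letter.\<close>
  have count_le: "count A x \<le> n" if "A \<in> words n" for A x
  proof (cases "x \<in># A")
    case True
    then have "x \<in> I" using that by (auto simp: words_def)
    have "replicate_mset (count A x) x \<subseteq># A"
      by (auto simp: count_le_replicate_mset_subset_eq[symmetric])
    then obtain B where B: "A = replicate_mset (count A x) x + B"
      by (meson subset_mset.le_iff_add)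
    have "n = sum_mset (image_mset w A)" using that by (simp add: words_def)
    also have "\<dots> \<ge> count A x * w x" by (subst (2) B) (simp add: image_replicate_mset)
    finally have "count A x * w x \<le> n" .
    moreover have "w x \<ge> 1" using w_pos[OF \<open>x \<in> I\<close>] by simp
    ultimately show ?thesis by (metis le_trans mult.right_neutral mult_le_mono2)
  qed (simp add: not_in_iff)
  \<comment> \<open>Each occurrence j of a letter x contributes w x, so the weight is a sum over
    pairs (x, j) with j at most the multiplicity of x.\<close>
  have weight: "(\<Sum>x\<in>J. \<Sum>j=1..n. if j \<le> count A x then w x else 0) = n" if A: "A \<in> words n" for A
  proof -
    have "n = sum_mset (image_mset w A)" using A by (simp add: words_def)
    also have "\<dots> = (\<Sum>x\<in>J. count A x * w x)"
      by (rule sum_mset_image_eq_sum_count[OF finJ]) (use A words_weight_le[OF A] in \<open>auto simp: J_def words_def\<close>)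
    also have "\<dots> = (\<Sum>x\<in>J. \<Sum>j=1..n. if j \<le> count A x then w x else 0)"
    proof (rule sum.cong[OF refl])
      fix x
      have "(\<Sum>j=1..n. if j \<le> count A x then w x else 0) = (\<Sum>j\<in>{1..count A x}. w x)"
        using count_le[OF A, of x] by (intro sum.mono_neutral_cong_right) auto
      then show "count A x * w x = (\<Sum>j=1..n. if j \<le> count A x then w x else 0)" by simp
    qed
    finally show ?thesis by simp
  qed
  have "n * q ^ n = (\<Sum>A\<in>words n. n)" by (simp add: card_words_eq)
  also have "\<dots> = (\<Sum>A\<in>words n. \<Sum>x\<in>J. \<Sum>j=1..n. if j \<le> count A x then w x else 0)"
    by (rule sum.cong) (simp_all only: weight)
  also have "\<dots> = (\<Sum>x\<in>J. \<Sum>j=1..n. \<Sum>A\<in>words n. if j \<le> count A x then w x else 0)"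
    by (subst sum.swap, rule sum.cong[OF refl], subst sum.swap, rule refl)
  also have "\<dots> = (\<Sum>x\<in>J. \<Sum>j=1..n. w x * card {A \<in> words n. j \<le> count A x})"
  proof (intro sum.cong refl)
    fix x j
    have "(\<Sum>A\<in>words n. if j \<le> count A x then w x else 0) = (\<Sum>A\<in>{A \<in> words n. j \<le> count A x}. w x)"
      using finite_words[of n] by (intro sum.mono_neutral_cong_right) auto
    then show "(\<Sum>A\<in>words n. if j \<le> count A x then w x else 0) = w x * card {A \<in> words n. j \<le> count A x}"
      by simp
  qed
  also have "\<dots> = (\<Sum>x\<in>J. \<Sum>j=1..n. if j * w x \<le> n then w x * q ^ (n - j * w x) else 0)"
    by (intro sum.cong refl) (auto simp: card_words_containing J_def)
  \<comment> \<open>Substituting k = j * w x, the total weight of the removed prime power, will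
    group the terms by divisors of k.\<close>
  also have "\<dots> = (\<Sum>x\<in>J. \<Sum>k=1..n. if w x dvd k then w x * q ^ (n - k) else 0)"
  proof (rule sum.cong[OF refl])
    fix x assume x: "x \<in> J"
    then have wx: "w x > 0" using w_pos by (auto simp: J_def)
    have "(\<Sum>j=1..n. if j * w x \<le> n then w x * q ^ (n - j * w x) else 0)
        = (\<Sum>j\<in>{j\<in>{1..n}. j * w x \<le> n}. w x * q ^ (n - j * w x))"
      by (intro sum.mono_neutral_cong_right) auto
    also have "\<dots> = (\<Sum>k\<in>{k\<in>{1..n}. w x dvd k}. w x * q ^ (n - k))"
    proof (rule sum.reindex_bij_witness[where i = "\<lambda>k. k div w x" and j = "\<lambda>j. j * w x"])
      fix k assume "k \<in> {k\<in>{1..n}. w x dvd k}"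
      then show "k div w x \<in> {j \<in> {1..n}. j * w x \<le> n}"
        using wx by (auto simp: dvd_div_eq_0_iff Suc_le_eq intro: le_trans[OF div_le_dividend])
    qed (use wx in \<open>auto simp: Suc_le_eq\<close>)
    also have "\<dots> = (\<Sum>k=1..n. if w x dvd k then w x * q ^ (n - k) else 0)"
      by (intro sum.mono_neutral_cong_left) auto
    finally show "(\<Sum>j=1..n. if j * w x \<le> n then w x * q ^ (n - j * w x) else 0)
        = (\<Sum>k=1..n. if w x dvd k then w x * q ^ (n - k) else 0)" .
  qed
  also have "\<dots> = (\<Sum>k=1..n. \<Sum>x\<in>J. if w x dvd k then w x * q ^ (n - k) else 0)"
    by (rule sum.swap)
  also have "\<dots> = (\<Sum>k=1..n. q ^ (n - k) * (\<Sum>d | d dvd k. d * card (letters d)))"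
  proof (rule sum.cong[OF refl])
    fix k assume k: "k \<in> {1..n}"
    then have fin: "finite {d. d dvd k}" by auto
    have "(\<Sum>x\<in>J. if w x dvd k then w x * q ^ (n - k) else 0)
       = (\<Sum>x\<in>(\<Union>d\<in>{d. d dvd k}. letters d). w x * q ^ (n - k))"
    proof (rule sum.mono_neutral_cong_right[OF finJ])
      show "(\<Union>d\<in>{d. d dvd k}. letters d) \<subseteq> J"
        using k by (auto simp: J_def letters_def dest: dvd_imp_le)
    qed (auto simp: J_def letters_def)
    also have "\<dots> = (\<Sum>d | d dvd k. \<Sum>x\<in>letters d. w x * q ^ (n - k))"
      by (rule sum.UNION_disjoint) (use fin finite_letters in \<open>auto simp: letters_def\<close>)
    also have "\<dots> = (\<Sum>d | d dvd k. q ^ (n - k) * (d * card (letters d)))"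
    proof (rule sum.cong[OF refl])
      fix d
      have "(\<Sum>x\<in>letters d. w x * q ^ (n - k)) = (\<Sum>x\<in>letters d. d * q ^ (n - k))"
        by (rule sum.cong) (auto simp: letters_def)
      then show "(\<Sum>x\<in>letters d. w x * q ^ (n - k)) = q ^ (n - k) * (d * card (letters d))"
        by simp
    qed
    finally show "(\<Sum>x\<in>J. if w x dvd k then w x * q ^ (n - k) else 0)
       = q ^ (n - k) * (\<Sum>d | d dvd k. d * card (letters d))"
      by (simp add: sum_distrib_left)
  qed
  finally show ?thesis by simp
qed

text \<open>Subtract q times the identity for n - 1 from the one for n: only the term k = n
  survives, and n q^n - (n - 1) q^n = q^n.\<close>

lemma sum_divisors_letters:
  assumes "n > 0"
  shows "(\<Sum>d | d dvd n. d * card (letters d)) = q ^ n"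
proof -
  define \<psi> where "\<psi> k = (\<Sum>d | d dvd k. d * card (letters d))" for k
  obtain m where n: "n = Suc m" using assms by (cases n) auto
  have "(\<Sum>k=1..n. q ^ (n - k) * \<psi> k) = (\<Sum>k=1..m. q ^ (n - k) * \<psi> k) + \<psi> n"
    unfolding n by simp
  also have "(\<Sum>k=1..m. q ^ (n - k) * \<psi> k) = q * (\<Sum>k=1..m. q ^ (m - k) * \<psi> k)"
    unfolding sum_distrib_left n by (intro sum.cong) (auto simp: Suc_diff_le)
  finally have "n * q ^ n = q * (m * q ^ m) + \<psi> n"
    using sum_divisors_words[of n] sum_divisors_words[of m] unfolding \<psi>_def by simp
  then show ?thesis unfolding \<psi>_def n by simp
qed

text \<open>Halving multiplicities writes each word uniquely as \<open>C + C + D\<close> with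
  \<open>D\<close> squarefree; the index k is the weight of \<open>C\<close>. In generating
  functions, Z(q t) = Z(q t^2) S(t) with Z(u) = 1/(1 - u) and S counting squarefree words.\<close>

lemma card_squarefree_words_recursion:
  "(\<Sum>k\<in>{k. 2 * k \<le> n}. q ^ k * card (squarefree_words (n - 2 * k))) = q ^ n"
proof -
  let ?P = "SIGMA k:{k. 2 * k \<le> n}. words k \<times> squarefree_words (n - 2 * k)"
  let ?h = "\<lambda>(k, C, D). C + C + D :: 'a multiset"
  have fin: "finite {k. 2 * k \<le> n}" by (rule finite_subset[of _ "{..n}"]) auto
  have finS: "finite (squarefree_words k)" for k
    using finite_words by (simp add: squarefree_words_def)
  have inj: "inj_on ?h ?P"
  proof (rule inj_onI, clarsimp)
    fix k C D k' C' D'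
    assume C: "C \<in> words k" "C' \<in> words k'" and D: "D \<in> squarefree_words (n - 2 * k)"
      "D' \<in> squarefree_words (n - 2 * k')" and eq: "C + C + D = C' + C' + D'"
    have "count C x = count C' x \<and> count D x = count D' x" for x
    proof -
      have "2 * count C x + count D x = 2 * count C' x + count D' x"
        using arg_cong[OF eq, of "\<lambda>A. count A x"] by simp
      moreover have "count D x \<le> 1" "count D' x \<le> 1" using D by (auto simp: squarefree_words_def)
      ultimately show ?thesis by presburger
    qed
    then have "C = C'" "D = D'" by (auto simp: multiset_eq_iff)
    with C show "k = k' \<and> C = C' \<and> D = D'" by (auto simp: words_def)
  qed
  have img: "?h ` ?P = words n"
  proof (intro equalityI subsetI)
    fix A assume "A \<in> ?h ` ?P"
    then obtain k C D where "A = C + C + D" "2 * k \<le> n" "C \<in> words k" "D \<in> squarefree_words (n - 2 * k)"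
      by auto
    then show "A \<in> words n" by (simp add: words_def squarefree_words_def)
  next
    fix A assume A: "A \<in> words n"
    \<comment> \<open>The half and the parity of each multiplicity.\<close>
    define C where "C = Abs_multiset (\<lambda>x. count A x div 2)"
    define D where "D = Abs_multiset (\<lambda>x. count A x mod 2)"
    have cC: "count C x = count A x div 2" for x
      unfolding C_def
      by (subst Abs_multiset_inverse) (auto intro!: finite_subset[of _ "set_mset A"] simp: div_greater_zero_iff
          simp flip: count_greater_zero_iff)
    have cD: "count D x = count A x mod 2" for x
      unfolding D_def
      by (subst Abs_multiset_inverse)
        (auto intro!: finite_subset[of _ "set_mset A"] simp: odd_pos simp flip: count_greater_zero_iff odd_iff_mod_2_eq_one)
    have A_eq: "A = C + C + D" 
    proof (rule multiset_eqI)
      fix x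
      show "count A x = count (C + C + D) x" by (simp add: cC cD) presburger
    qed
    have sub: "set_mset C \<subseteq> I" "set_mset D \<subseteq> I"
      using A unfolding A_eq by (auto simp: words_def)
    define k where "k = sum_mset (image_mset w C)"
    have wt: "k + k + sum_mset (image_mset w D) = n"
      using A unfolding A_eq k_def by (auto simp: words_def)
    have "C \<in> words k" "D \<in> squarefree_words (n - 2 * k)"
      using sub wt by (auto simp: words_def squarefree_words_def cD k_def[symmetric])
    then have "(k, C, D) \<in> ?P" using wt by auto
    then show "A \<in> ?h ` ?P" using A_eq by (intro image_eqI[rotated]) auto
  qed
  have "q ^ n = card (?h ` ?P)" by (simp add: img card_words_eq)
  also have "\<dots> = card ?P" by (rule card_image[OF inj])
  also have "\<dots> = (\<Sum>k\<in>{k. 2 * k \<le> n}. card (words k \<times> squarefree_words (n - 2 * k)))"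
    by (rule card_SigmaI) (use fin finite_words finS in auto)
  finally show ?thesis by (simp add: card_cartesian_product card_words_eq)
qed

text \<open>In the recursion for n the terms with k > 0 are q times the recursion for n - 2, that is
  q^(n-1). For n < 2 every word is squarefree and the formula would fail.\<close>

lemma card_squarefree_words:
  assumes "n \<ge> 2"
  shows "card (squarefree_words n) = q ^ n - q ^ (n - 1)"
proof -
  obtain m where n: "n = m + 2" using assms by (metis add.commute le_Suc_ex)
  have set: "{k. 2 * k \<le> n} = insert 0 (Suc ` {k. 2 * k \<le> m})"
  proof (intro equalityI subsetI)
    fix k assume "k \<in> {k. 2 * k \<le> n}"
    then show "k \<in> insert 0 (Suc ` {k. 2 * k \<le> m})"
      by (cases k) (auto simp: n)
  qed (auto simp: n)
  have fin: "finite {k. 2 * k \<le> m}" by (rule finite_subset[of _ "{..m}"]) auto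
  have "q ^ n = (\<Sum>k\<in>insert 0 (Suc ` {k. 2 * k \<le> m}). q ^ k * card (squarefree_words (n - 2 * k)))"
    using card_squarefree_words_recursion[of n] unfolding set by simp
  also have "\<dots> = card (squarefree_words n)
      + (\<Sum>k\<in>{k. 2 * k \<le> m}. q ^ Suc k * card (squarefree_words (n - 2 * Suc k)))"
    by (subst sum.insert) (use fin in \<open>auto simp: sum.reindex\<close>)
  also have "(\<Sum>k\<in>{k. 2 * k \<le> m}. q ^ Suc k * card (squarefree_words (n - 2 * Suc k)))
     = q * (\<Sum>k\<in>{k. 2 * k \<le> m}. q ^ k * card (squarefree_words (m - 2 * k)))"
    unfolding sum_distrib_left n by (intro sum.cong) auto
  also have "\<dots> = q ^ (n - 1)" using card_squarefree_words_recursion[of m] by (simp add: n)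
  finally show ?thesis by simp
qed

text \<open>A squarefree word is a set of letters, so it amounts to an independent choice, for each
  i, of \<open>count \<mu> i\<close> of the letters of weight i.\<close>

lemma card_squarefree_words_of_type:
  assumes \<mu>: "nat_partition n \<mu>"
  shows "card {A \<in> squarefree_words n. image_mset w A = \<mu>} = (\<Prod>i=1..n. card (letters i) choose count \<mu> i)"
proof -
  let ?F = "PiE {1..n} (\<lambda>i. {T. T \<subseteq> letters i \<and> card T = count \<mu> i})"
  let ?h = "\<lambda>A. restrict (\<lambda>i. {x \<in> set_mset A. w x = i}) {1..n}"
  let ?g = "\<lambda>T. mset_set (\<Union>i\<in>{1..n}. T i)"
  have \<mu>_le: "i \<in> {1..n}" if "i \<in># \<mu>" for i
    using \<mu> that unfolding nat_partition_def by (auto dest!: multi_member_split simp: Suc_le_eq intro: gr0I)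
  have count_img: "count (image_mset w (mset_set S)) i = card {x \<in> S. w x = i}" if "finite S" for S i
    using that by (auto simp: count_image_mset intro!: arg_cong[of _ _ card])
  have "bij_betw ?h {A \<in> squarefree_words n. image_mset w A = \<mu>} ?F"
  proof (rule bij_betwI[where g = ?g])
    show "?h \<in> {A \<in> squarefree_words n. image_mset w A = \<mu>} \<rightarrow> ?F"
    proof (rule funcsetI)
      fix A assume A: "A \<in> {A \<in> squarefree_words n. image_mset w A = \<mu>}"
      have A': "A = mset_set (set_mset A)"
        using A by (intro mset_eq_mset_set) (auto simp: squarefree_words_def)
      have "card {x \<in> set_mset A. w x = i} = count \<mu> i" for i
        using A count_img[of "set_mset A" i] by (simp flip: A')
      then show "?h A \<in> ?F"
        using A by (auto simp: letters_def squarefree_words_def words_def)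
    qed
    show "?g \<in> ?F \<rightarrow> {A \<in> squarefree_words n. image_mset w A = \<mu>}"
    proof (rule funcsetI)
      fix T assume T: "T \<in> ?F"
      have sub: "T i \<subseteq> letters i" "card (T i) = count \<mu> i" if "i \<in> {1..n}" for i
        using T that by (auto simp: PiE_iff)
      have fin: "finite (\<Union>i\<in>{1..n}. T i)"
        using sub finite_letters by (meson finite_UN_I finite_atLeastAtMost finite_subset)
      have "image_mset w (?g T) = \<mu>"
      proof (rule multiset_eqI)
        fix i
        show "count (image_mset w (?g T)) i = count \<mu> i"
        proof (cases "i \<in> {1..n}")
          case True
          then have "{x \<in> (\<Union>i\<in>{1..n}. T i). w x = i} = T i"
            using sub by (fastforce simp: letters_def)
          then show ?thesis using sub(2)[OF True] count_img[OF fin] by simp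
        next
          case False
          then have "{x \<in> (\<Union>i\<in>{1..n}. T i). w x = i} = {}"
            using sub by (fastforce simp: letters_def)
          then show ?thesis using False \<mu>_le count_img[OF fin] by (metis card.empty not_in_iff)
        qed
      qed
      moreover have "set_mset (?g T) \<subseteq> I" using fin sub by (fastforce simp: letters_def)
      ultimately show "?g T \<in> {A \<in> squarefree_words n. image_mset w A = \<mu>}"
        using \<mu> by (auto simp: squarefree_words_def words_def nat_partition_def count_mset_set')
    qed
    fix A assume A: "A \<in> {A \<in> squarefree_words n. image_mset w A = \<mu>}"
    have A': "A = mset_set (set_mset A)"
      using A by (intro mset_eq_mset_set) (auto simp: squarefree_words_def)
    have "w x \<in> {1..n}" if "x \<in># A" for x
      using A that \<mu>_le[of "w x"] by auto
    then have "(\<Union>i\<in>{1..n}. ?h A i) = set_mset A" by auto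
    then show "?g (?h A) = A" using A' by simp
  next
    fix T assume T: "T \<in> ?F"
    have sub: "T i \<subseteq> letters i" if "i \<in> {1..n}" for i
      using T that by (auto simp: PiE_iff)
    have fin: "finite (\<Union>i\<in>{1..n}. T i)"
      using sub finite_letters by (meson finite_UN_I finite_atLeastAtMost finite_subset)
    show "?h (?g T) = T"
    proof (rule ext)
      fix i
      show "?h (?g T) i = T i"
      proof (cases "i \<in> {1..n}")
        case True
        then have "{x \<in> (\<Union>i\<in>{1..n}. T i). w x = i} = T i"
          using sub by (fastforce simp: letters_def)
        then show ?thesis using fin True by simp
      next
        case False
        then show ?thesis using T by (auto simp: PiE_iff extensional_def)
      qed
    qed
  qed
  from bij_betw_same_card[OF this]
  show ?thesis by (simp add: card_PiE n_subsets finite_letters)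
qed

end

section \<open>Moebius inversion and the necklace formula\<close>

lemma sum_Pow_minus_one_card:
  assumes "finite A" "A \<noteq> {}"
  shows "(\<Sum>S\<in>Pow A. (-1) ^ card S) = (0 :: int)"
proof -
  obtain a where a: "a \<in> A" using assms by auto
  define B where "B = A - {a}"
  have A: "A = insert a B" "a \<notin> B" "finite B" using a assms by (auto simp: B_def)
  \<comment> \<open>Subsets without \<open>a\<close> cancel against the same subsets with
    \<open>a\<close> added.\<close>
  have "(\<Sum>S\<in>Pow A. (-1) ^ card S) = (\<Sum>S\<in>Pow B. (-1) ^ card S) + (\<Sum>S\<in>insert a ` Pow B. (-1 :: int) ^ card S)"
    unfolding A(1) Pow_insert by (rule sum.union_disjoint) (use A in auto)
  also have "(\<Sum>S\<in>insert a ` Pow B. (-1 :: int) ^ card S) = (\<Sum>S\<in>Pow B. - ((-1) ^ card S))"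
  proof (subst sum.reindex)
    show "inj_on (insert a) (Pow B)" using A by (auto simp: inj_on_def)
    show "sum ((\<lambda>S. (- 1) ^ card S) \<circ> insert a) (Pow B) = (\<Sum>S\<in>Pow B. - ((- 1 :: int) ^ card S))"
    proof (rule sum.cong[OF refl])
      fix S assume "S \<in> Pow B"
      then have "finite S" "a \<notin> S" using A finite_subset by auto
      then show "((\<lambda>S. (- 1) ^ card S) \<circ> insert a) S = - ((- 1 :: int) ^ card S)" by simp
    qed
  qed
  finally show ?thesis by (simp add: sum_negf)
qed

text \<open>Only squarefree divisors contribute, and \<open>prime_factors\<close> identifies them
  with the subsets of the prime factors of n; the alternating sum over these vanishes unless n has
  no prime factor.\<close>

lemma sum_moebius_mu:
  assumes "n > 0"
  shows "(\<Sum>d | d dvd n. moebius_mu d) = (if n = 1 then 1 else 0)"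
proof -
  have fin: "finite {d. d dvd n}" using assms by simp
  have pf_prod: "prime_factors (\<Prod>S) = S" if "S \<subseteq> prime_factors n" for S
  proof -
    have "finite S" using that finite_subset by blast
    moreover have "\<forall>p\<in>S. prime p" using that by auto
    ultimately show ?thesis
      by (subst prime_factors_prod) (auto simp: prime_prime_factors)
  qed
  have sqf_prod: "squarefree (\<Prod>S)" if "S \<subseteq> prime_factors n" for S
  proof -
    have "finite S" using that finite_subset by blast
    then show ?thesis using that
      by (intro squarefree_prod_coprime)
        (auto intro: squarefree_prime primes_coprime)
  qed
  have "(\<Sum>d | d dvd n. moebius_mu d) = (\<Sum>d\<in>{d. d dvd n \<and> squarefree d}. (-1) ^ card (prime_factors d))"
    using fin by (intro sum.mono_neutral_cong_right) (auto simp: moebius_mu_def)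
  also have "\<dots> = (\<Sum>S\<in>Pow (prime_factors n). (-1) ^ card S)"
  proof (rule sum.reindex_bij_witness[where i = "\<lambda>S. \<Prod>S" and j = prime_factors])
    fix d assume d: "d \<in> {d. d dvd n \<and> squarefree d}"
    then have d0: "d \<noteq> 0" using assms by (auto intro!: Nat.gr0I)
    have "d = (\<Prod>p\<in>prime_factors d. p ^ multiplicity p d)"
      using d0 by (intro prime_factorization_nat) simp
    also have "\<dots> = (\<Prod>p\<in>prime_factors d. p)"
    proof (rule prod.cong[OF refl])
      fix p assume p: "p \<in> prime_factors d"
      then have "multiplicity p d > 0" using d0 by (auto simp: prime_factors_multiplicity)
      moreover have "multiplicity p d \<le> 1"
        using d p d0 by (auto simp: squarefree_factorial_semiring')
      ultimately show "p ^ multiplicity p d = p" by (simp add: le_Suc_eq)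
    qed
    finally show "\<Prod>(prime_factors d) = d" by simp
    show "prime_factors d \<in> Pow (prime_factors n)"
      using d assms dvd_prime_factors[of n d] by blast
  next
    fix S assume S: "S \<in> Pow (prime_factors n)"
    then show "prime_factors (\<Prod>S) = S" using pf_prod by auto
    have finS: "finite S" using S finite_subset by blast
    have "\<Prod>S dvd \<Prod>(prime_factors n)" using S by (intro prod_dvd_prod_subset) auto
    also have "\<dots> dvd (\<Prod>p\<in>prime_factors n. p ^ multiplicity p n)"
      using assms by (intro prod_dvd_prod) (auto simp: prime_factors_multiplicity)
    also have "\<dots> = n" using prime_factorization_nat[OF assms] by (rule sym)
    finally show "\<Prod>S \<in> {d. d dvd n \<and> squarefree d}" using sqf_prod S by auto
  qed auto
  also have "\<dots> = (if n = 1 then 1 else 0)"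
  proof (cases "n = 1")
    case False
    then have "prime_factors n \<noteq> {}" using assms
      by (metis empty_iff in_prime_factors_iff less_numeral_extra(3) prime_factor_nat)
    then show ?thesis using False sum_Pow_minus_one_card[of "prime_factors n"] by simp
  qed simp
  finally show ?thesis .
qed

text \<open>Moebius inversion for an arbitrary sequence \<open>N\<close>: the divisor sums determine
  it, so the number of irreducible polynomials of degree n must be the necklace value.\<close>

lemma necklace_unique:
  fixes N :: "nat \<Rightarrow> nat"
  assumes N: "\<And>m. m > 0 \<Longrightarrow> (\<Sum>d | d dvd m. d * N d) = q ^ m" and n: "n > 0"
  shows "real (N n) = necklace n (real q)"
proof -
  have fin: "finite {d. d dvd m}" if "m > 0" for m :: nat using that by simp
  have "(\<Sum>d | d dvd n. of_int (moebius_mu d) * real q ^ (n div d))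
      = (\<Sum>d | d dvd n. \<Sum>e | e dvd n div d. of_int (moebius_mu d) * (real e * real (N e)))"
  proof (rule sum.cong[OF refl])
    fix d assume d: "d \<in> {d. d dvd n}"
    then have "n div d > 0" using n by (auto elim!: dvdE)
    from N[OF this] have "real q ^ (n div d) = (\<Sum>e | e dvd n div d. real e * real (N e))"
      by (metis (no_types, lifting) of_nat_mult of_nat_power of_nat_sum sum.cong)
    then show "of_int (moebius_mu d) * real q ^ (n div d)
       = (\<Sum>e | e dvd n div d. of_int (moebius_mu d) * (real e * real (N e)))"
      by (simp add: sum_distrib_left)
  qed
  also have "\<dots> = (\<Sum>(d, e)\<in>(SIGMA d:{d. d dvd n}. {e. e dvd n div d}). of_int (moebius_mu d) * (real e * real (N e)))"
    by (rule sum.Sigma) (use n in \<open>auto elim!: dvdE\<close>)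
  \<comment> \<open>The condition that d e divides n is symmetric in d and e. After the swap the
    inner Moebius sum vanishes unless e = n.\<close>
  also have "\<dots> = (\<Sum>(e, d)\<in>(SIGMA e:{e. e dvd n}. {d. d dvd n div e}). of_int (moebius_mu d) * (real e * real (N e)))"
  proof (rule sum.reindex_bij_witness[where i = "\<lambda>(e, d). (d, e)" and j = "\<lambda>(d, e). (e, d)"])
    fix x assume "x \<in> (SIGMA d:{d. d dvd n}. {e. e dvd n div d})"
    then show "(case x of (d, e) \<Rightarrow> (e, d)) \<in> (SIGMA e:{e. e dvd n}. {d. d dvd n div e})"
      using n by (auto elim!: dvdE)
  next
    fix x assume "x \<in> (SIGMA e:{e. e dvd n}. {d. d dvd n div e})"
    then show "(case x of (e, d) \<Rightarrow> (d, e)) \<in> (SIGMA d:{d. d dvd n}. {e. e dvd n div d})"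
      using n by (auto elim!: dvdE)
  qed auto
  also have "\<dots> = (\<Sum>e | e dvd n. \<Sum>d | d dvd n div e. of_int (moebius_mu d) * (real e * real (N e)))"
    by (rule sum.Sigma[symmetric]) (use n in \<open>auto elim!: dvdE\<close>)
  also have "\<dots> = (\<Sum>e | e dvd n. if e = n then real e * real (N e) else 0)"
  proof (rule sum.cong[OF refl])
    fix e assume e: "e \<in> {e. e dvd n}"
    then have "n div e > 0" using n by (auto elim!: dvdE)
    from sum_moebius_mu[OF this]
    have "(\<Sum>d | d dvd n div e. of_int (moebius_mu d) :: real) = (if n div e = 1 then 1 else 0)"
      by (metis (mono_tags) of_int_0 of_int_1 of_int_sum)
    moreover have "n div e = 1 \<longleftrightarrow> e = n" using e n by auto
    ultimately show "(\<Sum>d | d dvd n div e. of_int (moebius_mu d) * (real e * real (N e)))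
       = (if e = n then real e * real (N e) else 0)"
      by (simp flip: sum_distrib_right)
  qed
  also have "\<dots> = real n * real (N n)" using n by (subst sum.delta) auto
  finally show ?thesis using n by (simp add: necklace_def)
qed

section \<open>Unique factorization modulo a prime\<close>

text \<open>The lower coefficients are free and independent. Sets \<open>S j\<close> depending on
  the index cover the box, the reduced residues and a residue class inside the box alike.\<close>

lemma card_monic_with_coeffs:
  fixes S :: "nat \<Rightarrow> int set"
  shows "card {f :: int poly. degree f = n \<and> lead_coeff f = 1 \<and> (\<forall>j<n. coeff f j \<in> S j)} = (\<Prod>j<n. card (S j))"
proof -
  define P where "P c = (\<Sum>j<n. monom (c j) j) + monom 1 n" for c :: "nat \<Rightarrow> int"
  have coeff_P: "coeff (P c) i = (if i < n then c i else if i = n then 1 else 0)" for c i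
    by (simp add: P_def coeff_sum sum.delta')
  have deg_P: "degree (P c) = n" for c
  proof (rule antisym)
    show "degree (P c) \<le> n" by (rule degree_le) (simp add: coeff_P)
    show "n \<le> degree (P c)" by (rule le_degree) (simp add: coeff_P)
  qed
  have "bij_betw (\<lambda>f. restrict (coeff f) {..<n})
      {f. degree f = n \<and> lead_coeff f = 1 \<and> (\<forall>j<n. coeff f j \<in> S j)} (PiE {..<n} S)"
  proof (rule bij_betwI[where g = P])
    show "P \<in> PiE {..<n} S \<rightarrow> {f. degree f = n \<and> lead_coeff f = 1 \<and> (\<forall>j<n. coeff f j \<in> S j)}"
    proof (rule funcsetI)
      fix c assume "c \<in> PiE {..<n} S"
      then have "c j \<in> S j" if "j < n" for j using that by (auto simp: PiE_iff)
      then show "P c \<in> {f. degree f = n \<and> lead_coeff f = 1 \<and> (\<forall>j<n. coeff f j \<in> S j)}"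
        by (simp add: deg_P coeff_P)
    qed
  next
    fix f :: "int poly" assume f: "f \<in> {f. degree f = n \<and> lead_coeff f = 1 \<and> (\<forall>j<n. coeff f j \<in> S j)}"
    show "P (restrict (coeff f) {..<n}) = f"
    proof (rule poly_eqI)
      fix i
      show "coeff (P (restrict (coeff f) {..<n})) i = coeff f i"
        using f by (cases i n rule: linorder_cases) (auto simp: coeff_P coeff_eq_0)
    qed
  next
    fix c assume c: "c \<in> PiE {..<n} S"
    show "restrict (coeff (P c)) {..<n} = c"
    proof
      fix i
      show "restrict (coeff (P c)) {..<n} i = c i"
        using c by (cases "i < n") (auto simp: coeff_P PiE_iff extensional_def)
    qed
  qed auto
  from bij_betw_same_card[OF this] show ?thesis by (simp add: card_PiE)
qed

lemma degree_prod_mset_monic: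
  fixes A :: "int poly multiset"
  assumes "\<And>a. a \<in># A \<Longrightarrow> lead_coeff a = 1"
  shows "degree (prod_mset A) = sum_mset (image_mset degree A)"
  using assms
proof (induction A)
  case (add x A)
  have "lead_coeff (prod_mset A) = 1" using add.prems by (intro monic_prod_mset) auto
  then have "prod_mset A \<noteq> 0" by (metis leading_coeff_0_iff zero_neq_one)
  moreover have "x \<noteq> 0" using add.prems[of x] by auto
  ultimately show ?case using add by (simp add: degree_mult_eq)
qed auto

text \<open>Pseudo-division scales \<open>f\<close> by a power of the leading coefficient of
  \<open>g\<close>, here 1. Euclidean arguments modulo p can thus run on integer
  representatives.\<close>

lemma monic_division:
  fixes f g :: "int poly"
  assumes "lead_coeff g = 1"
  obtains s r where "f = g * s + r" "r = 0 \<or> degree r < degree g"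
proof -
  obtain s r where sr: "pseudo_divmod f g = (s, r)" by force
  have "g \<noteq> 0" using assms by auto
  from pseudo_divmod[OF this sr] assms show thesis by (intro that[of s r]) auto
qed

context poly_mod_prime
begin

lemma Mp_eq_0_iff_dvd: "Mp f = 0 \<longleftrightarrow> [:p:] dvd f"
  by (auto simp: poly_eq_iff Mp_coeff M_def const_poly_dvd_iff dvd_eq_mod_eq_0)

text \<open>A congruence in the form of an equation in Z[x] can be differentiated and evaluated at
  algebraic integers.\<close>

lemma eq_m_iff: "Mp f = Mp g \<longleftrightarrow> (\<exists>k. f = g + [:p:] * k)"
proof -
  have "Mp f = Mp g \<longleftrightarrow> [:p:] dvd f - g"
    by (auto simp: poly_eq_iff Mp_coeff M_def const_poly_dvd_iff mod_eq_dvd_iff)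
  then show ?thesis by (auto simp: dvd_def algebra_simps)
qed

lemma eq_mI: "f = g + [:p:] * k \<Longrightarrow> Mp f = Mp g"
  unfolding eq_m_iff by blast

lemma dvdm_iff: "f dvdm g \<longleftrightarrow> (\<exists>h k. g = f * h + [:p:] * k)"
  unfolding dvdm_def eq_m_iff ..

lemma dvdm_refl': "f dvdm f"
  unfolding dvdm_def by (intro exI[of _ 1]) simp

lemma dvdm_trans': "f dvdm g \<Longrightarrow> g dvdm h \<Longrightarrow> f dvdm h"
proof -
  assume "f dvdm g" "g dvdm h"
  then obtain a b c d where "g = f * a + [:p:] * b" "h = g * c + [:p:] * d"
    unfolding dvdm_iff by blast
  then have "h = f * (a * c) + [:p:] * (b * c + d)" by (simp add: algebra_simps)
  then show ?thesis unfolding dvdm_iff by blast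
qed

text \<open>Z[x] modulo p is a domain, because a constant prime stays prime in Z[x].\<close>

lemma Mp_mult_eq_0: "Mp (f * g) = 0 \<Longrightarrow> Mp f = 0 \<or> Mp g = 0"
proof -
  have "prime_elem [:p:]" unfolding prime_elem_const_poly_iff using prime by (rule prime_imp_prime_elem)
  then show "Mp (f * g) = 0 \<Longrightarrow> Mp f = 0 \<or> Mp g = 0"
    unfolding Mp_eq_0_iff_dvd by (simp add: prime_elem_dvd_mult_iff)
qed

lemma Mp_monic_nonzero: "lead_coeff f = 1 \<Longrightarrow> Mp f \<noteq> 0"
  using monic_Mp[of f] by auto

text \<open>\<open>c\<close> inverts the leading coefficient modulo p. Its inverse \<open>d\<close>
  is returned as well, so that a cofactor can be rescaled and a product kept unchanged modulo
  p.\<close>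

lemma make_monic:
  assumes "Mp f \<noteq> 0"
  obtains c d where "p dvd c * d - 1" "lead_coeff (Mp (smult c f)) = 1"
    "degree (Mp (smult c f)) = degree (Mp f)"
proof -
  define l where "l = lead_coeff (Mp f)"
  have l: "l \<noteq> 0" using assms by (simp only: l_def leading_coeff_0_iff not_False_eq_True)
  have Ml_l: "M l = l" by (simp add: l_def Mp_coeff)
  have "\<not> p dvd l" using l Ml_l unfolding M_def by (metis dvd_imp_mod_0)
  then have "Rings.coprime p l" using prime by (simp add: prime_imp_coprime)
  then obtain u v where uv: "u * p + v * l = 1"
    using bezout_int[of p l] by (auto simp: coprime_iff_gcd_eq_1)
  have Ml: "M (v * l) = 1"
  proof -
    have "v * l = 1 - u * p" using uv by simp
    then have "M (v * l) = M 1" unfolding M_def by (metis mod_diff_eq mod_mult_self2_is_0 diff_zero mod_mod_trivial)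
    then show ?thesis by simp
  qed
  have cf: "coeff (Mp (smult v f)) i = M (v * coeff (Mp f) i)" for i
    by (simp add: Mp_coeff)
  have top: "coeff (Mp (smult v f)) (degree (Mp f)) = 1"
    using Ml unfolding cf l_def .
  have deg: "degree (Mp (smult v f)) = degree (Mp f)"
  proof (rule antisym)
    show "degree (Mp (smult v f)) \<le> degree (Mp f)"
      by (rule degree_le) (auto simp: cf coeff_eq_0)
  qed (use top in \<open>auto intro: le_degree\<close>)
  have "p dvd v * l - 1"
    using uv by (metis add_diff_cancel_right' dvd_minus_iff dvd_triv_right minus_diff_eq add.commute)
  with top deg show thesis by (intro that[of v l]) auto
qed

text \<open>A monic factor cannot lose its leading term modulo p, so degrees add and leading
  coefficients multiply for the reduced cofactor.\<close>

lemma eq_m_monic_factor: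
  assumes f: "lead_coeff f = 1" and g: "lead_coeff g = 1" and eq: "Mp f = Mp (g * k)"
  shows "lead_coeff (Mp k) = 1" "degree f = degree g + degree (Mp k)"
proof -
  have "Mp f = Mp (g * Mp k)" using eq by simp
  have k0: "Mp k \<noteq> 0"
  proof
    assume "Mp k = 0"
    then have "Mp (g * Mp k) = 0" by simp
    then show False using \<open>Mp f = Mp (g * Mp k)\<close> Mp_monic_nonzero[OF f] by simp
  qed
  have g0: "g \<noteq> 0" using g by auto
  have deg: "degree (g * Mp k) = degree g + degree (Mp k)"
    using g0 k0 by (rule degree_mult_eq)
  have lc: "lead_coeff (g * Mp k) = lead_coeff (Mp k)"
    using g by (simp add: lead_coeff_mult)
  have Ml: "M (lead_coeff (Mp k)) = lead_coeff (Mp k)" by (simp add: Mp_coeff)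
  have "degree (Mp (g * Mp k)) = degree (g * Mp k)"
    by (rule degree_m_eq[OF _ m1]) (use k0 Ml lc in \<open>simp add: M_def\<close>)
  then have d: "degree (Mp f) = degree g + degree (Mp k)"
    using deg \<open>Mp f = Mp (g * Mp k)\<close> by simp
  then show "degree f = degree g + degree (Mp k)" using f by simp
  have "1 = lead_coeff (Mp f)" using f monic_Mp by simp
  also have "\<dots> = M (lead_coeff (g * Mp k))"
    unfolding \<open>Mp f = Mp (g * Mp k)\<close> using deg d \<open>Mp f = Mp (g * Mp k)\<close>
    by (simp add: Mp_coeff del: mult_Mp)
  also have "\<dots> = lead_coeff (Mp k)" using lc Ml by simp
  finally show "lead_coeff (Mp k) = 1" by simp
qed

text \<open>A monic combination \<open>h\<close> of \<open>g\<close> and \<open>f\<close> modulo p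
  of least degree divides both. As \<open>g\<close> is irreducible, \<open>h\<close> is a unit or an
  associate of \<open>g\<close>, and in the latter case \<open>g\<close> would divide
  \<open>f\<close>.\<close>

lemma bezout_m:
  assumes g: "lead_coeff g = 1" "irreducible_m g" and ndvd: "\<not> g dvdm f"
  obtains u v k where "u * g + v * f = 1 + [:p:] * k"
proof -
  define J where "J d \<longleftrightarrow> (\<exists>h u v. lead_coeff h = 1 \<and> degree h = d \<and> Mp h = Mp (u * g + v * f))" for d
  have "J (degree g)" unfolding J_def using g
    by (intro exI[of _ g] exI[of _ 1] exI[of _ 0]) auto
  then have "J (LEAST d. J d)" by (rule LeastI)
  then obtain h u v where h: "lead_coeff h = 1" "degree h = (LEAST d. J d)"
    and eq: "Mp h = Mp (u * g + v * f)" unfolding J_def by auto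
  obtain e where e: "h = u * g + v * f + [:p:] * e" using eq unfolding eq_m_iff by blast
  have dvd: "h dvdm a * g + b * f" for a b
  proof -
    obtain s r where sr: "a * g + b * f = h * s + r" "r = 0 \<or> degree r < degree h"
      using monic_division[OF h(1)] by blast
    have "Mp r = 0"
    proof (rule ccontr)
      \<comment> \<open>A nonzero remainder, made monic, would be a combination of smaller
        degree.\<close>
      assume r0: "Mp r \<noteq> 0"
      then obtain c d where c: "lead_coeff (Mp (smult c r)) = 1" "degree (Mp (smult c r)) = degree (Mp r)"
        using make_monic by blast
      have lin: "z * (a * g + b * f - (u * g + v * f + y * e) * s)
          = (z * (a - u * s)) * g + (z * (b - v * s)) * f + y * (z * (- e * s))" for y z :: "int poly"
        by (simp add: algebra_simps)
      have r: "r = a * g + b * f - (u * g + v * f + [:p:] * e) * s" using sr(1) unfolding e[symmetric] by simp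
      have "[:c:] * r = ([:c:] * (a - u * s)) * g + ([:c:] * (b - v * s)) * f + [:p:] * ([:c:] * (- e * s))"
        unfolding r by (rule lin)
      from eq_mI[OF this] have "Mp (Mp (smult c r)) = Mp (([:c:] * (a - u * s)) * g + ([:c:] * (b - v * s)) * f)"
        by simp
      then have "J (degree (Mp r))" unfolding J_def using c by blast
      then have "(LEAST d. J d) \<le> degree (Mp r)" by (rule Least_le)
      moreover have "degree (Mp r) \<le> degree r" by (rule degree_m_le)
      moreover have "r \<noteq> 0" using r0 by auto
      ultimately show False using sr(2) h(2) by auto
    qed
    then obtain k where "r = [:p:] * k" unfolding Mp_eq_0_iff_dvd by blast
    then show ?thesis unfolding dvdm_iff using sr(1) by blast
  qed
  have hg: "h dvdm g" and hf: "h dvdm f" using dvd[of 1 0] dvd[of 0 1] by simp_all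
  then obtain k where k: "Mp g = Mp (h * k)" unfolding dvdm_def by blast
  then have "h dvdm 1 \<or> k dvdm 1" using g(2) unfolding irreducible_m_def by blast
  then show thesis
  proof
    assume "h dvdm 1"
    then obtain s t where "1 = h * s + [:p:] * t" unfolding dvdm_iff by blast
    then have "(u * s) * g + (v * s) * f = 1 + [:p:] * (- e * s - t)"
      unfolding e by (simp add: algebra_simps)
    then show thesis by (rule that)
  next
    assume "k dvdm 1"
    then obtain s t where st: "1 = k * s + [:p:] * t" unfolding dvdm_iff by blast
    obtain k' where k': "g = h * k + [:p:] * k'" using k unfolding eq_m_iff by blast
    have "h = h * 1" by simp
    also have "\<dots> = g * s + [:p:] * (h * t - k' * s)"
      unfolding st k' by (simp add: algebra_simps)
    finally have "g dvdm h" unfolding dvdm_iff by blast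
    then show thesis using hf ndvd dvdm_trans' by blast
  qed
qed

text \<open>Euclid's lemma: multiply the Bezout relation between \<open>g\<close> and
  \<open>b\<close> by \<open>a\<close>.\<close>

lemma irreducible_m_dvdm_mult:
  assumes g: "lead_coeff g = 1" "irreducible_m g" and dvd: "g dvdm a * b"
  shows "g dvdm a \<or> g dvdm b"
proof (rule disjCI)
  assume "\<not> g dvdm b"
  from bezout_m[OF g this] obtain u v k where uv: "u * g + v * b = 1 + [:p:] * k" .
  obtain h k' where h: "a * b = g * h + [:p:] * k'" using dvd unfolding dvdm_iff by blast
  have "a = (u * g + v * b - [:p:] * k) * a" using uv by simp
  also have "\<dots> = g * (u * a) + v * (a * b) - [:p:] * k * a" by (simp add: algebra_simps)
  also have "\<dots> = g * (u * a + v * h) + [:p:] * (v * k' - k * a)" unfolding h by (simp add: algebra_simps)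
  finally show "g dvdm a" unfolding dvdm_iff by blast
qed

text \<open>Reduced monic representatives turn association of irreducibles into equality, so that
  factorizations can be literal multisets.\<close>

definition monic_irr :: "int poly set" where
  "monic_irr = {g. Mp g = g \<and> lead_coeff g = 1 \<and> irreducible_m g}"

lemma monic_irrD:
  assumes "g \<in> monic_irr"
  shows "Mp g = g" "lead_coeff g = 1" "irreducible_m g" "\<not> g dvdm 1" "degree g > 0"
proof -
  show g: "Mp g = g" "lead_coeff g = 1" "irreducible_m g" "\<not> g dvdm 1"
    using assms by (auto simp: monic_irr_def irreducible_m_def)
  show "degree g > 0"
  proof (rule ccontr)
    assume "\<not> degree g > 0"
    then have "g = 1" using g(2) by (auto elim!: degree_eq_zeroE)
    then show False using g(4) dvdm_refl' by simp
  qed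
qed

lemma monic_irr_dvdm_prod_mset:
  assumes g: "g \<in> monic_irr" and "g dvdm prod_mset A"
  shows "\<exists>a\<in>#A. g dvdm a"
  using assms(2)
proof (induction A)
  case empty
  then show ?case using monic_irrD[OF g] by simp
next
  case (add a A)
  then show ?case using irreducible_m_dvdm_mult[OF monic_irrD(2,3)[OF g], of a "prod_mset A"] by auto
qed

lemma monic_unit:
  assumes "lead_coeff k = 1" "k dvdm 1"
  shows "k = 1"
proof -
  obtain s where "Mp 1 = Mp (k * s)" using assms(2) by (auto simp: dvdm_def)
  from eq_m_monic_factor(2)[OF _ assms(1) this] have "degree k = 0" by simp
  then show ?thesis using assms(1) by (auto elim!: degree_eq_zeroE)
qed

lemma monic_irr_dvdm_eq:
  assumes g: "g \<in> monic_irr" and h: "h \<in> monic_irr" and dvd: "g dvdm h"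
  shows "g = h"
proof -
  obtain k where k: "Mp h = Mp (g * k)" using dvd by (auto simp: dvdm_def)
  have "g dvdm 1 \<or> k dvdm 1"
    using monic_irrD(3)[OF h] k unfolding irreducible_m_def by blast
  then have "Mp k dvdm 1" using monic_irrD(4)[OF g] by simp
  moreover have "lead_coeff (Mp k) = 1"
    by (rule eq_m_monic_factor(1)[OF _ _ k]) (use g h monic_irrD in auto)
  ultimately have "Mp k = 1" by (rule monic_unit[rotated])
  moreover have "h = Mp (g * Mp k)" using k monic_irrD(1)[OF h] by simp
  ultimately show ?thesis using monic_irrD(1)[OF g] by simp
qed

text \<open>A monic divisor of \<open>f\<close> modulo p of least positive degree is
  irreducible.\<close>

lemma monic_irr_factor_exists:
  assumes f: "lead_coeff f = 1" and deg: "degree f > 0"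
  obtains g k where "g \<in> monic_irr" "Mp f = Mp (g * k)" "lead_coeff k = 1" "degree k < degree f"
proof -
  define D where "D d \<longleftrightarrow> d > 0 \<and> (\<exists>h. lead_coeff h = 1 \<and> degree h = d \<and> h dvdm f)" for d
  have "D (degree f)" unfolding D_def using f deg dvdm_refl' by blast
  then have "D (LEAST d. D d)" by (rule LeastI)
  then obtain h where h: "lead_coeff h = 1" "degree h = (LEAST d. D d)" "degree h > 0" "h dvdm f"
    unfolding D_def by auto
  have min: "degree h \<le> degree a" if "lead_coeff a = 1" "a dvdm f" "degree a > 0" for a
    unfolding h(2) by (rule Least_le) (use that in \<open>auto simp: D_def\<close>)
  have "irreducible_m h"
    unfolding irreducible_m_def
  proof (intro conjI allI impI)
    show "\<not> h =m 0" using Mp_monic_nonzero[OF h(1)] by simp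
    show "\<not> h dvdm 1" using monic_unit[OF h(1)] h(3) by auto
    fix a b assume ab: "h =m a * b"
    have "Mp a \<noteq> 0"
    proof
      assume "Mp a = 0"
      then have "Mp (Mp a * b) = 0" by simp
      then show False using ab Mp_monic_nonzero[OF h(1)] by simp
    qed
    then obtain c d where c: "p dvd c * d - 1" "lead_coeff (Mp (smult c a)) = 1"
      using make_monic by blast
    \<comment> \<open>\<open>c\<close> makes \<open>a\<close> monic and its inverse \<open>d\<close>
      compensates in \<open>b\<close>, so that minimality of the degree of \<open>h\<close> applies
      to the factor \<open>a'\<close>.\<close>
    define a' where "a' = Mp (smult c a)"
    define b' where "b' = smult d b"
    obtain e where e: "c * d = 1 + p * e" using c(1) by (metis dvd_def diff_add_cancel add.commute)
    have "smult c a * smult d b = a * b + [:p:] * (smult e (a * b))"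
      by (simp add: e smult_add_left mult.commute smult_smult)
    then have "Mp (smult c a * smult d b) = Mp (a * b)" by (rule eq_mI)
    then have h': "Mp h = Mp (a' * b')" using ab by (simp add: a'_def b'_def del: mult_smult_left mult_smult_right)
    note fac = eq_m_monic_factor[OF h(1) c(2)[folded a'_def] h']
    have "a' dvdm f" using h' h(4) dvdm_trans'[of a' h f] unfolding dvdm_def by blast
    show "a dvdm 1 \<or> b dvdm 1"
    proof (cases "degree a' = 0")
      case True
      then have "a' = 1" using c(2)[folded a'_def] by (auto elim!: degree_eq_zeroE)
      then have "Mp 1 = Mp (a * [:c:])" by (simp add: a'_def mult.commute)
      then show ?thesis unfolding dvdm_def by blast
    next
      case False
      then have "degree h \<le> degree a'" using min c(2)[folded a'_def] \<open>a' dvdm f\<close> by simp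
      then have "degree (Mp b') = 0" using fac(2) by simp
      then have "Mp b' = 1" using fac(1) by (auto elim!: degree_eq_zeroE)
      then have "Mp 1 = Mp (b * [:d:])" by (simp add: b'_def mult.commute)
      then show ?thesis unfolding dvdm_def by blast
    qed
  qed
  then have g: "Mp h \<in> monic_irr" unfolding monic_irr_def using monic_Mp[OF h(1)] by simp
  obtain k where k: "Mp f = Mp (h * k)" using h(4) by (auto simp: dvdm_def)
  note fac = eq_m_monic_factor[OF f h(1) k]
  show thesis
    by (rule that[OF g, of "Mp k"]) (use k fac h(3) in auto)
qed

lemma monic_factorization_m_exists:
  assumes "lead_coeff f = 1"
  shows "\<exists>A. set_mset A \<subseteq> monic_irr \<and> Mp f = Mp (prod_mset A)"
  using assms
proof (induction "degree f" arbitrary: f rule: less_induct)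
  case less
  show ?case
  proof (cases "degree f = 0")
    case True
    then have "f = 1" using less.prems by (auto elim!: degree_eq_zeroE)
    then show ?thesis by (intro exI[of _ "{#}"]) auto
  next
    case False
    then obtain g k where gk: "g \<in> monic_irr" "Mp f = Mp (g * k)" "lead_coeff k = 1" "degree k < degree f"
      using monic_irr_factor_exists[OF less.prems] by auto
    from less.hyps[OF gk(4,3)] obtain A where A: "set_mset A \<subseteq> monic_irr" "Mp k = Mp (prod_mset A)"
      by blast
    have "Mp f = Mp (g * Mp k)" using gk(2) by simp
    also have "\<dots> = Mp (prod_mset (add_mset g A))" by (simp add: A(2))
    finally show ?thesis using A(1) gk(1) by (intro exI[of _ "add_mset g A"]) auto
  qed
qed

lemma monic_prod_mset_irr: "set_mset A \<subseteq> monic_irr \<Longrightarrow> lead_coeff (prod_mset A) = 1"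
  by (rule monic_prod_mset) (auto dest: monic_irrD(2))

lemma degree_prod_mset_irr:
  "set_mset A \<subseteq> monic_irr \<Longrightarrow> degree (prod_mset A) = sum_mset (image_mset degree A)"
  by (rule degree_prod_mset_monic) (auto dest: monic_irrD(2))

text \<open>A factor of the first product divides, hence equals, an element of the second multiset,
  and it can be cancelled because Z[x] modulo p is a domain.\<close>

lemma monic_factorization_m_unique:
  assumes "set_mset A \<subseteq> monic_irr" "set_mset B \<subseteq> monic_irr" "Mp (prod_mset A) = Mp (prod_mset B)"
  shows "A = B"
  using assms
proof (induction A arbitrary: B)
  case empty
  have "degree (Mp (prod_mset B)) = 0" by (simp flip: empty.prems(3))
  then have "sum_mset (image_mset degree B) = 0"
    using monic_prod_mset_irr[OF empty.prems(2)] degree_prod_mset_irr[OF empty.prems(2)] by simp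
  moreover have "degree b > 0" if "b \<in># B" for b
    using that empty.prems(2) monic_irrD(5) by auto
  ultimately show ?case by (metis less_irrefl multiset_nonemptyE sum_mset_0_iff multiset.set_map imageI)
next
  case (add x A)
  have x: "x \<in> monic_irr" using add.prems by simp
  have "Mp (prod_mset B) = Mp (x * prod_mset A)" using add.prems(3) by simp
  then have "x dvdm prod_mset B" unfolding dvdm_def by blast
  then obtain b where b: "b \<in># B" "x dvdm b" using monic_irr_dvdm_prod_mset[OF x] by blast
  then have "x = b" using monic_irr_dvdm_eq[OF x] add.prems(2) by auto
  then obtain B' where B: "B = add_mset x B'" using b(1) by (metis mset_add)
  have "Mp (x * (prod_mset A - prod_mset B')) = Mp (Mp (x * prod_mset A) - Mp (x * prod_mset B'))"
    by (simp add: right_diff_distrib)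
  also have "\<dots> = 0" using add.prems(3) unfolding B by simp
  finally have "Mp (prod_mset A - prod_mset B') = 0"
    using Mp_mult_eq_0 Mp_monic_nonzero monic_irrD(2)[OF x] by blast
  then obtain k where "prod_mset A - prod_mset B' = [:p:] * k" unfolding Mp_eq_0_iff_dvd by blast
  then have "Mp (prod_mset A) = Mp (prod_mset B')" by (intro eq_mI[of _ _ k]) (simp add: algebra_simps)
  then have "A = B'" using add.IH[of B'] add.prems(1,2) unfolding B by auto
  then show ?case unfolding B by simp
qed

text \<open>For monic \<open>f\<close> the existence and uniqueness above justify
  \<open>THE\<close>. The value depends only on \<open>Mp f\<close>, which makes all local
  conditions conditions on residues.\<close>

definition factors_m :: "int poly \<Rightarrow> int poly multiset" where
  "factors_m f = (THE A. set_mset A \<subseteq> monic_irr \<and> Mp f = Mp (prod_mset A))"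

lemma factors_m_eqI:
  "set_mset A \<subseteq> monic_irr \<Longrightarrow> Mp f = Mp (prod_mset A) \<Longrightarrow> factors_m f = A"
  unfolding factors_m_def using monic_factorization_m_unique by (intro the_equality) auto

lemma factors_m:
  assumes "lead_coeff f = 1"
  shows "set_mset (factors_m f) \<subseteq> monic_irr" "Mp f = Mp (prod_mset (factors_m f))"
    "sum_mset (image_mset degree (factors_m f)) = degree f"
proof -
  obtain A where A: "set_mset A \<subseteq> monic_irr" "Mp f = Mp (prod_mset A)"
    using monic_factorization_m_exists[OF assms] by blast
  then show 1: "set_mset (factors_m f) \<subseteq> monic_irr" "Mp f = Mp (prod_mset (factors_m f))"
    using factors_m_eqI[OF A] by auto
  then show "sum_mset (image_mset degree (factors_m f)) = degree f"
    using monic_degree_m[OF assms] monic_degree_m[OF monic_prod_mset_irr[OF 1(1)]]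
      degree_prod_mset_irr[OF 1(1)] by simp
qed

lemma factors_m_Mp: "factors_m (Mp f) = factors_m f"
  unfolding factors_m_def by simp

text \<open>Connects the set of irreducible divisors, in terms of which the splitting type is
  defined, with the factorization multiset.\<close>

lemma monic_irr_dvdm_iff:
  assumes f: "lead_coeff f = 1" and g: "g \<in> monic_irr"
  shows "g dvdm f \<longleftrightarrow> g \<in># factors_m f"
proof
  assume "g dvdm f"
  then have "g dvdm prod_mset (factors_m f)"
    using factors_m(2)[OF f] by (metis dvdm_Mp)
  then obtain a where "a \<in># factors_m f" "g dvdm a" using monic_irr_dvdm_prod_mset[OF g] by blast
  then show "g \<in># factors_m f" using monic_irr_dvdm_eq[OF g] factors_m(1)[OF f] by auto
next
  assume "g \<in># factors_m f"
  then obtain B where "factors_m f = add_mset g B" by (metis mset_add)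
  then have "Mp f = Mp (g * prod_mset B)" using factors_m(2)[OF f] by simp
  then show "g dvdm f" unfolding dvdm_def by blast
qed

definition monic_reduced :: "nat \<Rightarrow> int poly set" where
  "monic_reduced n = {f. Mp f = f \<and> lead_coeff f = 1 \<and> degree f = n}"

lemma card_monic_reduced: "card (monic_reduced n) = nat p ^ n"
proof -
  have "Mp f = f \<longleftrightarrow> (\<forall>j<n. coeff f j \<in> {0..<p})" if "lead_coeff f = 1" "degree f = n" for f
  proof -
    have "Mp f = f \<longleftrightarrow> (\<forall>j. coeff f j \<in> {0..<p})"
      using m1 by (simp add: poly_eq_iff Mp_coeff M_def mod_ident_iff)
    moreover have "coeff f j \<in> {0..<p}" if "\<not> j < n" for j
      using m1 that \<open>lead_coeff f = 1\<close> \<open>degree f = n\<close> by (cases "j = n") (auto simp: coeff_eq_0)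
    ultimately show ?thesis by blast
  qed
  then have "monic_reduced n = {f. degree f = n \<and> lead_coeff f = 1 \<and> (\<forall>j<n. coeff f j \<in> {0..<p})}"
    unfolding monic_reduced_def by blast
  then show ?thesis using card_monic_with_coeffs[of n "\<lambda>_. {0..<p}"] by simp
qed

text \<open>Unique factorization as a bijection. With the count p^n of reduced monic polynomials it
  supplies the hypothesis \<open>card_words\<close> for irreducibles weighted by degree.\<close>

lemma bij_betw_factors_m:
  "bij_betw factors_m (monic_reduced n)
     {A. set_mset A \<subseteq> monic_irr \<and> sum_mset (image_mset degree A) = n}"
proof (rule bij_betwI[where g = "\<lambda>A. Mp (prod_mset A)"])
  show "factors_m \<in> monic_reduced n \<rightarrow> {A. set_mset A \<subseteq> monic_irr \<and> sum_mset (image_mset degree A) = n}"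
    using factors_m by (auto simp: monic_reduced_def)
  show "(\<lambda>A. Mp (prod_mset A)) \<in> {A. set_mset A \<subseteq> monic_irr \<and> sum_mset (image_mset degree A) = n} \<rightarrow> monic_reduced n"
  proof
    fix A assume "A \<in> {A. set_mset A \<subseteq> monic_irr \<and> sum_mset (image_mset degree A) = n}"
    then have A: "set_mset A \<subseteq> monic_irr" "sum_mset (image_mset degree A) = n" by auto
    note mon = monic_prod_mset_irr[OF A(1)]
    show "Mp (prod_mset A) \<in> monic_reduced n"
      using monic_Mp[OF mon] monic_degree_m[OF mon] degree_prod_mset_irr[OF A(1)] A(2)
      by (auto simp: monic_reduced_def)
  qed
qed (use factors_m in \<open>auto simp: monic_reduced_def intro: factors_m_eqI\<close>)

end

section \<open>Equidistribution of the box modulo finitely many primes\<close>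

text \<open>Writing a = c + m t turns -B < a \<le> B into a half-open range of t cut out by two
  floors, so the count is an exact difference without boundary cases.\<close>

lemma card_residue_class_in_interval:
  fixes m c :: int and B :: nat
  assumes "m > 0" "0 \<le> c" "c < m"
  shows "int (card {a \<in> {- int B<..int B}. a mod m = c}) = (int B - c) div m - (- int B - c) div m"
proof -
  have bij: "bij_betw (\<lambda>t. c + m * t) {(- int B - c) div m<..(int B - c) div m}
     {a \<in> {- int B<..int B}. a mod m = c}"
  proof (rule bij_betwI[where g = "\<lambda>a. a div m"])
    have dv: "t \<le> x div m \<longleftrightarrow> m * t \<le> x" for t x
    proof
      assume "t \<le> x div m"
      then have "m * t \<le> m * (x div m)" using assms(1) by (intro mult_left_mono) auto
      also have "\<dots> \<le> x" using mult_div_mod_eq[of m x] pos_mod_sign[OF assms(1), of x] by linarith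
      finally show "m * t \<le> x" .
    next
      assume "m * t \<le> x"
      from zdiv_mono1[OF this assms(1)] show "t \<le> x div m" using assms(1) by simp
    qed
    have lt: "(- int B - c) div m < t \<longleftrightarrow> - int B < c + m * t" for t
      using dv[of t "- int B - c"] by linarith
    have le: "t \<le> (int B - c) div m \<longleftrightarrow> c + m * t \<le> int B" for t
      using dv[of t "int B - c"] by linarith
    show "(\<lambda>t. c + m * t) \<in> {(- int B - c) div m<..(int B - c) div m} \<rightarrow> {a \<in> {- int B<..int B}. a mod m = c}"
      using assms by (auto simp: lt le)
    show "(\<lambda>a. a div m) \<in> {a \<in> {- int B<..int B}. a mod m = c} \<rightarrow> {(- int B - c) div m<..(int B - c) div m}"
    proof
      fix a assume a: "a \<in> {a \<in> {- int B<..int B}. a mod m = c}"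
      then have "c + m * (a div m) = a" by (metis (mono_tags, lifting) mem_Collect_eq mod_mult_div_eq)
      then show "a div m \<in> {(- int B - c) div m<..(int B - c) div m}"
        using a by (auto simp: lt le)
    qed
  qed (use assms in auto)
  have "(- int B - c) div m \<le> (int B - c) div m"
    using assms(1) by (intro zdiv_mono1) auto
  then show ?thesis using bij_betw_same_card[OF bij] by simp
qed

lemma residue_class_density:
  fixes m c :: int
  assumes "m > 0" "0 \<le> c" "c < m"
  shows "(\<lambda>B. real (card {a \<in> {- int B<..int B}. a mod m = c}) / real (2 * B)) \<longlonglongrightarrow> 1 / real_of_int m"
proof (rule tendsto_sandwich)
  \<comment> \<open>Both rounding errors lie in [0, 1), so their difference is below 1 in absolute
    value.\<close>
  have approx: "\<bar>real (card {a \<in> {- int B<..int B}. a mod m = c}) - real (2 * B) / real_of_int m\<bar> \<le> 1" for B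
  proof -
    have fl: "real_of_int (x div m) \<le> real_of_int x / real_of_int m"
      "real_of_int x / real_of_int m - 1 < real_of_int (x div m)" for x
      unfolding floor_divide_of_int_eq[symmetric, of x m, where ?'a = real] by linarith+
    have "real (card {a \<in> {- int B<..int B}. a mod m = c})
       = real_of_int ((int B - c) div m) - real_of_int ((- int B - c) div m)"
      by (simp flip: card_residue_class_in_interval[OF assms] of_int_diff)
    moreover have "real_of_int (int B - c) / real_of_int m - real_of_int (- int B - c) / real_of_int m
       = real (2 * B) / real_of_int m"
      by (simp flip: diff_divide_distrib)
    ultimately show ?thesis
      using fl[of "int B - c"] fl[of "- int B - c"] by linarith
  qed
  have upper: "real (card {a \<in> {- int B<..int B}. a mod m = c}) / real (2 * B) \<le> 1 / real_of_int m + 1 / real (2 * B)"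
    and lower: "1 / real_of_int m - 1 / real (2 * B) \<le> real (card {a \<in> {- int B<..int B}. a mod m = c}) / real (2 * B)"
    if "B > 0" for B
  proof -
    let ?X = "real (card {a \<in> {- int B<..int B}. a mod m = c})" and ?Y = "real (2 * B)"
    have Y: "?Y > 0" using that by simp
    have X: "?X \<le> ?Y / real_of_int m + 1" "?Y / real_of_int m - 1 \<le> ?X"
      using approx[of B] by linarith+
    have "?X / ?Y \<le> (?Y / real_of_int m + 1) / ?Y" using X(1) Y by (intro divide_right_mono) auto
    also have "\<dots> = 1 / real_of_int m + 1 / ?Y" using Y by (simp add: add_divide_distrib)
    finally show "?X / ?Y \<le> 1 / real_of_int m + 1 / ?Y" .
    have "1 / real_of_int m - 1 / ?Y = (?Y / real_of_int m - 1) / ?Y" using Y by (simp add: diff_divide_distrib)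
    also have "\<dots> \<le> ?X / ?Y" using X(2) Y by (intro divide_right_mono) auto
    finally show "1 / real_of_int m - 1 / ?Y \<le> ?X / ?Y" .
  qed
  show "\<forall>\<^sub>F B in sequentially. 1 / real_of_int m - 1 / real (2 * B) \<le> real (card {a \<in> {- int B<..int B}. a mod m = c}) / real (2 * B)"
    using eventually_gt_at_top[of 0] by eventually_elim (rule lower)
  show "\<forall>\<^sub>F B in sequentially. real (card {a \<in> {- int B<..int B}. a mod m = c}) / real (2 * B) \<le> 1 / real_of_int m + 1 / real (2 * B)"
    using eventually_gt_at_top[of 0] by eventually_elim (rule upper)
  have "filterlim (\<lambda>B::nat. real (2 * B)) at_top sequentially"
    by (rule filterlim_compose[OF filterlim_real_sequentially])
      (rule filterlim_subseq, auto simp: strict_mono_def)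
  then have "(\<lambda>B. 1 / real (2 * B)) \<longlonglongrightarrow> 0" by (intro tendsto_divide_0[OF tendsto_const] filterlim_at_top_imp_at_infinity)
  then show "(\<lambda>B. 1 / real_of_int m - 1 / real (2 * B)) \<longlonglongrightarrow> 1 / real_of_int m"
    and "(\<lambda>B. 1 / real_of_int m + 1 / real (2 * B)) \<longlonglongrightarrow> 1 / real_of_int m"
    by (auto intro: tendsto_eq_intros)
qed

lemma card_monic_box: "card (monic_box n B) = (2 * B) ^ n"
proof -
  have "monic_box n B = {f. degree f = n \<and> lead_coeff f = 1 \<and> (\<forall>j<n. coeff f j \<in> {- int B<..int B})}"
    by (auto simp: monic_box_def)
  then show ?thesis using card_monic_with_coeffs[of n "\<lambda>_. {- int B<..int B}"]
    by (simp add: nat_mult_distrib)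
qed

lemma finite_monic_with_coeffs:
  assumes "\<And>j. j < n \<Longrightarrow> finite (S j)"
  shows "finite {f :: int poly. degree f = n \<and> lead_coeff f = 1 \<and> (\<forall>j<n. coeff f j \<in> S j)}"
proof (rule finite_imageD)
  show "finite ((\<lambda>f. restrict (coeff f) {..<n}) ` {f :: int poly. degree f = n \<and> lead_coeff f = 1 \<and> (\<forall>j<n. coeff f j \<in> S j)})"
    by (rule finite_subset[of _ "PiE {..<n} S"]) (use assms in \<open>auto intro!: finite_PiE simp: PiE_iff extensional_def split: if_splits\<close>)
  show "inj_on (\<lambda>f. restrict (coeff f) {..<n}) {f :: int poly. degree f = n \<and> lead_coeff f = 1 \<and> (\<forall>j<n. coeff f j \<in> S j)}"
  proof (rule inj_onI, rule poly_eqI)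
    fix f g :: "int poly" and i
    assume f: "f \<in> {f. degree f = n \<and> lead_coeff f = 1 \<and> (\<forall>j<n. coeff f j \<in> S j)}"
      and g: "g \<in> {f. degree f = n \<and> lead_coeff f = 1 \<and> (\<forall>j<n. coeff f j \<in> S j)}"
      and eq: "restrict (coeff f) {..<n} = restrict (coeff g) {..<n}"
    show "coeff f i = coeff g i"
      using f g fun_cong[OF eq, of i] by (cases i n rule: linorder_cases) (auto simp: coeff_eq_0)
  qed
qed

lemma finite_monic_box: "finite (monic_box n B)"
  by (rule finite_subset[OF _ finite_monic_with_coeffs[of n "\<lambda>_. {- int B<..int B}"]])
    (auto simp: monic_box_def)

definition monic_residues :: "nat \<Rightarrow> int \<Rightarrow> int poly set" where
  "monic_residues n m = {f. degree f = n \<and> lead_coeff f = 1 \<and> (\<forall>j<n. coeff f j \<in> {0..<m})}"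

text \<open>Fixing the residues of the n coefficients gives a product of one-dimensional counts over
  (2B)^n, with limit m^-n; the part of the box over \<open>W\<close> is a finite disjoint union of
  such classes.\<close>

lemma monic_box_residue_density:
  assumes m: "m > 0" and W: "W \<subseteq> monic_residues n m"
  shows "(\<lambda>B. real (card {f \<in> monic_box n B. \<exists>g\<in>W. \<forall>j<n. coeff f j mod m = coeff g j}) / real (card (monic_box n B)))
    \<longlonglongrightarrow> real (card W) / real_of_int m ^ n"
proof -
  have finW: "finite W"
    using W finite_monic_with_coeffs[of n "\<lambda>_. {0..<m}"] by (auto simp: monic_residues_def intro: finite_subset)
  define C where "C g B = {f \<in> monic_box n B. \<forall>j<n. coeff f j mod m = coeff g j}" for g B
  have card_C: "card (C g B) = (\<Prod>j<n. card {a \<in> {- int B<..int B}. a mod m = coeff g j})" for g B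
  proof -
    have "C g B = {f. degree f = n \<and> lead_coeff f = 1 \<and> (\<forall>j<n. coeff f j \<in> {a \<in> {- int B<..int B}. a mod m = coeff g j})}"
      by (auto simp: C_def monic_box_def)
    then show ?thesis by (simp only: card_monic_with_coeffs)
  qed
  have lim_C: "(\<lambda>B. real (card (C g B)) / real (card (monic_box n B))) \<longlonglongrightarrow> 1 / real_of_int m ^ n" if g: "g \<in> W" for g
  proof -
    have "(\<lambda>B. \<Prod>j<n. real (card {a \<in> {- int B<..int B}. a mod m = coeff g j}) / real (2 * B)) \<longlonglongrightarrow> (\<Prod>j<n. 1 / real_of_int m)"
      using g W m by (intro tendsto_prod residue_class_density) (auto simp: monic_residues_def)
    then show ?thesis
      by (simp add: card_C card_monic_box prod_dividef power_divide)
  qed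
  have "real (card {f \<in> monic_box n B. \<exists>g\<in>W. \<forall>j<n. coeff f j mod m = coeff g j}) / real (card (monic_box n B))
     = (\<Sum>g\<in>W. real (card (C g B)) / real (card (monic_box n B)))" for B
  proof -
    have "{f \<in> monic_box n B. \<exists>g\<in>W. \<forall>j<n. coeff f j mod m = coeff g j} = (\<Union>g\<in>W. C g B)"
      by (auto simp: C_def)
    also have "card \<dots> = (\<Sum>g\<in>W. card (C g B))"
    proof (rule card_UN_disjoint[OF finW])
      show "\<forall>g\<in>W. finite (C g B)" using finite_monic_box by (auto simp: C_def)
      show "\<forall>g\<in>W. \<forall>h\<in>W. g \<noteq> h \<longrightarrow> C g B \<inter> C h B = {}"
      proof (intro ballI impI)
        fix g h assume gh: "g \<in> W" "h \<in> W" "g \<noteq> h"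
        obtain i where i: "coeff g i \<noteq> coeff h i" using gh(3) by (auto simp: poly_eq_iff)
        have deg: "degree g = n" "degree h = n" "coeff g n = 1" "coeff h n = 1"
          using gh(1,2) W by (auto simp: monic_residues_def)
        have "i < n" using i deg by (cases i n rule: linorder_cases) (auto simp: coeff_eq_0)
        then show "C g B \<inter> C h B = {}" using i by (auto simp: C_def)
      qed
    qed
    finally show ?thesis by (simp add: sum_divide_distrib)
  qed
  moreover have "(\<lambda>B. \<Sum>g\<in>W. real (card (C g B)) / real (card (monic_box n B))) \<longlonglongrightarrow> (\<Sum>g\<in>W. 1 / real_of_int m ^ n)"
    by (intro tendsto_sum lim_C)
  ultimately show ?thesis by simp
qed

text \<open>The Chinese remainder theorem, applied to each coefficient below the leading
  one.\<close>

lemma card_monic_residues_chinese: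
  assumes Q: "finite Q" "\<And>q. q \<in> Q \<Longrightarrow> prime q"
    and S: "\<And>q. q \<in> Q \<Longrightarrow> S q \<subseteq> poly_mod_prime.monic_reduced (int q) n"
  shows "card {g \<in> monic_residues n (\<Prod>q\<in>Q. int q). \<forall>q\<in>Q. poly_mod.Mp (int q) g \<in> S q} = (\<Prod>q\<in>Q. card (S q))"
proof -
  let ?m = "\<Prod>q\<in>Q. int q"
  let ?W = "{g \<in> monic_residues n ?m. \<forall>q\<in>Q. poly_mod.Mp (int q) g \<in> S q}"
  have loc: "poly_mod_prime (int q)" if "q \<in> Q" for q
    using Q(2)[OF that] by unfold_locales simp
  have cop: "\<forall>i\<in>Q. \<forall>j\<in>Q. i \<noteq> j \<longrightarrow> Rings.coprime i j"
    using Q(2) primes_coprime by blast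
  have m_pos: "(\<Prod>q\<in>Q. q) > 0" using Q by (auto intro!: prod_pos prime_gt_0_nat)
  have m_eq: "?m = int (\<Prod>q\<in>Q. q)" by simp
  have "bij_betw (\<lambda>g. restrict (\<lambda>q. poly_mod.Mp (int q) g) Q) ?W (PiE Q S)"
    unfolding bij_betw_def
  proof (intro conjI inj_onI)
    fix g h assume g: "g \<in> ?W" and h: "h \<in> ?W"
      and eq: "restrict (\<lambda>q. poly_mod.Mp (int q) g) Q = restrict (\<lambda>q. poly_mod.Mp (int q) h) Q"
    show "g = h"
    proof (rule poly_eqI)
      fix i
      have "[coeff g i = coeff h i] (mod ?m)"
      proof (rule cong_cong_prod_coprime)
        have "[coeff g i = coeff h i] (mod int q)" if "q \<in> Q" for q
          using arg_cong[OF fun_cong[OF eq, of q], of "\<lambda>f. coeff f i"] that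
          by (simp add: poly_mod.Mp_coeff poly_mod.M_def cong_def)
        then show "\<forall>q\<in>Q. [coeff g i = coeff h i] (mod int q)" by blast
        show "\<forall>q\<in>Q. \<forall>q'\<in>Q. q \<noteq> q' \<longrightarrow> Rings.coprime (int q) (int q')"
          using cop by simp
      qed
      then show "coeff g i = coeff h i"
        using g h by (cases i n rule: linorder_cases) (auto simp: monic_residues_def coeff_eq_0 cong_def)
    qed
  next
    show "(\<lambda>g. restrict (\<lambda>q. poly_mod.Mp (int q) g) Q) ` ?W = PiE Q S"
    proof (intro equalityI subsetI)
      fix T assume T: "T \<in> PiE Q S"
      have TS: "T q \<in> S q" "poly_mod.Mp (int q) (T q) = T q" "lead_coeff (T q) = 1" "degree (T q) = n" if "q \<in> Q" for q
        using T that S[OF that] poly_mod_prime.monic_reduced_def[OF loc[OF that]] by (auto simp: PiE_iff)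
      \<comment> \<open>Reduced coefficients are nonnegative, so \<open>nat\<close> loses nothing
        when the remainder theorem for natural numbers is applied.\<close>
      have Tnn: "0 \<le> coeff (T q) j" if "q \<in> Q" for q j
      proof -
        have "coeff (T q) j = coeff (T q) j mod int q"
          using arg_cong[OF TS(2)[OF that], of "\<lambda>f. coeff f j"] by (simp add: poly_mod.Mp_coeff poly_mod.M_def)
        then show ?thesis using Q(2)[OF that] by (metis of_nat_0_less_iff pos_mod_sign prime_gt_0_nat)
      qed
      have "\<exists>x. x < (\<Prod>q\<in>Q. q) \<and> (\<forall>q\<in>Q. [x = nat (coeff (T q) j)] (mod q))" for j
        using chinese_remainder_unique_nat[OF Q(1), of "\<lambda>q. q" "\<lambda>q. nat (coeff (T q) j)"] cop Q(2)
        by (metis (no_types, lifting) not_prime_0)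
      then obtain x where x: "x j < (\<Prod>q\<in>Q. q)" "\<And>q. q \<in> Q \<Longrightarrow> [x j = nat (coeff (T q) j)] (mod q)" for j
        by metis
      define g where "g = (\<Sum>j<n. monom (int (x j)) j) + monom 1 n"
      have cg: "coeff g i = (if i < n then int (x i) else if i = n then 1 else 0)" for i
        by (simp add: g_def coeff_sum sum.delta')
      have dg: "degree g = n" by (rule antisym[OF degree_le le_degree]) (simp_all add: cg)
      have gT: "poly_mod.Mp (int q) g = T q" if q: "q \<in> Q" for q
      proof (rule poly_eqI)
        fix i
        have red: "coeff (T q) i = coeff (T q) i mod int q"
          using arg_cong[OF TS(2)[OF q], of "\<lambda>f. coeff f i"] by (simp add: poly_mod.Mp_coeff poly_mod.M_def)
        have "[int (x i) = coeff (T q) i] (mod int q)"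
          using x(2)[OF q, of i] Tnn[OF q, of i] by (simp flip: cong_int_iff)
        then have "i < n \<Longrightarrow> int (x i) mod int q = coeff (T q) i" using red by (simp add: cong_def)
        then show "coeff (poly_mod.Mp (int q) g) i = coeff (T q) i"
          using TS(3,4)[OF q] red
          by (cases i n rule: linorder_cases) (auto simp: poly_mod.Mp_coeff poly_mod.M_def cg coeff_eq_0)
      qed
      have "g \<in> monic_residues n ?m"
        using x(1) by (auto simp: monic_residues_def dg cg m_eq simp del: of_nat_prod)
      then have "g \<in> ?W" using gT TS(1) by auto
      moreover have "T = restrict (\<lambda>q. poly_mod.Mp (int q) g) Q"
        using T gT by (auto simp: PiE_def extensional_def fun_eq_iff)
      ultimately show "T \<in> (\<lambda>g. restrict (\<lambda>q. poly_mod.Mp (int q) g) Q) ` ?W" by blast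
    qed auto
  qed
  from bij_betw_same_card[OF this] show ?thesis using Q(1) by (simp add: card_PiE)
qed

text \<open>Local conditions at distinct primes are independent: membership depends only on
  \<open>f\<close> modulo the product of the primes, where the Chinese remainder theorem factors the
  count.\<close>

lemma monic_box_density:
  assumes Q: "finite Q" "\<And>q. q \<in> Q \<Longrightarrow> prime q"
    and S: "\<And>q. q \<in> Q \<Longrightarrow> S q \<subseteq> poly_mod_prime.monic_reduced (int q) n"
  shows "(\<lambda>B. real (card {f \<in> monic_box n B. \<forall>q\<in>Q. poly_mod.Mp (int q) f \<in> S q}) / real (card (monic_box n B)))
    \<longlonglongrightarrow> (\<Prod>q\<in>Q. real (card (S q)) / real q ^ n)"
proof -
  let ?m = "\<Prod>q\<in>Q. int q"
  let ?W = "{g \<in> monic_residues n ?m. \<forall>q\<in>Q. poly_mod.Mp (int q) g \<in> S q}"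
  have m_pos: "?m > 0" using Q by (auto intro!: prod_pos prime_gt_0_nat)
  have red: "poly_mod.Mp (int q) f = poly_mod.Mp (int q) g"
    if "q \<in> Q" "\<forall>j<n. coeff f j mod ?m = coeff g j" "degree f = n" "degree g = n" "coeff f n = 1" "coeff g n = 1" for q f g
  proof (rule poly_eqI)
    fix i
    have "int q dvd ?m" using that(1) Q(1) by (intro dvd_prodI) auto
    then have "coeff f j mod int q = coeff g j mod int q" if "j < n" for j
      using \<open>\<forall>j<n. coeff f j mod ?m = coeff g j\<close> that by (metis mod_mod_cancel)
    then show "coeff (poly_mod.Mp (int q) f) i = coeff (poly_mod.Mp (int q) g) i"
      using that by (cases i n rule: linorder_cases) (auto simp: poly_mod.Mp_coeff poly_mod.M_def coeff_eq_0)
  qed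
  have eq: "{f \<in> monic_box n B. \<forall>q\<in>Q. poly_mod.Mp (int q) f \<in> S q}
     = {f \<in> monic_box n B. \<exists>g\<in>?W. \<forall>j<n. coeff f j mod ?m = coeff g j}" for B
  proof (intro equalityI subsetI)
    fix f assume f: "f \<in> {f \<in> monic_box n B. \<forall>q\<in>Q. poly_mod.Mp (int q) f \<in> S q}"
    define g where "g = (\<Sum>j<n. monom (coeff f j mod ?m) j) + monom 1 n"
    have cg: "coeff g i = (if i < n then coeff f i mod ?m else if i = n then 1 else 0)" for i
      by (simp add: g_def coeff_sum sum.delta')
    have dg: "degree g = n" by (rule antisym[OF degree_le le_degree]) (simp_all add: cg)
    have "g \<in> monic_residues n ?m" using m_pos by (auto simp: monic_residues_def dg cg)
    moreover have "poly_mod.Mp (int q) g = poly_mod.Mp (int q) f" if "q \<in> Q" for q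
      by (rule red[symmetric]) (use f that in \<open>auto simp: monic_box_def dg cg\<close>)
    ultimately have "g \<in> ?W" using f by auto
    then show "f \<in> {f \<in> monic_box n B. \<exists>g\<in>?W. \<forall>j<n. coeff f j mod ?m = coeff g j}"
      using f by (auto simp: cg intro!: bexI[of _ g])
  next
    fix f assume "f \<in> {f \<in> monic_box n B. \<exists>g\<in>?W. \<forall>j<n. coeff f j mod ?m = coeff g j}"
    then obtain g where f: "f \<in> monic_box n B" and g: "g \<in> ?W" "\<forall>j<n. coeff f j mod ?m = coeff g j"
      by blast
    then have "poly_mod.Mp (int q) f = poly_mod.Mp (int q) g" if "q \<in> Q" for q
      by (intro red) (use that in \<open>auto simp: monic_box_def monic_residues_def\<close>)
    then show "f \<in> {f \<in> monic_box n B. \<forall>q\<in>Q. poly_mod.Mp (int q) f \<in> S q}" using f g(1) by auto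
  qed
  have "real (card ?W) / real_of_int ?m ^ n = (\<Prod>q\<in>Q. real (card (S q)) / real q ^ n)"
    by (subst card_monic_residues_chinese[OF Q S]) (auto simp: prod_dividef prod_power_distrib)
  with monic_box_residue_density[OF m_pos, of ?W n] show ?thesis
    unfolding eq by (simp only: Collect_restrict)
qed

section \<open>Ideals and the ring of algebraic integers\<close>

text \<open>Rings are plain subsets of a type, so that arithmetic stays that of the complex numbers
  or of polynomials over them. Quotients never occur: congruence means that a difference lies in an
  ideal.\<close>

definition subring_of :: "'a :: comm_ring_1 set \<Rightarrow> bool" where
  "subring_of A \<longleftrightarrow> 0 \<in> A \<and> 1 \<in> A \<and> (\<forall>x\<in>A. - x \<in> A) \<and> (\<forall>x\<in>A. \<forall>y\<in>A. x + y \<in> A \<and> x * y \<in> A)"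

text \<open>A[x] inside the polynomial type. It iterates: \<open>polys_over (polys_over A)\<close>
  is the bivariate ring that contains the polynomial with roots
  \<open>\<Theta> \<sigma>\<close>.\<close>

definition polys_over :: "'a :: zero set \<Rightarrow> 'a poly set" where
  "polys_over A = {f. \<forall>i. coeff f i \<in> A}"

lemma polys_overI: "(\<And>i. coeff f i \<in> A) \<Longrightarrow> f \<in> polys_over A"
  by (simp add: polys_over_def)

lemma polys_overD: "f \<in> polys_over A \<Longrightarrow> coeff f i \<in> A"
  by (simp add: polys_over_def)

lemma subring_ofD:
  assumes "subring_of A"
  shows "0 \<in> A" "1 \<in> A" "x \<in> A \<Longrightarrow> - x \<in> A" "x \<in> A \<Longrightarrow> y \<in> A \<Longrightarrow> x + y \<in> A"
    "x \<in> A \<Longrightarrow> y \<in> A \<Longrightarrow> x * y \<in> A" "x \<in> A \<Longrightarrow> y \<in> A \<Longrightarrow> x - y \<in> A"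
proof -
  show *: "0 \<in> A" "1 \<in> A" "x \<in> A \<Longrightarrow> - x \<in> A" "x \<in> A \<Longrightarrow> y \<in> A \<Longrightarrow> x + y \<in> A"
    "x \<in> A \<Longrightarrow> y \<in> A \<Longrightarrow> x * y \<in> A" for x y
    using assms by (auto simp: subring_of_def)
  show "x \<in> A \<Longrightarrow> y \<in> A \<Longrightarrow> x - y \<in> A"
    using *(4)[of x "- y"] *(3)[of y] by simp
qed

lemma subring_of_sum: "subring_of A \<Longrightarrow> (\<And>i. i \<in> I \<Longrightarrow> f i \<in> A) \<Longrightarrow> sum f I \<in> A"
  by (induction I rule: infinite_finite_induct) (simp_all add: subring_ofD)

lemma subring_of_prod: "subring_of A \<Longrightarrow> (\<And>i. i \<in> I \<Longrightarrow> f i \<in> A) \<Longrightarrow> prod f I \<in> A"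
  by (induction I rule: infinite_finite_induct) (simp_all add: subring_ofD)

lemma subring_of_prod_mset: "subring_of A \<Longrightarrow> set_mset I \<subseteq> A \<Longrightarrow> prod_mset I \<in> A"
  by (induction I) (simp_all add: subring_ofD)

lemma subring_of_power: "subring_of A \<Longrightarrow> x \<in> A \<Longrightarrow> x ^ n \<in> A"
  by (induction n) (simp_all add: subring_ofD)

lemma subring_of_of_nat: "subring_of A \<Longrightarrow> of_nat n \<in> A"
  by (induction n) (simp_all add: subring_ofD)

lemma subring_of_of_int: "subring_of A \<Longrightarrow> of_int n \<in> A"
  by (cases n) (simp_all add: subring_of_of_nat subring_ofD del: of_nat_Suc)

lemma subring_of_polys_over:
  assumes "subring_of A"
  shows "subring_of (polys_over A)"
proof -
  note [simp, intro] = subring_ofD[OF assms]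
  have "f * g \<in> polys_over A" if "f \<in> polys_over A" "g \<in> polys_over A" for f g
    using that by (auto simp: polys_over_def coeff_mult intro!: subring_of_sum[OF assms])
  moreover have "1 \<in> polys_over A"
    by (auto simp: polys_over_def coeff_1)
  ultimately show ?thesis by (auto simp: subring_of_def polys_over_def)
qed

lemma pCons_in_polys_over: "a \<in> A \<Longrightarrow> f \<in> polys_over A \<Longrightarrow> pCons a f \<in> polys_over A"
  by (auto simp: polys_over_def coeff_pCons split: nat.splits)

lemma pCons_in_polys_over_iff: "pCons a f \<in> polys_over A \<longleftrightarrow> a \<in> A \<and> f \<in> polys_over A"
  by (auto simp: polys_over_def coeff_pCons split: nat.splits)

lemma zero_in_polys_over: "0 \<in> A \<Longrightarrow> 0 \<in> polys_over A"
  by (simp add: polys_over_def)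

lemma monom_in_polys_over: "0 \<in> A \<Longrightarrow> a \<in> A \<Longrightarrow> monom a n \<in> polys_over A"
  by (simp add: polys_over_def)

lemma poly_in_subring:
  assumes "subring_of A" "f \<in> polys_over A" "x \<in> A"
  shows "poly f x \<in> A"
  using assms(2)
proof (induction f)
  case (pCons a f)
  then show ?case using assms by (simp add: pCons_in_polys_over_iff subring_ofD)
qed (use assms in \<open>simp add: subring_ofD\<close>)

definition ideal_of :: "'a :: comm_ring_1 set \<Rightarrow> 'a set \<Rightarrow> bool" where
  "ideal_of A P \<longleftrightarrow> subring_of A \<and> P \<subseteq> A \<and> 0 \<in> P \<and> (\<forall>x\<in>P. \<forall>y\<in>P. x + y \<in> P) \<and> (\<forall>x\<in>P. \<forall>y\<in>A. x * y \<in> P)"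

definition prime_ideal_of :: "'a :: comm_ring_1 set \<Rightarrow> 'a set \<Rightarrow> bool" where
  "prime_ideal_of A P \<longleftrightarrow> ideal_of A P \<and> 1 \<notin> P \<and> (\<forall>x\<in>A. \<forall>y\<in>A. x * y \<in> P \<longrightarrow> x \<in> P \<or> y \<in> P)"

lemma ideal_ofD:
  assumes "ideal_of A P"
  shows "subring_of A" "P \<subseteq> A" "0 \<in> P" "x \<in> P \<Longrightarrow> y \<in> P \<Longrightarrow> x + y \<in> P"
    "x \<in> P \<Longrightarrow> y \<in> A \<Longrightarrow> x * y \<in> P" "x \<in> A \<Longrightarrow> y \<in> P \<Longrightarrow> x * y \<in> P" "x \<in> P \<Longrightarrow> - x \<in> P"
    "x \<in> P \<Longrightarrow> y \<in> P \<Longrightarrow> x - y \<in> P"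
proof -
  show *: "subring_of A" "P \<subseteq> A" "0 \<in> P" "x \<in> P \<Longrightarrow> y \<in> P \<Longrightarrow> x + y \<in> P"
    "x \<in> P \<Longrightarrow> y \<in> A \<Longrightarrow> x * y \<in> P" for x y
    using assms by (auto simp: ideal_of_def)
  show "x \<in> A \<Longrightarrow> y \<in> P \<Longrightarrow> x * y \<in> P" using *(5)[of y x] by (simp add: mult.commute)
  have "- 1 \<in> A" using *(1) by (simp_all add: subring_ofD)
  then show neg: "x \<in> P \<Longrightarrow> - x \<in> P" for x using *(5)[of x "- 1"] by simp
  show "x \<in> P \<Longrightarrow> y \<in> P \<Longrightarrow> x - y \<in> P" using *(4)[of x "- y"] neg[of y] by simp
qed

lemma ideal_of_sum:
  assumes "ideal_of A P" "\<And>i. i \<in> I \<Longrightarrow> f i \<in> P"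
  shows "sum f I \<in> P"
  using assms(2) by (induction I rule: infinite_finite_induct) (simp_all add: ideal_ofD(3,4)[OF assms(1)])

lemma prime_ideal_ofD:
  assumes "prime_ideal_of A P"
  shows "ideal_of A P" "1 \<notin> P" "x \<in> A \<Longrightarrow> y \<in> A \<Longrightarrow> x * y \<in> P \<Longrightarrow> x \<in> P \<or> y \<in> P"
  using assms by (auto simp: prime_ideal_of_def)

lemma prime_ideal_of_prod:
  assumes P: "prime_ideal_of A P" and "finite I" and "\<And>i. i \<in> I \<Longrightarrow> f i \<in> A" and "prod f I \<in> P"
  shows "\<exists>i\<in>I. f i \<in> P"
  using assms(2-4)
proof (induction I rule: finite_induct)
  case empty
  then show ?case using prime_ideal_ofD(2)[OF P] by simp
next
  case (insert i I)
  then show ?case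
    using prime_ideal_ofD(3)[OF P, of "f i" "prod f I"]
      subring_of_prod[OF ideal_ofD(1)[OF prime_ideal_ofD(1)[OF P]], of I f] by auto
qed

lemma prime_ideal_of_prod_mset:
  assumes P: "prime_ideal_of A P" and "set_mset I \<subseteq> A" and "prod_mset I \<in> P"
  shows "\<exists>x\<in>#I. x \<in> P"
  using assms(2-3)
proof (induction I)
  case empty
  then show ?case using prime_ideal_ofD(2)[OF P] by simp
next
  case (add x I)
  then show ?case
    using prime_ideal_ofD(3)[OF P, of x "prod_mset I"]
      subring_of_prod_mset[OF ideal_ofD(1)[OF prime_ideal_ofD(1)[OF P]], of I] by auto
qed

lemma ideal_cong_trans: "ideal_of A P \<Longrightarrow> x - y \<in> P \<Longrightarrow> y - z \<in> P \<Longrightarrow> x - z \<in> P"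
  using ideal_ofD(4)[of A P "x - y" "y - z"] by simp

lemma ideal_cong_sym: "ideal_of A P \<Longrightarrow> x - y \<in> P \<Longrightarrow> y - x \<in> P"
  using ideal_ofD(7)[of A P "x - y"] by simp

lemma ideal_cong_add: "ideal_of A P \<Longrightarrow> x - y \<in> P \<Longrightarrow> z - w \<in> P \<Longrightarrow> x + z - (y + w) \<in> P"
  using ideal_ofD(4)[of A P "x - y" "z - w"] by (simp add: algebra_simps)

lemma ideal_cong_mult:
  "ideal_of A P \<Longrightarrow> x - y \<in> P \<Longrightarrow> z - w \<in> P \<Longrightarrow> y \<in> A \<Longrightarrow> z \<in> A \<Longrightarrow> x * z - y * w \<in> P"
  using ideal_ofD(4)[of A P "(x - y) * z" "y * (z - w)"] ideal_ofD(5)[of A P "x - y" z]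
    ideal_ofD(6)[of A P y "z - w"] by (simp add: algebra_simps)

lemma ideal_cong_mem: "ideal_of A P \<Longrightarrow> x - y \<in> P \<Longrightarrow> x \<in> P \<longleftrightarrow> y \<in> P"
  using ideal_ofD(4)[of A P "x - y" y] ideal_ofD(8)[of A P x "x - y"] by auto

lemma ideal_cong_prod:
  assumes P: "ideal_of A P" and "\<And>i. i \<in> I \<Longrightarrow> f i \<in> A" "\<And>i. i \<in> I \<Longrightarrow> g i \<in> A" "\<And>i. i \<in> I \<Longrightarrow> f i - g i \<in> P"
  shows "prod f I - prod g I \<in> P"
  using assms(2-4)
proof (induction I rule: infinite_finite_induct)
  case (insert i I)
  then show ?case
    using ideal_cong_mult[OF P, of "f i" "g i" "prod f I" "prod g I"]
      subring_of_prod[OF ideal_ofD(1)[OF P], of I f] by auto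
qed (use ideal_ofD(3)[OF P] in auto)

lemma ideal_cong_poly:
  assumes P: "ideal_of A P" and f: "f \<in> polys_over A" and x: "x \<in> A" "y \<in> A" "x - y \<in> P"
  shows "poly f x - poly f y \<in> P"
  using f
proof (induction f)
  case (pCons a f)
  then have f: "a \<in> A" "f \<in> polys_over A" by (auto simp: pCons_in_polys_over_iff)
  have "x * poly f x - y * poly f y \<in> P"
    using ideal_cong_mult[OF P x(3) pCons.IH[OF f(2)] x(2)] poly_in_subring[OF ideal_ofD(1)[OF P] f(2) x(1)] by simp
  then show ?case by simp
qed (use ideal_ofD(3)[OF P] in auto)

lemma ideal_of_polys_over:
  assumes P: "ideal_of A P"
  shows "ideal_of (polys_over A) (polys_over P)"
proof -
  have "f * g \<in> polys_over P" if "f \<in> polys_over P" "g \<in> polys_over A" for f g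
    using that ideal_ofD(5)[OF P]
    by (auto simp: polys_over_def coeff_mult intro!: ideal_of_sum[OF P])
  then show ?thesis
    using subring_of_polys_over[OF ideal_ofD(1)[OF P]] ideal_ofD(2-4)[OF P]
    by (auto simp: ideal_of_def polys_over_def)
qed

text \<open>Gauss's argument: take the least indices at which two polynomials have coefficients
  outside P. At the sum of these indices the coefficient of the product is congruent to the product
  of the two coefficients.\<close>

lemma prime_ideal_of_polys_over:
  assumes P: "prime_ideal_of A P"
  shows "prime_ideal_of (polys_over A) (polys_over P)"
  unfolding prime_ideal_of_def
proof (intro conjI ballI impI)
  note id = prime_ideal_ofD(1)[OF P]
  show "ideal_of (polys_over A) (polys_over P)" by (rule ideal_of_polys_over[OF id])
  show "1 \<notin> polys_over P" using prime_ideal_ofD(2)[OF P] by (auto simp: polys_over_def intro!: exI[of _ 0])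
  fix f g assume f: "f \<in> polys_over A" and g: "g \<in> polys_over A" and fg: "f * g \<in> polys_over P"
  show "f \<in> polys_over P \<or> g \<in> polys_over P"
  proof (rule ccontr)
    assume "\<not> ?thesis"
    then have "\<exists>i. coeff f i \<notin> P" "\<exists>j. coeff g j \<notin> P" by (auto simp: polys_over_def)
    define i where "i = (LEAST i. coeff f i \<notin> P)"
    define j where "j = (LEAST j. coeff g j \<notin> P)"
    have i: "coeff f i \<notin> P" "\<And>k. k < i \<Longrightarrow> coeff f k \<in> P"
      unfolding i_def using LeastI_ex[OF \<open>\<exists>i. coeff f i \<notin> P\<close>] not_less_Least by blast+
    have j: "coeff g j \<notin> P" "\<And>k. k < j \<Longrightarrow> coeff g k \<in> P"
      unfolding j_def using LeastI_ex[OF \<open>\<exists>j. coeff g j \<notin> P\<close>] not_less_Least by blast+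
    have "coeff (f * g) (i + j) = (\<Sum>k\<le>i + j. coeff f k * coeff g (i + j - k))" by (simp add: coeff_mult)
    also have "\<dots> = coeff f i * coeff g j + (\<Sum>k\<in>{..i + j} - {i}. coeff f k * coeff g (i + j - k))"
      by (subst sum.remove[of _ i]) auto
    finally have eq: "coeff f i * coeff g j = coeff (f * g) (i + j) - (\<Sum>k\<in>{..i + j} - {i}. coeff f k * coeff g (i + j - k))"
      by simp
    have "coeff f k * coeff g (i + j - k) \<in> P" if "k \<in> {..i + j} - {i}" for k
    proof (cases "k < i")
      case True
      then show ?thesis using i(2) polys_overD[OF g] ideal_ofD(5)[OF id] by blast
    next
      case False
      then have "i + j - k < j" using that by auto
      then show ?thesis using j(2) polys_overD[OF f] ideal_ofD(6)[OF id] by blast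
    qed
    then have "(\<Sum>k\<in>{..i + j} - {i}. coeff f k * coeff g (i + j - k)) \<in> P" by (rule ideal_of_sum[OF id])
    then have "coeff f i * coeff g j \<in> P" unfolding eq using polys_overD[OF fg] ideal_ofD(8)[OF id] by blast
    then show False using prime_ideal_ofD(3)[OF P] polys_overD[OF f] polys_overD[OF g] i(1) j(1) by blast
  qed
qed

lemma synthetic_div_in_polys_over:
  assumes "subring_of A" "f \<in> polys_over A" "c \<in> A"
  shows "synthetic_div f c \<in> polys_over A"
  using assms(2)
proof (induction f)
  case (pCons a f)
  then have "a \<in> A" "f \<in> polys_over A" by (auto simp: pCons_in_polys_over_iff)
  then show ?case using pCons.IH poly_in_subring[OF assms(1) _ assms(3)]
    by (simp add: pCons_in_polys_over)
qed (use assms in \<open>simp add: zero_in_polys_over subring_ofD\<close>)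

text \<open>The root bound in the domain A/P, stated by congruences: split off one root c; for every
  other root d the difference d - c lies outside P and can be cancelled.\<close>

lemma card_roots_mod_prime_ideal:
  assumes P: "prime_ideal_of A P" and "f \<in> polys_over A" "f \<notin> polys_over P"
    and "finite C" "C \<subseteq> A" "\<And>c. c \<in> C \<Longrightarrow> poly f c \<in> P" "\<And>c d. c \<in> C \<Longrightarrow> d \<in> C \<Longrightarrow> c \<noteq> d \<Longrightarrow> c - d \<notin> P"
  shows "card C \<le> degree f"
  using assms(2-)
proof (induction "degree f" arbitrary: f C)
  case 0
  then obtain a where a: "f = [:a:]" by (metis degree_eq_zeroE)
  note id = prime_ideal_ofD(1)[OF P]
  have "a \<notin> P" using 0(3) a ideal_ofD(3)[OF id] by (auto simp: pCons_in_polys_over_iff zero_in_polys_over)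
  then have "C = {}" using 0(6) a by auto
  then show ?case by simp
next
  case (Suc n)
  note id = prime_ideal_ofD(1)[OF P]
  note ring = ideal_ofD(1)[OF id]
  show ?case
  proof (cases "C = {}")
    case False
    then obtain c where c: "c \<in> C" by auto
    define g where "g = synthetic_div f c"
    have f: "f = [:- c, 1:] * g + [:poly f c:]" unfolding g_def by (rule synthetic_div_correct'[symmetric])
    have cA: "c \<in> A" using c Suc.prems by auto
    have g: "g \<in> polys_over A" unfolding g_def by (rule synthetic_div_in_polys_over[OF ring Suc.prems(1) cA])
    have gn: "g \<notin> polys_over P"
    proof
      assume "g \<in> polys_over P"
      moreover have "[:- c, 1:] \<in> polys_over A"
        using cA subring_ofD[OF ring] subring_ofD(2)[OF subring_of_polys_over[OF ring]]
        by (auto simp: pCons_in_polys_over_iff zero_in_polys_over)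
      ultimately have "[:- c, 1:] * g \<in> polys_over P"
        using ideal_ofD(6)[OF ideal_of_polys_over[OF id]] by blast
      moreover have "[:poly f c:] \<in> polys_over P"
        using Suc.prems(5)[OF c] ideal_ofD(3)[OF id] by (auto simp: pCons_in_polys_over_iff zero_in_polys_over)
      ultimately have "f \<in> polys_over P"
        using ideal_ofD(4)[OF ideal_of_polys_over[OF id]] f by metis
      then show False using Suc.prems(2) by simp
    qed
    have "card (C - {c}) \<le> degree g"
    proof (rule Suc.hyps(1))
      show "n = degree g" unfolding g_def degree_synthetic_div Suc.hyps(2)[symmetric] by simp
      show "finite (C - {c})" "C - {c} \<subseteq> A" using Suc.prems by auto
      show "d - e \<notin> P" if "d \<in> C - {c}" "e \<in> C - {c}" "d \<noteq> e" for d e using Suc.prems(6) that by auto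
      fix d assume d: "d \<in> C - {c}"
      then have dA: "d \<in> A" using Suc.prems by auto
      have "poly f d = (d - c) * poly g d + poly f c" by (subst f) (simp add: algebra_simps)
      then have "(d - c) * poly g d = poly f d - poly f c" by simp
      then have "(d - c) * poly g d \<in> P" using Suc.prems(5) c d ideal_ofD(8)[OF id] by auto
      moreover have "d - c \<notin> P" using Suc.prems(6) c d by auto
      ultimately show "poly g d \<in> P"
        using prime_ideal_ofD(3)[OF P, of "d - c" "poly g d"] subring_ofD(6)[OF ring dA cA]
          poly_in_subring[OF ring g dA] by blast
    qed (use g gn in auto)
    moreover have "degree f = Suc (degree g)" unfolding g_def degree_synthetic_div Suc.hyps(2)[symmetric] by simp
    ultimately show ?thesis using c Suc.prems(3) by (simp add: card_Diff_singleton)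
  qed simp
qed

section \<open>Frobenius congruences\<close>

text \<open>The error term is kept as q times an explicit element, so the formula serves in any
  commutative ring, for numbers and polynomials alike.\<close>

lemma add_power_prime:
  fixes x y :: "'a :: comm_ring_1"
  assumes "prime q"
  shows "(x + y) ^ q = x ^ q + y ^ q + of_nat q * (\<Sum>k\<in>{1..<q}. of_nat ((q choose k) div q) * x ^ k * y ^ (q - k))"
proof -
  have q: "q > 1" using assms by (rule prime_gt_1_nat)
  have "(x + y) ^ q = (\<Sum>k\<le>q. of_nat (q choose k) * x ^ k * y ^ (q - k))" by (rule binomial_ring)
  also have "{..q} = insert 0 (insert q {1..<q})" using q by auto
  also have "(\<Sum>k\<in>\<dots>. of_nat (q choose k) * x ^ k * y ^ (q - k))
     = y ^ q + x ^ q + (\<Sum>k\<in>{1..<q}. of_nat (q choose k) * x ^ k * y ^ (q - k))"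
    using q by simp
  also have "(\<Sum>k\<in>{1..<q}. of_nat (q choose k) * x ^ k * y ^ (q - k))
     = (\<Sum>k\<in>{1..<q}. of_nat q * (of_nat ((q choose k) div q) * x ^ k * y ^ (q - k)))"
  proof (rule sum.cong[OF refl])
    fix k assume k: "k \<in> {1..<q}"
    then have "q dvd q choose k" using assms by (intro dvd_choose_prime) auto
    then have "q choose k = q * ((q choose k) div q)" by simp
    then have "of_nat (q choose k) = (of_nat q * of_nat ((q choose k) div q) :: 'a)"
      by (metis of_nat_mult)
    then show "of_nat (q choose k) * x ^ k * y ^ (q - k)
       = of_nat q * (of_nat ((q choose k) div q) * x ^ k * y ^ (q - k))"
      by (simp add: mult.assoc)
  qed
  finally show ?thesis by (simp add: sum_distrib_left add.commute)
qed

lemma ideal_cong_add_power: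
  assumes P: "ideal_of A P" and q: "prime q" "of_nat q \<in> P" and xy: "x \<in> A" "y \<in> A"
  shows "(x + y) ^ q - (x ^ q + y ^ q) \<in> P"
proof -
  note ring = ideal_ofD(1)[OF P]
  have "(\<Sum>k\<in>{1..<q}. of_nat ((q choose k) div q) * x ^ k * y ^ (q - k)) \<in> A"
    using xy by (intro subring_of_sum[OF ring] subring_ofD(5)[OF ring] subring_of_of_nat[OF ring] subring_of_power[OF ring])
  then show ?thesis unfolding add_power_prime[OF q(1)] using ideal_ofD(5)[OF P q(2)] by simp
qed

lemma of_nat_in_polys_over: "of_nat q \<in> P \<Longrightarrow> 0 \<in> P \<Longrightarrow> of_nat q \<in> polys_over P"
  by (simp add: of_nat_poly pCons_in_polys_over_iff zero_in_polys_over)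

text \<open>The q-th power is additive modulo an ideal containing q; on a polynomial it therefore
  raises the coefficients to the q-th power and replaces x by x^q.\<close>

lemma poly_power_prime_cong:
  assumes P: "ideal_of A P" and q: "prime q" "of_nat q \<in> P" and f: "f \<in> polys_over A"
  shows "f ^ q - map_poly (\<lambda>c. c ^ q) f \<circ>\<^sub>p monom 1 q \<in> polys_over P"
  using f
proof (induction f)
  case 0
  then show ?case using ideal_ofD(3)[OF P] prime_gt_0_nat[OF q(1)] by (simp add: power_0_left zero_in_polys_over)
next
  case (pCons a f)
  note PX = ideal_of_polys_over[OF P]
  note ring = ideal_ofD(1)[OF P]
  note ringX = ideal_ofD(1)[OF PX]
  have q0: "q > 0" using q(1) by (rule prime_gt_0_nat)
  have a: "a \<in> A" and f: "f \<in> polys_over A" using pCons.prems by (auto simp: pCons_in_polys_over_iff)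
  have X: "monom 1 k \<in> polys_over A" for k using subring_ofD[OF ring] by (intro monom_in_polys_over) auto
  have a': "[:a:] \<in> polys_over A" using a subring_ofD[OF ring] by (auto simp: pCons_in_polys_over_iff zero_in_polys_over)
  have eq: "pCons a f = [:a:] + monom 1 1 * f" by (simp add: monom_altdef)
  have 1: "(pCons a f) ^ q - ([:a:] ^ q + (monom 1 1 * f) ^ q) \<in> polys_over P"
    unfolding eq using ideal_ofD(3)[OF P] q
    by (intro ideal_cong_add_power[OF PX] of_nat_in_polys_over subring_ofD(5)[OF ringX] X a' f)
  have "(monom 1 1 * f) ^ q - monom 1 q * (map_poly (\<lambda>c. c ^ q) f \<circ>\<^sub>p monom 1 q) \<in> polys_over P"
    using ideal_ofD(6)[OF PX X pCons.IH[OF f], of q]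
    by (simp add: power_mult_distrib monom_power algebra_simps)
  then have 2: "[:a:] ^ q + (monom 1 1 * f) ^ q - ([:a:] ^ q + monom 1 q * (map_poly (\<lambda>c. c ^ q) f \<circ>\<^sub>p monom 1 q)) \<in> polys_over P"
    by simp
  have 3: "map_poly (\<lambda>c. c ^ q) (pCons a f) \<circ>\<^sub>p monom 1 q = [:a:] ^ q + monom 1 q * (map_poly (\<lambda>c. c ^ q) f \<circ>\<^sub>p monom 1 q)"
    using q0 pCons.hyps by (subst map_poly_pCons) (auto simp: pcompose_pCons poly_const_pow)
  show ?case unfolding 3 by (rule ideal_cong_trans[OF PX 1 2])
qed

text \<open>Fermat's little theorem: additivity of the q-th power modulo q gives an induction on
  natural numbers, and every integer is congruent to a natural number.\<close>

lemma prime_dvd_power_minus: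
  fixes c :: int
  assumes "prime q"
  shows "int q dvd c ^ q - c"
proof -
  have id: "ideal_of UNIV {x. int q dvd x}" by (auto simp: ideal_of_def subring_of_def)
  have q0: "q > 0" using assms by (rule prime_gt_0_nat)
  have nat: "int q dvd int n ^ q - int n" for n
  proof (induction n)
    case (Suc n)
    have "int q dvd (int n + 1) ^ q - (int n ^ q + 1 ^ q)"
      using ideal_cong_add_power[OF id assms, of "int n" 1] by simp
    from dvd_add[OF this Suc] show ?case by (simp add: algebra_simps)
  qed (use q0 in \<open>simp add: power_0_left\<close>)
  define n where "n = nat (c mod int q)"
  have n: "int n = c mod int q" using q0 by (simp add: n_def)
  have c: "[c = int n] (mod int q)" by (simp add: n cong_def)
  have "[c ^ q - c = int n ^ q - int n] (mod int q)" by (rule cong_diff[OF cong_pow[OF c] c])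
  from cong_dvd_iff[OF this] nat[of n] show ?thesis by simp
qed

section \<open>The ring of algebraic integers and its prime ideals\<close>

text \<open>The determinant trick: the generators form an eigenvector, nonzero by \<open>nz\<close>,
  of an integer matrix with eigenvalue \<open>x\<close>, and the characteristic polynomial of that
  matrix is monic with integer coefficients.\<close>

lemma algebraic_int_if_stable_span:
  fixes x :: complex
  assumes fin: "finite S" and nz: "\<exists>s\<in>S. s \<noteq> 0"
    and stable: "\<And>s. s \<in> S \<Longrightarrow> \<exists>c. x * s = (\<Sum>t\<in>S. of_int (c t) * t)"
  shows "algebraic_int x"
proof -
  obtain c where c: "\<And>s. s \<in> S \<Longrightarrow> x * s = (\<Sum>t\<in>S. of_int (c s t) * t)" using stable by metis
  obtain ss where ss: "set ss = S" "distinct ss" using finite_distinct_list[OF fin] by blast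
  define n where "n = length ss"
  define A where "A = mat n n (\<lambda>(i, j). c (ss ! i) (ss ! j))"
  define v where "v = vec n (\<lambda>i. ss ! i)"
  let ?A = "map_mat of_int A :: complex mat"
  have A: "A \<in> carrier_mat n n" "?A \<in> carrier_mat n n" by (auto simp: A_def)
  have Av: "?A *\<^sub>v v = x \<cdot>\<^sub>v v"
  proof (rule eq_vecI)
    fix i assume "i < dim_vec (x \<cdot>\<^sub>v v)"
    then have i: "i < n" by (simp add: v_def)
    then have "ss ! i \<in> S" using ss n_def by auto
    have "(?A *\<^sub>v v) $ i = (\<Sum>j\<in>{0..<n}. of_int (c (ss ! i) (ss ! j)) * ss ! j)"
      using i by (simp add: A_def v_def scalar_prod_def)
    also have "\<dots> = (\<Sum>t\<in>S. of_int (c (ss ! i) t) * t)"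
    proof (rule sum.reindex_bij_betw)
      show "bij_betw (\<lambda>j. ss ! j) {0..<n} S"
        using bij_betw_nth[OF ss(2), of "{0..<n}" S] ss(1) by (simp add: n_def lessThan_atLeast0)
    qed
    also have "\<dots> = (x \<cdot>\<^sub>v v) $ i" using c[OF \<open>ss ! i \<in> S\<close>] i by (simp add: v_def)
    finally show "(?A *\<^sub>v v) $ i = (x \<cdot>\<^sub>v v) $ i" .
  qed (simp add: A_def v_def)
  have v0: "v \<noteq> 0\<^sub>v n"
  proof
    assume "v = 0\<^sub>v n"
    obtain i where "i < n" "ss ! i \<noteq> 0" using nz ss by (metis in_set_conv_nth n_def)
    then show False using arg_cong[OF \<open>v = 0\<^sub>v n\<close>, of "\<lambda>v. v $ i"] by (simp add: v_def)
  qed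
  have dims: "dim_row ?A = n" "v \<in> carrier_vec n" by (simp_all add: A_def v_def)
  have "eigenvalue ?A x"
    unfolding eigenvalue_def eigenvector_def dims(1) using Av v0 dims(2) by blast
  then have "poly (char_poly ?A) x = 0" using eigenvalue_root_char_poly[OF A(2)] by blast
  then have "poly (map_poly of_int (char_poly A)) x = 0"
    by (simp add: of_int_hom.char_poly_hom[OF A(1)])
  then show ?thesis unfolding algebraic_int_altdef_ipoly
    using degree_monic_char_poly[OF A(1)] by (intro exI[of _ "char_poly A"]) auto
qed

text \<open>The finitely many products a^i b^j, with i and j below the degrees of monic equations
  for a and b, span an additive group stable under multiplication by a and by b.\<close>

lemma algebraic_int_add_mult:
  fixes a b :: complex
  assumes "algebraic_int a" "algebraic_int b"
  shows "algebraic_int (a + b)" "algebraic_int (a * b)"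
proof -
  obtain f where f: "poly (map_poly of_int f) a = 0" "lead_coeff f = 1"
    using assms(1) unfolding algebraic_int_altdef_ipoly by blast
  obtain g where g: "poly (map_poly of_int g) b = 0" "lead_coeff g = 1"
    using assms(2) unfolding algebraic_int_altdef_ipoly by blast
  define m where "m = degree f"
  define n where "n = degree g"
  define S where "S = (\<lambda>(i, j). a ^ i * b ^ j) ` ({..<m} \<times> {..<n})"
  define sp where "sp = {y. \<exists>c. y = (\<Sum>t\<in>S. of_int (c t) * t)}"
  have fin: "finite S" by (simp add: S_def)
  have sp_S: "s \<in> sp" if "s \<in> S" for s
  proof -
    have "(\<Sum>t\<in>S. of_int (if t = s then 1 else 0) * t) = (\<Sum>t\<in>S. if t = s then t else 0)"
      by (rule sum.cong) auto
    also have "\<dots> = s" using fin that by simp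
    finally show ?thesis unfolding sp_def by (intro CollectI exI[of _ "\<lambda>t. if t = s then 1 else 0"]) simp
  qed
  have sp_add: "x + y \<in> sp" if xy: "x \<in> sp" "y \<in> sp" for x y
  proof -
    obtain c d where "x = (\<Sum>t\<in>S. of_int (c t) * t)" "y = (\<Sum>t\<in>S. of_int (d t) * t)"
      using xy unfolding sp_def by blast
    then have "x + y = (\<Sum>t\<in>S. of_int (c t + d t) * t)" by (simp add: sum.distrib algebra_simps)
    then show ?thesis unfolding sp_def by (intro CollectI exI[of _ "\<lambda>t. c t + d t"])
  qed
  have sp_scale: "of_int k * x \<in> sp" if x: "x \<in> sp" for x k
  proof -
    obtain c where "x = (\<Sum>t\<in>S. of_int (c t) * t)" using x unfolding sp_def by blast
    then have "of_int k * x = (\<Sum>t\<in>S. of_int (k * c t) * t)" by (simp add: sum_distrib_left mult.assoc)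
    then show ?thesis unfolding sp_def by (intro CollectI exI[of _ "\<lambda>t. k * c t"])
  qed
  have sp_0: "0 \<in> sp" unfolding sp_def by (intro CollectI exI[of _ "\<lambda>_. 0"]) simp
  have sp_sum: "(\<Sum>i\<in>I. h i) \<in> sp" if "\<And>i. i \<in> I \<Longrightarrow> h i \<in> sp" for I :: "nat set" and h
    using that by (induction I rule: infinite_finite_induct) (auto intro: sp_add sp_0)
  \<comment> \<open>The monic equation rewrites the power z^d through lower ones; this handles the
    products that leave the list of monomials.\<close>
  have reduce: "z ^ d * w \<in> sp"
    if h: "poly (map_poly of_int h) z = 0" "lead_coeff h = 1" "d = degree h"
      and w: "\<And>i. i < d \<Longrightarrow> z ^ i * w \<in> sp" for h :: "int poly" and z d w
  proof -
    have "0 = (\<Sum>i\<le>d. of_int (coeff h i) * z ^ i)"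
      using h by (simp add: poly_altdef degree_map_poly coeff_map_poly)
    also have "{..d} = insert d {..<d}" by auto
    finally have "z ^ d = (\<Sum>i<d. of_int (- coeff h i) * z ^ i)"
      using h by (simp add: sum_negf eq_neg_iff_add_eq_0)
    then have zw: "z ^ d * w = (\<Sum>i<d. of_int (- coeff h i) * (z ^ i * w))"
      by (simp add: sum_distrib_right mult.assoc)
    show ?thesis unfolding zw by (rule sp_sum, rule sp_scale, rule w) simp
  qed
  have a_s: "a * s \<in> sp" if s: "s \<in> S" for s
  proof -
    obtain i j where ij: "i < m" "j < n" "s = a ^ i * b ^ j" using s by (auto simp: S_def)
    show ?thesis
    proof (cases "Suc i = m")
      case True
      have "a ^ m * b ^ j \<in> sp"
        using ij by (intro reduce[OF f(1,2) m_def] sp_S) (auto simp: S_def)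
      then show ?thesis unfolding ij(3) True[symmetric] by (simp add: mult.assoc)
    next
      case False
      then have "a ^ Suc i * b ^ j \<in> S" using ij unfolding S_def by (intro image_eqI[of _ _ "(Suc i, j)"]) auto
      then show ?thesis using ij sp_S by (simp add: mult.assoc)
    qed
  qed
  have b_s: "b * s \<in> sp" if s: "s \<in> S" for s
  proof -
    obtain i j where ij: "i < m" "j < n" "s = a ^ i * b ^ j" using s by (auto simp: S_def)
    show ?thesis
    proof (cases "Suc j = n")
      case True
      have "b ^ n * a ^ i \<in> sp"
        using ij by (intro reduce[OF g(1,2) n_def] sp_S) (auto simp: S_def mult.commute)
      then show ?thesis unfolding ij(3) True[symmetric] by (simp add: mult_ac)
    next
      case False
      then have "a ^ i * b ^ Suc j \<in> S" using ij unfolding S_def by (intro image_eqI[of _ _ "(i, Suc j)"]) auto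
      then show ?thesis using ij sp_S by (simp add: mult_ac)
    qed
  qed
  have a_sp: "a * y \<in> sp" if y: "y \<in> sp" for y
  proof -
    obtain c where "y = (\<Sum>t\<in>S. of_int (c t) * t)" using y unfolding sp_def by blast
    then have y': "a * y = (\<Sum>t\<in>S. of_int (c t) * (a * t))" by (simp add: sum_distrib_left mult_ac)
    have "(\<Sum>t\<in>T. of_int (c t) * (a * t)) \<in> sp" if "T \<subseteq> S" for T
      using finite_subset[OF that fin] that
      by (induction T rule: finite_induct) (auto intro!: sp_add sp_0 sp_scale a_s)
    then show ?thesis unfolding y' by blast
  qed
  have mn: "m > 0" "n > 0" using f g
    by (auto simp: m_def n_def intro!: Nat.gr0I elim!: degree_eq_zeroE)
  then have "1 \<in> S" unfolding S_def by (intro image_eqI[of _ _ "(0, 0)"]) auto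
  then have nz: "\<exists>s\<in>S. s \<noteq> 0" by (intro bexI[of _ 1]) auto
  have "(a + b) * s \<in> sp" if "s \<in> S" for s
    using sp_add[OF a_s[OF that] b_s[OF that]] by (simp add: algebra_simps)
  then show "algebraic_int (a + b)"
    by (intro algebraic_int_if_stable_span[OF fin nz]) (auto simp: sp_def)
  have "(a * b) * s \<in> sp" if "s \<in> S" for s
    using a_sp[OF b_s[OF that]] by (simp add: algebra_simps)
  then show "algebraic_int (a * b)"
    by (intro algebraic_int_if_stable_span[OF fin nz]) (auto simp: sp_def)
qed

definition alg_ints :: "complex set" where "alg_ints = {x. algebraic_int x}"

lemma subring_of_alg_ints: "subring_of alg_ints"
  by (auto simp: subring_of_def alg_ints_def intro: algebraic_int_add_mult)

text \<open>By Zorn's lemma some ideal is maximal among the proper ones containing p, and a maximal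
  ideal is prime.\<close>

lemma exists_prime_ideal_above:
  assumes "prime (p :: int)"
  shows "\<exists>P. prime_ideal_of alg_ints P \<and> of_int p \<in> P"
proof -
  note ring = subring_of_alg_ints
  define F where "F = {P. ideal_of alg_ints P \<and> of_int p \<in> P \<and> 1 \<notin> P}"
  define P0 where "P0 = (\<lambda>x. of_int p * x) ` alg_ints"
  have p1: "p > 1" using assms by (rule prime_gt_1_int)
  have "P0 \<in> F"
    unfolding F_def ideal_of_def
  proof (intro CollectI conjI ballI ring)
    show "P0 \<subseteq> alg_ints" unfolding P0_def using subring_of_of_int[OF ring] subring_ofD(5)[OF ring] by auto
    show "0 \<in> P0" unfolding P0_def using subring_ofD(1)[OF ring] by force
    show "of_int p \<in> P0" unfolding P0_def using subring_ofD(2)[OF ring] by force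
    show "x + y \<in> P0" if "x \<in> P0" "y \<in> P0" for x y
      using that subring_ofD(4)[OF ring] unfolding P0_def by (auto simp flip: distrib_left)
    show "x * y \<in> P0" if "x \<in> P0" "y \<in> alg_ints" for x y
      using that subring_ofD(5)[OF ring] unfolding P0_def by (auto simp: mult.assoc)
    show "1 \<notin> P0"
    proof
      assume "1 \<in> P0"
      then obtain x :: complex where x: "algebraic_int x" "of_int p * x = 1" unfolding P0_def alg_ints_def by (auto elim!: imageE)
      \<comment> \<open>The ideal generated by p is proper: otherwise 1/p would be an algebraic
        integer, while a rational algebraic integer is an integer.\<close>
      then have "x = 1 / of_int p" using p1 by (simp add: field_simps)
      then have "x \<in> \<rat>" by simp
      then have "x \<in> \<int>" using rational_algebraic_int_is_int[OF x(1)] by blast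
      then obtain k where "x = of_int k" by (auto elim: Ints_cases)
      then have "of_int (p * k) = (1 :: complex)" using x by simp
      then have "p * k = 1" by (metis of_int_eq_1_iff)
      then have "p dvd 1" by (metis dvd_triv_left)
      then show False using p1 by simp
    qed
  qed
  have "\<exists>P\<in>F. \<forall>X\<in>F. P \<subseteq> X \<longrightarrow> X = P"
  proof (rule subset_Zorn_nonempty)
    show "F \<noteq> {}" using \<open>P0 \<in> F\<close> by auto
    fix C assume C: "C \<noteq> {}" "subset.chain F C"
    have CF: "ideal_of alg_ints X" "of_int p \<in> X" "1 \<notin> X" if "X \<in> C" for X
      using C(2) that by (auto simp: subset.chain_def F_def)
    have chain: "X \<subseteq> Y \<or> Y \<subseteq> X" if "X \<in> C" "Y \<in> C" for X Y
      using C(2) that by (auto simp: subset.chain_def)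
    show "\<Union>C \<in> F"
      unfolding F_def ideal_of_def
    proof (intro CollectI conjI ballI ring)
      show "\<Union>C \<subseteq> alg_ints" using ideal_ofD(2)[OF CF(1)] by blast
      show "0 \<in> \<Union>C" "of_int p \<in> \<Union>C" "1 \<notin> \<Union>C" using C(1) CF(2,3) ideal_ofD(3)[OF CF(1)] by blast+
      show "x * y \<in> \<Union>C" if "x \<in> \<Union>C" "y \<in> alg_ints" for x y
        using that ideal_ofD(5)[OF CF(1)] by blast
      show "x + y \<in> \<Union>C" if xy: "x \<in> \<Union>C" "y \<in> \<Union>C" for x y
      proof -
        obtain X Y where XY: "X \<in> C" "x \<in> X" "Y \<in> C" "y \<in> Y" using xy by auto
        then obtain Z where Z: "Z \<in> C" "x \<in> Z" "y \<in> Z" using chain[of X Y] by blast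
        then have "x + y \<in> Z" using ideal_ofD(4)[OF CF(1)] by blast
        then show ?thesis using Z by auto
      qed
    qed
  qed
  then obtain P where P: "P \<in> F" and max: "\<And>X. X \<in> F \<Longrightarrow> P \<subseteq> X \<Longrightarrow> X = P" by blast
  have id: "ideal_of alg_ints P" and pP: "of_int p \<in> P" and P1: "1 \<notin> P" using P by (auto simp: F_def)
  have "y \<in> P" if x: "x \<in> alg_ints" and y: "y \<in> alg_ints" and xy: "x * y \<in> P" and nx: "x \<notin> P" for x y
  proof -
    \<comment> \<open>The ideal generated by P and x. If x is outside P, maximality puts 1 into it,
      and multiplying by y gives y in P.\<close>
    define X where "X = {u + x * v | u v. u \<in> P \<and> v \<in> alg_ints}"
    have PX: "P \<subseteq> X"
    proof
      fix u assume "u \<in> P"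
      then show "u \<in> X" unfolding X_def using subring_ofD(1)[OF ring]
        by (intro CollectI exI[of _ u] exI[of _ 0]) auto
    qed
    have xX: "x \<in> X" unfolding X_def using ideal_ofD(3)[OF id] subring_ofD(2)[OF ring]
      by (intro CollectI exI[of _ 0] exI[of _ 1]) auto
    have idX: "ideal_of alg_ints X"
      unfolding ideal_of_def
    proof (intro conjI ballI ring)
      show "X \<subseteq> alg_ints" unfolding X_def using ideal_ofD(2)[OF id] x
        by (auto intro!: subring_ofD(4,5)[OF ring])
      show "0 \<in> X" using PX ideal_ofD(3)[OF id] by auto
      show "s + t \<in> X" if st: "s \<in> X" "t \<in> X" for s t
      proof -
        obtain u v u' v' where "s = u + x * v" "t = u' + x * v'" "u \<in> P" "u' \<in> P" "v \<in> alg_ints" "v' \<in> alg_ints"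
          using st unfolding X_def by blast
        then have "s + t = (u + u') + x * (v + v')" "u + u' \<in> P" "v + v' \<in> alg_ints"
          using ideal_ofD(4)[OF id] subring_ofD(4)[OF ring] by (auto simp: algebra_simps)
        then show ?thesis unfolding X_def by blast
      qed
      show "s * t \<in> X" if st: "s \<in> X" "t \<in> alg_ints" for s t
      proof -
        obtain u v where "s = u + x * v" "u \<in> P" "v \<in> alg_ints" using st unfolding X_def by blast
        then have "s * t = u * t + x * (v * t)" "u * t \<in> P" "v * t \<in> alg_ints"
          using ideal_ofD(5)[OF id] subring_ofD(5)[OF ring] st(2) by (simp_all add: distrib_right)
        then show ?thesis unfolding X_def by blast
      qed
    qed
    have "1 \<in> X"
    proof (rule ccontr)
      assume "1 \<notin> X"
      then have "X \<in> F" unfolding F_def using idX PX pP by auto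
      then show False using max[OF _ PX] xX nx by auto
    qed
    then obtain u v where uv: "1 = u + x * v" "u \<in> P" "v \<in> alg_ints" unfolding X_def by blast
    have "y = 1 * y" by simp
    also have "\<dots> = u * y + (x * y) * v" unfolding uv(1) by (simp add: algebra_simps)
    finally show ?thesis
      using ideal_ofD(4)[OF id ideal_ofD(5)[OF id uv(2) y] ideal_ofD(5)[OF id xy uv(3)]] by simp
  qed
  then have "prime_ideal_of alg_ints P" using id P1 unfolding prime_ideal_of_def by blast
  then show ?thesis using pP by blast
qed

section \<open>Discriminants modulo a prime\<close>

lemma poly_eq_prod_proots:
  fixes G :: "complex poly"
  shows "poly G a = lead_coeff G * (\<Prod>b\<in>#proots G. a - b)"
proof -
  have "poly G a = poly (smult (lead_coeff G) (\<Prod>b\<in>#proots G. [:- b, 1:])) a"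
    by (simp only: complex_poly_decompose_multiset)
  also have "\<dots> = lead_coeff G * (\<Prod>b\<in>#proots G. a - b)"
    by (simp add: poly_prod_mset image_mset.compositionality o_def)
  finally show ?thesis .
qed

text \<open>Both sides expand to the double product of the differences between roots of
  \<open>F\<close> and roots of \<open>G\<close>, with the differences taken in opposite
  order.\<close>

lemma prod_proots_swap:
  fixes F G :: "complex poly"
  shows "lead_coeff F ^ degree G * (\<Prod>a\<in>#proots F. poly G a)
     = (-1) ^ (degree F * degree G) * (lead_coeff G ^ degree F * (\<Prod>b\<in>#proots G. poly F b))"
proof -
  have 1: "(\<Prod>a\<in>#proots F. poly G a) = lead_coeff G ^ degree F * (\<Prod>a\<in>#proots F. \<Prod>b\<in>#proots G. a - b)" for F G :: "complex poly"
  proof -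
    have "(\<Prod>a\<in>#proots F. poly G a) = (\<Prod>a\<in>#proots F. lead_coeff G * (\<Prod>b\<in>#proots G. a - b))"
      by (simp only: poly_eq_prod_proots[of G])
    then show ?thesis by (simp add: prod_mset.distrib prod_mset_constant size_proots_complex)
  qed
  have "(\<Prod>a\<in>#proots F. \<Prod>b\<in>#proots G. a - b) = (\<Prod>a\<in>#proots F. \<Prod>b\<in>#proots G. (-1) * (b - a))"
    by simp
  also have "\<dots> = (\<Prod>a\<in>#proots F. (-1) ^ degree G * (\<Prod>b\<in>#proots G. b - a))"
    by (simp only: prod_mset.distrib prod_mset_constant size_proots_complex)
  also have "\<dots> = ((-1) ^ degree G) ^ degree F * (\<Prod>a\<in>#proots F. \<Prod>b\<in>#proots G. b - a)"
    by (simp only: prod_mset.distrib prod_mset_constant size_proots_complex)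
  also have "(\<Prod>a\<in>#proots F. \<Prod>b\<in>#proots G. b - a) = (\<Prod>b\<in>#proots G. \<Prod>a\<in>#proots F. b - a)"
    by (rule prod_mset.swap)
  finally have 2: "(\<Prod>a\<in>#proots F. \<Prod>b\<in>#proots G. a - b)
     = (-1) ^ (degree F * degree G) * (\<Prod>b\<in>#proots G. \<Prod>a\<in>#proots F. b - a)"
    by (simp add: power_mult[symmetric] mult.commute)
  show ?thesis unfolding 1[of F G] 1[of G F] 2 by (simp add: mult_ac)
qed

text \<open>Euclid's algorithm: with H = F mod G, the subresultant identities relate the resultant
  of F and G to that of G and H, and on the product side F and H agree at the roots of G.\<close>

lemma resultant_eq_prod_proots_aux:
  fixes F G :: "complex poly"
  assumes "F \<noteq> 0" "G \<noteq> 0" "degree G \<le> degree F"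
  shows "resultant F G = lead_coeff F ^ degree G * (\<Prod>a\<in>#proots F. poly G a)"
  using assms
proof (induction "degree G" arbitrary: F G rule: less_induct)
  case less
  show ?case
  proof (cases "degree G = 0")
    case True
    then obtain c where "G = [:c:]" by (metis degree_eq_zeroE)
    moreover have "image_mset (poly [:c:]) (proots F) = image_mset (\<lambda>_. c) (proots F)"
      by (rule image_mset_cong) simp
    ultimately show ?thesis by (simp add: prod_mset_constant size_proots_complex)
  next
    case False
    define H where "H = F mod G"
    have FGH: "F + (- (F div G)) * G = H"
      unfolding H_def by (simp add: minus_div_mult_eq_mod[symmetric])
    have dH: "degree H < degree G" unfolding H_def
      using less.prems(2) False degree_mod_less[of G F] by auto
    have FH: "poly F b = poly H b" if "b \<in># proots G" for b
    proof -
      have "poly G b = 0" using that less.prems(2) by simp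
      then show ?thesis using arg_cong[OF FGH, of "\<lambda>f. poly f b"] by simp
    qed
    have prod_FH: "(\<Prod>b\<in>#proots G. poly F b) = (\<Prod>b\<in>#proots G. poly H b)"
      by (rule arg_cong[where f = prod_mset], rule image_mset_cong) (rule FH)
    have "resultant F G = (-1) ^ (degree F * degree G) * (lead_coeff G ^ degree F * (\<Prod>b\<in>#proots G. poly H b))"
    proof (cases "degree H = 0")
      case True
      \<comment> \<open>The recursion ends at a constant remainder c, possibly 0, where the product
        over the roots of G is c to the power deg G.\<close>
      then obtain c where c: "H = [:c:]" by (metis degree_eq_zeroE)
      have "subresultant 0 F G = smult ((-1) ^ ((degree F - 0) * (degree G - 0)) * lead_coeff G ^ (degree F - 0)
          * coeff H 0 ^ (degree G - 0 - 1)) H"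
        by (rule BT_eq_19[OF FGH less.prems(3)]) (use dH True False in auto)
      then have "resultant F G = (-1) ^ (degree F * degree G) * lead_coeff G ^ degree F * c ^ (degree G - 1) * c"
        by (simp add: subresultant_resultant c)
      also have "\<dots> = (-1) ^ (degree F * degree G) * (lead_coeff G ^ degree F * c ^ degree G)"
        using False by (cases "degree G") (simp_all add: mult_ac)
      finally have "resultant F G = (-1) ^ (degree F * degree G) * (lead_coeff G ^ degree F * c ^ degree G)" .
      moreover have "image_mset (poly [:c:]) (proots G) = image_mset (\<lambda>_. c) (proots G)"
        by (rule image_mset_cong) simp
      ultimately show ?thesis by (simp add: c prod_mset_constant size_proots_complex)
    next
      case dH0: False
      have "subresultant 0 F G = smult ((-1) ^ ((degree F - 0) * (degree G - 0)) * lead_coeff G ^ (degree F - degree H))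
          (subresultant 0 G H)"
        by (rule BT_lemma_1_12[OF FGH less.prems(3)]) (use dH dH0 in auto)
      then have "resultant F G = (-1) ^ (degree F * degree G) * lead_coeff G ^ (degree F - degree H) * resultant G H"
        by (simp add: subresultant_resultant)
      also have "resultant G H = lead_coeff G ^ degree H * (\<Prod>b\<in>#proots G. poly H b)"
        by (rule less.hyps[OF dH]) (use less.prems dH dH0 in auto)
      also have "(-1) ^ (degree F * degree G) * lead_coeff G ^ (degree F - degree H) * (lead_coeff G ^ degree H * (\<Prod>b\<in>#proots G. poly H b))
          = (-1) ^ (degree F * degree G) * (lead_coeff G ^ (degree F - degree H + degree H) * (\<Prod>b\<in>#proots G. poly H b))"
        by (simp add: power_add mult_ac)
      also have "degree F - degree H + degree H = degree F" using dH less.prems(3) by simp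
      finally show ?thesis .
    qed
    then show ?thesis unfolding prod_proots_swap[of F G] prod_FH .
  qed
qed

lemma resultant_eq_prod_proots:
  fixes F G :: "complex poly"
  assumes "F \<noteq> 0" "G \<noteq> 0"
  shows "resultant F G = lead_coeff F ^ degree G * (\<Prod>a\<in>#proots F. poly G a)"
proof (cases "degree G \<le> degree F")
  case True
  then show ?thesis using assms resultant_eq_prod_proots_aux by blast
next
  case False
  have "resultant F G = (-1) ^ (degree F * degree G) * resultant G F" by (rule resultant_swap)
  also have "resultant G F = lead_coeff G ^ degree F * (\<Prod>b\<in>#proots G. poly F b)"
    using False assms by (intro resultant_eq_prod_proots_aux) auto
  finally show ?thesis unfolding prod_proots_swap[of F G] .
qed

abbreviation cpoly :: "int poly \<Rightarrow> complex poly" where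
  "cpoly \<equiv> map_poly of_int"

abbreviation ipoly :: "int poly \<Rightarrow> complex \<Rightarrow> complex" where
  "ipoly f x \<equiv> poly (cpoly f) x"

lemma cpoly_hom:
  "cpoly (f + g) = cpoly f + cpoly g" "cpoly (f - g) = cpoly f - cpoly g" "cpoly (f * g) = cpoly f * cpoly g"
  "cpoly (prod_mset A) = prod_mset (image_mset cpoly A)" "cpoly [:c:] = [:of_int c:]" "cpoly 1 = 1"
proof -
  show "cpoly (f + g) = cpoly f + cpoly g" by (rule of_int_poly_hom.hom_add)
  show "cpoly (f - g) = cpoly f - cpoly g" by (rule of_int_poly_hom.hom_minus)
  show mult: "cpoly (f * g) = cpoly f * cpoly g" for f g by (rule of_int_poly_hom.hom_mult)
  show one: "cpoly 1 = 1" by simp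
  show "cpoly (prod_mset A) = prod_mset (image_mset cpoly A)"
    by (induction A) (simp_all add: mult del: map_poly_1)
  show "cpoly [:c:] = [:of_int c:]"
    by (rule poly_eqI) (simp add: coeff_map_poly coeff_pCons split: nat.split)
qed

lemma ipoly_hom:
  "ipoly (f + g) a = ipoly f a + ipoly g a" "ipoly (f - g) a = ipoly f a - ipoly g a"
  "ipoly (f * g) a = ipoly f a * ipoly g a" "ipoly [:c:] a = of_int c" "ipoly 1 a = 1"
  "ipoly (prod_mset A) a = (\<Prod>g\<in>#A. ipoly g a)"
  by (simp_all only: cpoly_hom poly_add poly_diff poly_mult poly_pCons poly_0 poly_1 mult_zero_right add_0_right
      poly_prod_mset image_mset.compositionality o_def)

text \<open>For monic \<open>f\<close> the power of the leading coefficient in the product formula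
  and the division in \<open>discriminant\<close> are both trivial; only the sign remains.\<close>

lemma discriminant_eq_prod:
  fixes f :: "int poly"
  assumes f: "lead_coeff f = 1" and deg: "degree f > 0"
  shows "of_int (discriminant f) = (-1) ^ (degree f * (degree f - 1) div 2) * (\<Prod>a\<in>#proots (cpoly f). ipoly (pderiv f) a)"
proof -
  have "pderiv f \<noteq> 0" using deg by (simp add: pderiv_eq_0_iff)
  have "f \<noteq> 0" using deg by auto
  have "of_int (resultant f (pderiv f)) = resultant (cpoly f) (cpoly (pderiv f))"
    by (rule of_int_hom.resultant_hom[symmetric])
  also have "\<dots> = (\<Prod>a\<in>#proots (cpoly f). ipoly (pderiv f) a)"
    using \<open>pderiv f \<noteq> 0\<close> \<open>f \<noteq> 0\<close> f by (subst resultant_eq_prod_proots) simp_all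
  finally show ?thesis using f by (simp add: discriminant_def)
qed

lemma root_in_alg_ints: "lead_coeff f = 1 \<Longrightarrow> ipoly f a = 0 \<Longrightarrow> a \<in> alg_ints"
  unfolding alg_ints_def algebraic_int_altdef_ipoly by blast

lemma cpoly_over_alg_ints: "cpoly f \<in> polys_over alg_ints"
  by (auto simp: polys_over_def coeff_map_poly intro: subring_of_of_int[OF subring_of_alg_ints])

lemma ipoly_in_alg_ints: "a \<in> alg_ints \<Longrightarrow> ipoly f a \<in> alg_ints"
  by (rule poly_in_subring[OF subring_of_alg_ints cpoly_over_alg_ints])

section \<open>Separability modulo p and the discriminant\<close>

context poly_mod_prime
begin

lemma prime_nat_p: "prime (nat p)" "int (nat p) = p"
proof -
  show "prime (nat p)" using prime unfolding prime_int_nat_transfer by blast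
  show "int (nat p) = p" using m1 by simp
qed

text \<open>Over the integers, Fermat's theorem removes the p-th powers from the coefficients in the
  general congruence.\<close>

lemma power_p_eq_m: "Mp (f ^ nat p) = Mp (f \<circ>\<^sub>p monom 1 (nat p))"
proof -
  have id: "ideal_of UNIV {x :: int. p dvd x}" by (auto simp: ideal_of_def subring_of_def)
  have 1: "f ^ nat p - map_poly (\<lambda>c. c ^ nat p) f \<circ>\<^sub>p monom 1 (nat p) \<in> polys_over {x. p dvd x}"
    by (rule poly_power_prime_cong[OF id]) (use prime_nat_p in \<open>auto simp: polys_over_def\<close>)
  have "p dvd coeff (f ^ nat p) i - coeff (f \<circ>\<^sub>p monom 1 (nat p)) i" for i
  proof -
    have q: "nat p > 0" using m1 by simp
    have i: "i = nat p * (i div nat p) + i mod nat p" "i mod nat p < nat p" using q by simp_all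
    have "coeff (g \<circ>\<^sub>p monom 1 (nat p)) i = (if i mod nat p = 0 then coeff g (i div nat p) else 0)" for g :: "int poly"
      by (subst i(1), rule coeff_pcompose_monom[OF i(2)])
    then have 2: "p dvd coeff (map_poly (\<lambda>c. c ^ nat p) f \<circ>\<^sub>p monom 1 (nat p)) i - coeff (f \<circ>\<^sub>p monom 1 (nat p)) i"
      using prime_dvd_power_minus[OF prime_nat_p(1)] prime_nat_p(2) q
      by (simp add: coeff_map_poly power_0_left)
    have "p dvd coeff (f ^ nat p) i - coeff (map_poly (\<lambda>c. c ^ nat p) f \<circ>\<^sub>p monom 1 (nat p)) i"
      using polys_overD[OF 1, of i] by simp
    from dvd_add[OF this 2] show ?thesis by simp
  qed
  then show ?thesis by (auto simp: poly_eq_iff Mp_coeff M_def mod_eq_dvd_iff)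
qed

text \<open>F_p is perfect. As g' has smaller degree, divisibility would force g' = 0 modulo p; then
  only exponents divisible by p occur in g, so g is congruent to R(x^p), that is to R^p, which is
  not irreducible.\<close>

lemma irreducible_not_dvdm_pderiv:
  assumes g: "g \<in> monic_irr"
  shows "\<not> g dvdm pderiv g"
proof
  assume "g dvdm pderiv g"
  then obtain h where h: "Mp (pderiv g) = Mp (g * h)" by (auto simp: dvdm_def)
  have "Mp (pderiv g) = 0"
  proof (rule ccontr)
    assume nz: "Mp (pderiv g) \<noteq> 0"
    have h': "Mp (pderiv g) = Mp (g * Mp h)" using h by simp
    have h0: "Mp h \<noteq> 0"
    proof
      assume "Mp h = 0"
      then show False using nz h' by simp
    qed
    have g0: "g \<noteq> 0" using monic_irrD(2)[OF g] by auto
    have lc: "lead_coeff (g * Mp h) = lead_coeff (Mp h)"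
      using monic_irrD(2)[OF g] by (simp add: lead_coeff_mult)
    have "M (lead_coeff (Mp h)) = lead_coeff (Mp h)" by (simp add: Mp_coeff)
    then have "degree (Mp (g * Mp h)) = degree (g * Mp h)"
      by (intro degree_m_eq[OF _ m1]) (use h0 lc in \<open>simp add: M_def\<close>)
    also have "\<dots> \<ge> degree g" using g0 h0 by (simp add: degree_mult_eq)
    finally have "degree g \<le> degree (Mp (pderiv g))" using h' by simp
    also have "\<dots> \<le> degree (pderiv g)" by (rule degree_m_le)
    also have "\<dots> < degree g" using monic_irrD(5)[OF g] by (simp add: degree_pderiv)
    finally show False by simp
  qed
  then have pd: "p dvd int (Suc i) * coeff g (Suc i)" for i
    by (simp add: poly_eq_iff Mp_coeff M_def coeff_pderiv dvd_eq_mod_eq_0)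
  define q where "q = nat p"
  have q: "q > 0" "prime q" "int q = p" using m1 prime_nat_p by (auto simp: q_def)
  \<comment> \<open>Keeping every q-th coefficient gives a p-th root of \<open>g\<close> modulo
    p.\<close>
  define R where "R = (\<Sum>i\<le>degree g. monom (coeff g (q * i)) i)"
  have cR: "coeff R i = coeff g (q * i)" for i
  proof (cases "i \<le> degree g")
    case False
    then have "degree g < q * i" using q(1) by (metis Suc_leI less_le_trans mult_le_mono1 nat_mult_1 not_le One_nat_def)
    then show ?thesis using False by (simp add: R_def coeff_sum sum.delta' coeff_eq_0)
  qed (simp add: R_def coeff_sum sum.delta')
  have "Mp g = Mp (R \<circ>\<^sub>p monom 1 q)"
  proof (rule poly_eqI)
    fix i
    have i: "i = q * (i div q) + i mod q" "i mod q < q" using q by simp_all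
    have c: "coeff (R \<circ>\<^sub>p monom 1 q) i = (if i mod q = 0 then coeff R (i div q) else 0)"
      by (subst i(1), rule coeff_pcompose_monom[OF i(2)])
    show "coeff (Mp g) i = coeff (Mp (R \<circ>\<^sub>p monom 1 q)) i"
    proof (cases "i mod q = 0")
      case True
      then show ?thesis using i(1) by (simp add: Mp_coeff c cR)
    next
      case False
      then obtain j where j: "i = Suc j" by (cases i) auto
      have "\<not> p dvd int i" using False q(3) by (metis int_dvd_int_iff dvd_imp_mod_0)
      then have "p dvd coeff g i" using pd[of j] prime unfolding j by (simp add: prime_dvd_mult_iff del: of_nat_Suc)
      then show ?thesis using False by (simp add: Mp_coeff c M_def)
    qed
  qed
  also have "\<dots> = Mp (R ^ q)" using power_p_eq_m[of R] by (simp add: q_def)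
  finally have gRq: "Mp g = Mp (R ^ q)" .
  then have gR: "Mp g = Mp (R * R ^ (q - 1))" using q(1) by (cases q) auto
  then have "R dvdm 1 \<or> R ^ (q - 1) dvdm 1" using monic_irrD(3)[OF g] unfolding irreducible_m_def by blast
  then have "R dvdm 1"
  proof
    assume *: "R ^ (q - 1) dvdm 1"
    obtain m where m: "q - 1 = Suc m" using prime_gt_1_nat[OF q(2)] by (cases "q - 1") auto
    have "Mp (R ^ (q - 1)) = Mp (R * R ^ m)" unfolding m by simp
    then have "R dvdm R ^ (q - 1)" unfolding dvdm_def by blast
    then show ?thesis using * dvdm_trans' by blast
  qed
  then obtain s where s: "Mp 1 = Mp (R * s)" by (auto simp: dvdm_def)
  have "Mp 1 = Mp (R ^ k * s ^ k)" for k
  proof (induction k)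
    case (Suc k)
    have "R ^ Suc k * s ^ Suc k = (R * s) * (R ^ k * s ^ k)" by (simp add: mult_ac)
    then have "Mp (R ^ Suc k * s ^ Suc k) = Mp (Mp (R * s) * Mp (R ^ k * s ^ k))" by (simp only: mult_Mp)
    also have "\<dots> = Mp 1" unfolding Suc[symmetric] s[symmetric] by simp
    finally show ?case by simp
  qed simp
  from this[of q] have "Mp 1 = Mp (Mp (R ^ q) * s ^ q)" by simp
  also have "\<dots> = Mp (g * s ^ q)" unfolding gRq[symmetric] by simp
  finally have "g dvdm 1" unfolding dvdm_def by blast
  then show False using monic_irrD(4)[OF g] by simp
qed

end

text \<open>\<open>\<mm>\<close> plays the role of the kernel of reduction to an algebraic closure
  of F_p; a congruence modulo \<open>\<mm>\<close> replaces an equation there.\<close>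

locale prime_above = poly_mod_prime p for p :: int +
  fixes \<mm> :: "complex set"
  assumes prime_ideal: "prime_ideal_of alg_ints \<mm>" and p_in: "of_int p \<in> \<mm>"
begin

lemmas ideal = prime_ideal_ofD(1)[OF prime_ideal]
lemmas idealD = ideal_ofD[OF ideal]

text \<open>\<open>\<mm>\<close> meets Z in pZ: an integer prime to p would give 1 in
  \<open>\<mm>\<close> by Bezout.\<close>

lemma of_int_in_iff: "of_int k \<in> \<mm> \<longleftrightarrow> p dvd k"
proof
  assume k: "of_int k \<in> \<mm>"
  show "p dvd k"
  proof (rule ccontr)
    assume "\<not> p dvd k"
    then have "Rings.coprime p k" using prime by (simp add: prime_imp_coprime)
    then obtain u v where "u * p + v * k = 1"
      using bezout_int[of p k] by (auto simp: coprime_iff_gcd_eq_1)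
    then have "of_int u * of_int p + of_int v * of_int k = (1 :: complex)"
      by (metis of_int_add of_int_mult of_int_1)
    moreover have "of_int u * of_int p + of_int v * of_int k \<in> \<mm>"
      by (intro idealD(4,6) subring_of_of_int[OF idealD(1)] p_in k)
    ultimately show False using prime_ideal_ofD(2)[OF prime_ideal] by simp
  qed
next
  assume "p dvd k"
  then obtain j where "k = p * j" by blast
  then show "of_int k \<in> \<mm>" using idealD(5)[OF p_in subring_of_of_int[OF idealD(1), of j]] by simp
qed

lemma ipoly_cong:
  assumes "Mp f = Mp g" "a \<in> alg_ints"
  shows "ipoly f a - ipoly g a \<in> \<mm>"
proof -
  obtain k where "f = g + [:p:] * k" using assms(1) unfolding eq_m_iff by blast
  then have "ipoly f a - ipoly g a = of_int p * ipoly k a" by (simp only: ipoly_hom) simp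
  then show ?thesis using idealD(5)[OF p_in ipoly_in_alg_ints[OF assms(2)]] by simp
qed

lemma ipoly_cong_mem: "Mp f = Mp g \<Longrightarrow> a \<in> alg_ints \<Longrightarrow> ipoly f a \<in> \<mm> \<longleftrightarrow> ipoly g a \<in> \<mm>"
  using ideal_cong_mem[OF ideal ipoly_cong] by blast

text \<open>Evaluating the Bezout relation of \<open>g\<close> and \<open>h\<close> at a common root
  modulo \<open>\<mm>\<close> would put 1 into \<open>\<mm>\<close>.\<close>

lemma irr_root_not_root:
  assumes g: "g \<in> monic_irr" and a: "a \<in> alg_ints" "ipoly g a \<in> \<mm>" and "\<not> g dvdm h"
  shows "ipoly h a \<notin> \<mm>"
proof
  assume h: "ipoly h a \<in> \<mm>"
  obtain u v k where "u * g + v * h = 1 + [:p:] * k"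
    using bezout_m[OF monic_irrD(2,3)[OF g] assms(4)] .
  from arg_cong[OF this, of "\<lambda>f. ipoly f a"]
  have "1 = ipoly u a * ipoly g a + ipoly v a * ipoly h a - of_int p * ipoly k a"
    by (simp only: ipoly_hom) simp
  also have "\<dots> \<in> \<mm>"
    by (intro idealD(4,8) idealD(6)[OF ipoly_in_alg_ints] idealD(5)[OF p_in ipoly_in_alg_ints] a h)
  finally show False using prime_ideal_ofD(2)[OF prime_ideal] by simp
qed

lemma irr_roots_disjoint:
  assumes "g \<in> monic_irr" "h \<in> monic_irr" "a \<in> alg_ints" "ipoly g a \<in> \<mm>" "ipoly h a \<in> \<mm>"
  shows "g = h"
  using irr_root_not_root[of g a h] assms monic_irr_dvdm_eq by blast

lemma root_of_some_factor:
  assumes f: "lead_coeff f = 1" and a: "ipoly f a = 0"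
  shows "\<exists>g\<in>#factors_m f. ipoly g a \<in> \<mm>"
proof -
  have aA: "a \<in> alg_ints" by (rule root_in_alg_ints[OF f a])
  have "ipoly (prod_mset (factors_m f)) a \<in> \<mm>"
    using ipoly_cong_mem[OF factors_m(2)[OF f] aA] a idealD(3) by simp
  then have "(\<Prod>g\<in>#factors_m f. ipoly g a) \<in> \<mm>" by (simp only: ipoly_hom)
  then have "\<exists>x\<in>#image_mset (\<lambda>g. ipoly g a) (factors_m f). x \<in> \<mm>"
    by (intro prime_ideal_of_prod_mset[OF prime_ideal]) (auto intro: ipoly_in_alg_ints[OF aA])
  then show ?thesis by auto
qed

text \<open>Take a complex root b of \<open>g\<close>. Then f(b), the product of b - a over the
  roots a of \<open>f\<close>, lies in \<open>\<mm>\<close>, so b is congruent to some root a of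
  \<open>f\<close>, and g(a) is congruent to g(b) = 0.\<close>

lemma factor_has_root:
  assumes f: "lead_coeff f = 1" and g: "g \<in># factors_m f"
  shows "\<exists>a. ipoly f a = 0 \<and> ipoly g a \<in> \<mm>"
proof -
  have gi: "g \<in> monic_irr" using factors_m(1)[OF f] g by auto
  have "\<not> constant (poly (cpoly g))" using monic_irrD(5)[OF gi] by (simp add: constant_degree)
  then obtain b where b: "ipoly g b = 0" using fundamental_theorem_of_algebra by blast
  have bA: "b \<in> alg_ints" by (rule root_in_alg_ints[OF monic_irrD(2)[OF gi] b])
  obtain h where "Mp f = Mp (g * h)" using monic_irr_dvdm_iff[OF f gi] g by (auto simp: dvdm_def)
  then have "ipoly f b \<in> \<mm>" using ipoly_cong_mem[OF _ bA, of f "g * h"] b idealD(3) by (simp add: ipoly_hom)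
  moreover have "ipoly f b = (\<Prod>a\<in>#proots (cpoly f). b - a)"
    using f by (subst poly_eq_prod_proots) simp
  moreover have f0: "cpoly f \<noteq> 0" using f by auto
  have roots: "a \<in> alg_ints" "ipoly f a = 0" if "a \<in># proots (cpoly f)" for a
    using that f0 root_in_alg_ints[OF f] by auto
  ultimately obtain a where a: "a \<in># proots (cpoly f)" "b - a \<in> \<mm>"
    using prime_ideal_of_prod_mset[OF prime_ideal, of "{#b - a. a \<in># proots (cpoly f)#}"]
      subring_ofD(6)[OF idealD(1) bA] by auto
  have "ipoly g b - ipoly g a \<in> \<mm>"
    by (rule ideal_cong_poly[OF ideal cpoly_over_alg_ints bA roots(1)[OF a(1)] a(2)])
  then have "ipoly g a \<in> \<mm>" using b idealD(7) by fastforce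
  then show ?thesis using roots(2)[OF a(1)] by blast
qed

text \<open>At a root a over the factor g, the derivative of f is congruent to g'(a) times the value
  of the remaining factors. The first is outside \<open>\<mm>\<close> by separability, the second
  because distinct irreducibles share no root modulo \<open>\<mm>\<close>.\<close>

lemma pderiv_root_not_in:
  assumes f: "lead_coeff f = 1" and sf: "\<And>g. count (factors_m f) g \<le> 1" and a: "ipoly f a = 0"
  shows "ipoly (pderiv f) a \<notin> \<mm>"
proof
  assume pd: "ipoly (pderiv f) a \<in> \<mm>"
  have aA: "a \<in> alg_ints" by (rule root_in_alg_ints[OF f a])
  obtain g where g: "g \<in># factors_m f" "ipoly g a \<in> \<mm>" using root_of_some_factor[OF f a] by blast
  have gi: "g \<in> monic_irr" using factors_m(1)[OF f] g(1) by auto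
  obtain B where B: "factors_m f = add_mset g B" using g(1) by (metis mset_add)
  have gB: "g \<notin># B" using sf[of g] unfolding B by (simp add: not_in_iff)
  obtain k where k: "f = g * prod_mset B + [:p:] * k"
    using factors_m(2)[OF f] unfolding B eq_m_iff by auto
  have "pderiv f = g * pderiv (prod_mset B) + prod_mset B * pderiv g + [:p:] * pderiv k"
    by (subst k) (simp add: pderiv_add pderiv_mult pderiv_smult)
  from arg_cong[OF this, of "\<lambda>f. ipoly f a"]
  have "ipoly (prod_mset B) a * ipoly (pderiv g) a
     = ipoly (pderiv f) a - ipoly g a * ipoly (pderiv (prod_mset B)) a - of_int p * ipoly (pderiv k) a"
    by (simp only: ipoly_hom(1-4)) simp
  also have "\<dots> \<in> \<mm>"
    by (intro idealD(8) idealD(5)[OF g(2) ipoly_in_alg_ints] idealD(5)[OF p_in ipoly_in_alg_ints] pd aA)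
  finally have "ipoly (prod_mset B) a \<in> \<mm> \<or> ipoly (pderiv g) a \<in> \<mm>"
    using prime_ideal_ofD(3)[OF prime_ideal] ipoly_in_alg_ints[OF aA] by blast
  then show False
  proof
    assume "ipoly (pderiv g) a \<in> \<mm>"
    then show False using irr_root_not_root[OF gi aA g(2) irreducible_not_dvdm_pderiv[OF gi]] by simp
  next
    assume "ipoly (prod_mset B) a \<in> \<mm>"
    then have "(\<Prod>g\<in>#B. ipoly g a) \<in> \<mm>" by (simp only: ipoly_hom)
    then have "\<exists>x\<in>#image_mset (\<lambda>g. ipoly g a) B. x \<in> \<mm>"
      by (intro prime_ideal_of_prod_mset[OF prime_ideal]) (auto intro: ipoly_in_alg_ints[OF aA])
    then obtain h where h: "h \<in># B" "ipoly h a \<in> \<mm>" by auto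
    have "h \<in> monic_irr" using factors_m(1)[OF f] h(1) unfolding B by auto
    then show False using irr_roots_disjoint[OF gi _ aA g(2) h(2)] h(1) gB by blast
  qed
qed

text \<open>A repeated factor divides the derivative modulo p, and some root of \<open>f\<close>
  lies over it.\<close>

lemma pderiv_root_in:
  assumes f: "lead_coeff f = 1" and rep: "count (factors_m f) g \<ge> 2"
  shows "\<exists>a. ipoly f a = 0 \<and> ipoly (pderiv f) a \<in> \<mm>"
proof -
  have "g \<in># factors_m f" using rep by (intro count_inI) auto
  then obtain B where B: "factors_m f = add_mset g B" by (metis mset_add)
  have "g \<in># B" using rep unfolding B by (intro count_inI) auto
  then obtain C where C: "B = add_mset g C" by (metis mset_add)
  obtain a where a: "ipoly f a = 0" "ipoly g a \<in> \<mm>"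
    using factor_has_root[OF f \<open>g \<in># factors_m f\<close>] by blast
  have aA: "a \<in> alg_ints" by (rule root_in_alg_ints[OF f a(1)])
  obtain k where k: "f = g * (g * prod_mset C) + [:p:] * k"
    using factors_m(2)[OF f] unfolding B C eq_m_iff by auto
  have "pderiv f = g * (pderiv (g * prod_mset C) + prod_mset C * pderiv g) + [:p:] * pderiv k"
    by (subst k) (simp add: pderiv_add pderiv_mult[of g "g * prod_mset C"] pderiv_smult algebra_simps)
  from arg_cong[OF this, of "\<lambda>f. ipoly f a"]
  have "ipoly (pderiv f) a = ipoly g a * ipoly (pderiv (g * prod_mset C) + prod_mset C * pderiv g) a + of_int p * ipoly (pderiv k) a"
    by (simp only: ipoly_hom(1-4))
  also have "\<dots> \<in> \<mm>"
    by (intro idealD(4) idealD(5)[OF a(2) ipoly_in_alg_ints] idealD(5)[OF p_in ipoly_in_alg_ints] aA)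
  finally show ?thesis using a(1) by blast
qed

text \<open>Up to sign the discriminant is the product of f'(a) over the roots, so it lies in the
  prime ideal \<open>\<mm>\<close> exactly when some f'(a) does; and the integers in
  \<open>\<mm>\<close> are the multiples of p.\<close>

lemma dvd_discriminant_iff:
  assumes f: "lead_coeff f = 1" and deg: "degree f > 0"
  shows "p dvd discriminant f \<longleftrightarrow> \<not> (\<forall>g. count (factors_m f) g \<le> 1)"
proof -
  let ?D = "\<Prod>a\<in>#proots (cpoly f). ipoly (pderiv f) a"
  have f0: "cpoly f \<noteq> 0" using f by auto
  have roots: "a \<in> alg_ints" "ipoly f a = 0" if "a \<in># proots (cpoly f)" for a
    using that f0 root_in_alg_ints[OF f] by auto
  have "p dvd discriminant f \<longleftrightarrow> of_int (discriminant f) \<in> \<mm>" by (simp add: of_int_in_iff)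
  also have "\<dots> \<longleftrightarrow> ?D \<in> \<mm>"
  proof -
    have "of_int (discriminant f) = ?D \<or> of_int (discriminant f) = - ?D"
      unfolding discriminant_eq_prod[OF assms] by (simp add: minus_one_power_iff)
    then show ?thesis using idealD(7)[of ?D] idealD(7)[of "- ?D"] by auto
  qed
  also have "\<dots> \<longleftrightarrow> (\<exists>a. ipoly f a = 0 \<and> ipoly (pderiv f) a \<in> \<mm>)"
  proof
    assume "?D \<in> \<mm>"
    then have "\<exists>x\<in>#image_mset (\<lambda>a. ipoly (pderiv f) a) (proots (cpoly f)). x \<in> \<mm>"
      by (intro prime_ideal_of_prod_mset[OF prime_ideal]) (auto intro: ipoly_in_alg_ints roots)
    then show "\<exists>a. ipoly f a = 0 \<and> ipoly (pderiv f) a \<in> \<mm>" using roots by auto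
  next
    assume "\<exists>a. ipoly f a = 0 \<and> ipoly (pderiv f) a \<in> \<mm>"
    then obtain a where a: "ipoly f a = 0" "ipoly (pderiv f) a \<in> \<mm>" by blast
    then have "a \<in># proots (cpoly f)" using f0 by simp
    then obtain R where R: "proots (cpoly f) = add_mset a R" by (metis mset_add)
    have "(\<Prod>a\<in>#R. ipoly (pderiv f) a) \<in> alg_ints"
      by (rule subring_of_prod_mset[OF idealD(1)]) (use roots in \<open>auto simp: R intro: ipoly_in_alg_ints\<close>)
    then show "?D \<in> \<mm>" unfolding R using idealD(5)[OF a(2)] by simp
  qed
  also have "\<dots> \<longleftrightarrow> \<not> (\<forall>g. count (factors_m f) g \<le> 1)"
    using pderiv_root_not_in[OF f] pderiv_root_in[OF f] by (metis Suc_1 not_less_eq_eq)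
  finally show ?thesis .
qed

text \<open>At every root a the value f'(a) is outside \<open>\<mm>\<close>, hence nonzero, so all
  roots are simple.\<close>

lemma card_roots:
  assumes f: "lead_coeff f = 1" and sf: "\<And>g. count (factors_m f) g \<le> 1"
  shows "card {a. ipoly f a = 0} = degree f"
proof -
  have f0: "cpoly f \<noteq> 0" using f by auto
  have "cpoly (pderiv f) = pderiv (cpoly f)" by (simp add: of_int_hom.map_poly_pderiv)
  then have "poly (pderiv (cpoly f)) a \<noteq> 0" if "ipoly f a = 0" for a
    using pderiv_root_not_in[OF f sf that] idealD(3) by auto
  then have "rsquarefree (cpoly f)" unfolding rsquarefree_roots by blast
  then have "order a (cpoly f) = 1" if "ipoly f a = 0" for a
    using that rsquarefree_root_order f0 by blast
  then have "proots (cpoly f) = mset_set {a. ipoly f a = 0}"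
    using f0 poly_roots_finite[OF f0] by (auto simp: multiset_eq_iff count_mset_set' order_root)
  then have "size (proots (cpoly f)) = card {a. ipoly f a = 0}" by simp
  then show ?thesis by (simp add: size_proots_complex)
qed

end

section \<open>The Galois group of a splitting field\<close>

text \<open>The target is the whole type: an embedding of a subfield into the complex numbers need
  not preserve it. That it does so for a splitting field is proved in
  \<open>hom_on_splitting_field_bij\<close>.\<close>

definition hom_on :: "'a :: comm_ring_1 set \<Rightarrow> ('a \<Rightarrow> 'a) \<Rightarrow> bool" where
  "hom_on K \<tau> \<longleftrightarrow> subring_of K \<and> \<tau> 1 = 1 \<and> (\<forall>x\<in>K. \<forall>y\<in>K. \<tau> (x + y) = \<tau> x + \<tau> y \<and> \<tau> (x * y) = \<tau> x * \<tau> y)"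

lemma hom_onD:
  assumes "hom_on K \<tau>"
  shows "subring_of K" "\<tau> 1 = 1" "x \<in> K \<Longrightarrow> y \<in> K \<Longrightarrow> \<tau> (x + y) = \<tau> x + \<tau> y"
    "x \<in> K \<Longrightarrow> y \<in> K \<Longrightarrow> \<tau> (x * y) = \<tau> x * \<tau> y" "\<tau> 0 = 0" "x \<in> K \<Longrightarrow> \<tau> (- x) = - \<tau> x"
    "x \<in> K \<Longrightarrow> y \<in> K \<Longrightarrow> \<tau> (x - y) = \<tau> x - \<tau> y"
proof -
  show *: "subring_of K" "\<tau> 1 = 1" and add: "x \<in> K \<Longrightarrow> y \<in> K \<Longrightarrow> \<tau> (x + y) = \<tau> x + \<tau> y"
    and "x \<in> K \<Longrightarrow> y \<in> K \<Longrightarrow> \<tau> (x * y) = \<tau> x * \<tau> y" for x y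
    using assms by (auto simp: hom_on_def)
  show z: "\<tau> 0 = 0" using add[of 0 0] subring_ofD(1)[OF *(1)] by simp
  show neg: "x \<in> K \<Longrightarrow> \<tau> (- x) = - \<tau> x" for x
    using add[of x "- x"] subring_ofD(3)[OF *(1), of x] z by (simp add: eq_neg_iff_add_eq_0 add.commute)
  show "x \<in> K \<Longrightarrow> y \<in> K \<Longrightarrow> \<tau> (x - y) = \<tau> x - \<tau> y"
    using add[of x "- y"] neg[of y] subring_ofD(3)[OF *(1), of y] by simp
qed

lemma hom_on_sum:
  assumes "hom_on K \<tau>" "\<And>i. i \<in> I \<Longrightarrow> g i \<in> K"
  shows "\<tau> (sum g I) = (\<Sum>i\<in>I. \<tau> (g i))"
  using assms(2)
  by (induction I rule: infinite_finite_induct)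
    (simp_all add: hom_onD(3,5)[OF assms(1)] subring_of_sum[OF hom_onD(1)[OF assms(1)]])

lemma hom_on_prod:
  assumes "hom_on K \<tau>" "\<And>i. i \<in> I \<Longrightarrow> g i \<in> K"
  shows "\<tau> (prod g I) = (\<Prod>i\<in>I. \<tau> (g i))"
  using assms(2)
  by (induction I rule: infinite_finite_induct)
    (simp_all add: hom_onD(2,4)[OF assms(1)] subring_of_prod[OF hom_onD(1)[OF assms(1)]])

lemma hom_on_of_int:
  assumes "hom_on K \<tau>"
  shows "\<tau> (of_int n) = of_int n"
proof -
  have nat: "\<tau> (of_nat k) = of_nat k" for k
    by (induction k) (simp_all add: hom_onD(2,3,5)[OF assms] subring_of_of_nat[OF hom_onD(1)[OF assms]]
        subring_ofD(2)[OF hom_onD(1)[OF assms]])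
  show ?thesis
    by (cases n) (simp_all add: nat hom_onD(6)[OF assms] subring_of_of_nat[OF hom_onD(1)[OF assms]] del: of_nat_Suc)
qed

lemma hom_on_polys_over:
  assumes \<tau>: "hom_on K \<tau>"
  shows "hom_on (polys_over K) (map_poly \<tau>)"
  unfolding hom_on_def
proof (intro conjI ballI)
  note z = hom_onD(5)[OF \<tau>]
  show "subring_of (polys_over K)" by (rule subring_of_polys_over[OF hom_onD(1)[OF \<tau>]])
  show "map_poly \<tau> 1 = 1" by (rule poly_eqI) (simp add: coeff_map_poly z coeff_1 hom_onD(2)[OF \<tau>])
  fix f g assume f: "f \<in> polys_over K" and g: "g \<in> polys_over K"
  show "map_poly \<tau> (f + g) = map_poly \<tau> f + map_poly \<tau> g"
    by (rule poly_eqI) (simp add: coeff_map_poly z hom_onD(3)[OF \<tau>] polys_overD[OF f] polys_overD[OF g])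
  show "map_poly \<tau> (f * g) = map_poly \<tau> f * map_poly \<tau> g"
  proof (rule poly_eqI)
    fix n
    have "\<tau> (\<Sum>i\<le>n. coeff f i * coeff g (n - i)) = (\<Sum>i\<le>n. \<tau> (coeff f i * coeff g (n - i)))"
      by (rule hom_on_sum[OF \<tau>]) (simp add: subring_ofD(5)[OF hom_onD(1)[OF \<tau>]] polys_overD[OF f] polys_overD[OF g])
    then show "coeff (map_poly \<tau> (f * g)) n = coeff (map_poly \<tau> f * map_poly \<tau> g) n"
      by (simp add: coeff_map_poly z coeff_mult hom_onD(4)[OF \<tau>] polys_overD[OF f] polys_overD[OF g])
  qed
qed

lemma hom_on_poly:
  assumes \<tau>: "hom_on K \<tau>" and f: "f \<in> polys_over K" and x: "x \<in> K"
  shows "\<tau> (poly f x) = poly (map_poly \<tau> f) (\<tau> x)"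
  using f
proof (induction f)
  case 0
  then show ?case by (simp add: hom_onD(5)[OF \<tau>])
next
  case (pCons a f)
  then have f: "a \<in> K" "f \<in> polys_over K" by (auto simp: pCons_in_polys_over_iff)
  have fx: "poly f x \<in> K" by (rule poly_in_subring[OF hom_onD(1)[OF \<tau>] f(2) x])
  show ?case using pCons.IH[OF f(2)] fx f(1) x pCons.hyps
    by (simp add: map_poly_pCons hom_onD(3,4,5)[OF \<tau>] subring_ofD(5)[OF hom_onD(1)[OF \<tau>]])
qed

section \<open>Subfields and simple extensions\<close>

definition subfield_of :: "'a :: field set \<Rightarrow> bool" where
  "subfield_of K \<longleftrightarrow> subring_of K \<and> (\<forall>x\<in>K. inverse x \<in> K)"

lemma subfield_ofD:
  assumes "subfield_of K"
  shows "subring_of K" "x \<in> K \<Longrightarrow> inverse x \<in> K" "x \<in> K \<Longrightarrow> y \<in> K \<Longrightarrow> x / y \<in> K"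
  using assms subring_ofD(5)[of K x "inverse y"] by (auto simp: subfield_of_def divide_inverse)

lemma Rats_subset_subfield:
  fixes K :: "'a :: field_char_0 set"
  assumes "subfield_of K"
  shows "\<rat> \<subseteq> K"
proof
  fix x :: 'a assume "x \<in> \<rat>"
  then obtain a b where "x = of_int a / of_int b" by (auto elim: Rats_cases')
  then show "x \<in> K" using subfield_ofD[OF assms] subring_of_of_int[of K] by simp
qed

lemma subfield_of_Rats: "subfield_of (\<rat> :: 'a :: field_char_0 set)"
  by (auto simp: subfield_of_def subring_of_def)

lemma hom_on_inverse:
  fixes K :: "'a :: field set"
  assumes K: "subfield_of K" and \<tau>: "hom_on K \<tau>" and x: "x \<in> K"
  shows "\<tau> (inverse x) = inverse (\<tau> x)"
proof (cases "x = 0")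
  case False
  have "\<tau> x * \<tau> (inverse x) = \<tau> (x * inverse x)"
    using hom_onD(4)[OF \<tau> x subfield_ofD(2)[OF K x]] by simp
  also have "\<dots> = 1" using False hom_onD(2)[OF \<tau>] by simp
  finally show ?thesis by (metis inverse_unique)
qed (simp add: hom_onD(5)[OF \<tau>])

lemma hom_on_inj:
  fixes K :: "'a :: field set"
  assumes K: "subfield_of K" and \<tau>: "hom_on K \<tau>"
  shows "inj_on \<tau> K"
proof (rule inj_onI)
  fix x y assume xy: "x \<in> K" "y \<in> K" "\<tau> x = \<tau> y"
  have xyK: "x - y \<in> K" using subring_ofD(6)[OF hom_onD(1)[OF \<tau>] xy(1,2)] .
  have z: "\<tau> (x - y) = 0" using hom_onD(7)[OF \<tau> xy(1,2)] xy(3) by simp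
  show "x = y"
  proof (rule ccontr)
    assume "x \<noteq> y"
    then have "1 = \<tau> ((x - y) * inverse (x - y))" using hom_onD(2)[OF \<tau>] by simp
    also have "\<dots> = 0" using hom_onD(4)[OF \<tau> xyK subfield_ofD(2)[OF K xyK]] z by simp
    finally show False by simp
  qed
qed

lemma division_over_subfield:
  fixes F :: "'a :: field set"
  assumes F: "subfield_of F" and P: "P \<in> polys_over F" "P \<noteq> 0" and "R \<in> polys_over F"
  shows "\<exists>S\<in>polys_over F. \<exists>T\<in>polys_over F. R = P * S + T \<and> (T = 0 \<or> degree T < degree P)"
  using assms(4)
proof (induction "degree R" arbitrary: R rule: less_induct)
  case less
  note ring = subring_of_polys_over[OF subfield_ofD(1)[OF F]]
  show ?case
  proof (cases "R = 0 \<or> degree R < degree P")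
    case True
    then show ?thesis using less.prems subring_ofD(1)[OF ring]
      by (intro bexI[of _ 0] bexI[of _ R]) auto
  next
    case False
    define c where "c = lead_coeff R / lead_coeff P"
    define m where "m = monom c (degree R - degree P)"
    define R' where "R' = R - P * m"
    have c: "c \<in> F" "c \<noteq> 0"
      unfolding c_def using subfield_ofD(3)[OF F polys_overD[OF less.prems] polys_overD[OF P(1)]] False P(2) by auto
    have m: "m \<in> polys_over F" unfolding m_def using c(1) subring_ofD(1)[OF subfield_ofD(1)[OF F]]
      by (intro monom_in_polys_over)
    have m0: "m \<noteq> 0" using c by (simp add: m_def)
    have R': "R' \<in> polys_over F" unfolding R'_def
      by (intro subring_ofD(5,6)[OF ring] less.prems P m)
    have dPm: "degree (P * m) = degree R"
      using False P(2) m0 c by (simp add: degree_mult_eq m_def degree_monom_eq)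
    have lPm: "lead_coeff (P * m) = lead_coeff R"
    proof -
      have "lead_coeff m = c" using c(2) by (simp add: m_def degree_monom_eq)
      then show ?thesis using P(2) by (simp only: lead_coeff_mult) (simp add: c_def)
    qed
    show ?thesis
    proof (cases "R' = 0 \<or> degree R' < degree P")
      case True
      then show ?thesis using m R' unfolding R'_def by (intro bexI[of _ m] bexI[of _ R']) (auto simp: R'_def)
    next
      case F2: False
      have "degree R' < degree R"
      proof -
        have "degree R' \<le> degree R" unfolding R'_def using dPm by (intro degree_diff_le) auto
        moreover have "coeff R' (degree R) = 0" using lPm dPm by (simp add: R'_def)
        ultimately show ?thesis using F2 by (metis le_neq_implies_less leading_coeff_0_iff)
      qed
      from less.hyps[OF this R'] obtain S T where ST: "S \<in> polys_over F" "T \<in> polys_over F"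
        "R' = P * S + T" "T = 0 \<or> degree T < degree P" by blast
      have "R = P * (m + S) + T" using ST(3) unfolding R'_def by (simp add: algebra_simps)
      then show ?thesis using ST subring_ofD(4)[OF ring m ST(1)] by blast
    qed
  qed
qed

text \<open>Any annihilating polynomial of least degree, without normalization to a monic
  one.\<close>

definition minpoly_over :: "'a :: field set \<Rightarrow> 'a \<Rightarrow> 'a poly \<Rightarrow> bool" where
  "minpoly_over F a m \<longleftrightarrow> m \<in> polys_over F \<and> m \<noteq> 0 \<and> poly m a = 0 \<and>
     (\<forall>R\<in>polys_over F. R \<noteq> 0 \<longrightarrow> poly R a = 0 \<longrightarrow> degree m \<le> degree R)"

lemma minpoly_over_exists:
  assumes "R \<in> polys_over F" "R \<noteq> 0" "poly R a = 0"
  obtains m where "minpoly_over F a m"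
proof -
  define D where "D d \<longleftrightarrow> (\<exists>R\<in>polys_over F. R \<noteq> 0 \<and> poly R a = 0 \<and> degree R = d)" for d
  have "D (degree R)" unfolding D_def using assms by blast
  then have "D (LEAST d. D d)" by (rule LeastI)
  then obtain m where m: "m \<in> polys_over F" "m \<noteq> 0" "poly m a = 0" "degree m = (LEAST d. D d)"
    unfolding D_def by auto
  have "(LEAST d. D d) \<le> degree R" if "R \<in> polys_over F" "R \<noteq> 0" "poly R a = 0" for R
    by (rule Least_le) (use that in \<open>auto simp: D_def\<close>)
  then show thesis using m by (intro that[of m]) (auto simp: minpoly_over_def)
qed

locale simple_extension =
  fixes F :: "'a :: field set" and a :: 'a and m :: "'a poly"
  assumes F: "subfield_of F" and m: "minpoly_over F a m"
begin

lemmas ring = subring_of_polys_over[OF subfield_ofD(1)[OF F]]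

lemma minpolyD: "m \<in> polys_over F" "m \<noteq> 0" "poly m a = 0"
    "R \<in> polys_over F \<Longrightarrow> R \<noteq> 0 \<Longrightarrow> poly R a = 0 \<Longrightarrow> degree m \<le> degree R"
  using m by (auto simp: minpoly_over_def)

lemma degree_minpoly: "degree m > 0"
proof (rule Nat.gr0I)
  assume "degree m = 0"
  then obtain c where "m = [:c:]" by (metis degree_eq_zeroE)
  then show False using minpolyD(2,3) by simp
qed

lemma root_imp_multiple:
  assumes R: "R \<in> polys_over F" "poly R a = 0"
  obtains S where "S \<in> polys_over F" "R = m * S"
proof -
  obtain S T where ST: "S \<in> polys_over F" "T \<in> polys_over F" "R = m * S + T" "T = 0 \<or> degree T < degree m"
    using division_over_subfield[OF F minpolyD(1,2) R(1)] by blast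
  have "poly T a = 0" using arg_cong[OF ST(3), of "\<lambda>f. poly f a"] R(2) minpolyD(3) by simp
  then have "T = 0" using minpolyD(4)[OF ST(2)] ST(4) by fastforce
  then show thesis using ST by (intro that[of S]) auto
qed

definition ext :: "'a set" where "ext = (\<lambda>R. poly R a) ` polys_over F"

text \<open>Divide m by R with remainder T: then T(a) = -R(a) S(a), and T has smaller degree, so
  T(a) is invertible by induction. A zero remainder would let S annihilate a in a degree below that
  of m.\<close>

lemma inverse_in_ext_small:
  assumes "R \<in> polys_over F" "R \<noteq> 0" "degree R < degree m"
  shows "\<exists>S\<in>polys_over F. poly R a * poly S a = 1"
  using assms
proof (induction "degree R" arbitrary: R rule: less_induct)
  case less
  show ?case
  proof (cases "degree R = 0")
    case True
    then obtain c where c: "R = [:c:]" by (metis degree_eq_zeroE)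
    have "c \<noteq> 0" using less.prems c by auto
    moreover have "c \<in> F" using polys_overD[OF less.prems(1), of 0] c by simp
    then have "[:inverse c:] \<in> polys_over F" using subfield_ofD[OF F] subring_ofD(1)[OF subfield_ofD(1)[OF F]]
      by (auto simp: pCons_in_polys_over_iff zero_in_polys_over)
    ultimately show ?thesis using c by (intro bexI[of _ "[:inverse c:]"]) auto
  next
    case False
    obtain S T where ST: "S \<in> polys_over F" "T \<in> polys_over F" "m = R * S + T" "T = 0 \<or> degree T < degree R"
      using division_over_subfield[OF F less.prems(1,2) minpolyD(1)] by blast
    have "T \<noteq> 0"
    proof
      assume "T = 0"
      then have mRS: "m = R * S" using ST by simp
      then have "S \<noteq> 0" "degree m = degree R + degree S" using minpolyD(2) less.prems(2) by (auto simp: degree_mult_eq)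
      moreover have "poly R a \<noteq> 0" using minpolyD(4)[OF less.prems(1,2)] less.prems(3) by auto
      then have "poly S a = 0" using minpolyD(3) mRS by simp
      ultimately show False using minpolyD(4)[OF ST(1)] False by simp
    qed
    then have "degree T < degree R" using ST(4) by simp
    then obtain U where U: "U \<in> polys_over F" "poly T a * poly U a = 1"
      using less.hyps[of T] ST(2) \<open>T \<noteq> 0\<close> less.prems(3) by auto
    have "poly R a * poly S a + poly T a = 0"
      using arg_cong[OF ST(3), of "\<lambda>f. poly f a"] minpolyD(3) by simp
    then have "poly T a = - (poly R a * poly S a)" by (simp add: eq_neg_iff_add_eq_0 add.commute)
    then have "poly R a * poly (- S * U) a = 1" using U(2) by (simp add: algebra_simps)
    moreover have "- S * U \<in> polys_over F" by (intro subring_ofD(3,5)[OF ring] ST U)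
    ultimately show ?thesis by blast
  qed
qed

lemma subfield_ext: "subfield_of ext"
proof -
  have sub: "subring_of ext"
    unfolding subring_of_def
  proof (intro conjI ballI)
    show "0 \<in> ext" unfolding ext_def using subring_ofD(1)[OF ring] by (intro image_eqI[of _ _ 0]) auto
    show "1 \<in> ext" unfolding ext_def using subring_ofD(2)[OF ring] by (intro image_eqI[of _ _ 1]) auto
    fix x assume x: "x \<in> ext"
    then obtain R where R: "x = poly R a" "R \<in> polys_over F" unfolding ext_def by auto
    show "- x \<in> ext" unfolding ext_def using subring_ofD(3)[OF ring R(2)] R(1) by (intro image_eqI[of _ _ "- R"]) auto
    fix y assume y: "y \<in> ext"
    then obtain R' where R': "y = poly R' a" "R' \<in> polys_over F" unfolding ext_def by auto
    show "x + y \<in> ext" unfolding ext_def using subring_ofD(4)[OF ring R(2) R'(2)] R(1) R'(1)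
      by (intro image_eqI[of _ _ "R + R'"]) auto
    show "x * y \<in> ext" unfolding ext_def using subring_ofD(5)[OF ring R(2) R'(2)] R(1) R'(1)
      by (intro image_eqI[of _ _ "R * R'"]) auto
  qed
  have "inverse x \<in> ext" if x: "x \<in> ext" for x
  proof (cases "x = 0")
    case True
    then show ?thesis using subring_ofD(1)[OF sub] by simp
  next
    case False
    obtain R where R: "x = poly R a" "R \<in> polys_over F" using x unfolding ext_def by auto
    obtain S T where ST: "S \<in> polys_over F" "T \<in> polys_over F" "R = m * S + T" "T = 0 \<or> degree T < degree m"
      using division_over_subfield[OF F minpolyD(1,2) R(2)] by blast
    have xT: "x = poly T a" using arg_cong[OF ST(3), of "\<lambda>f. poly f a"] R(1) minpolyD(3) by simp
    then have "T \<noteq> 0" using False by auto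
    then obtain U where U: "U \<in> polys_over F" "poly T a * poly U a = 1"
      using inverse_in_ext_small[OF ST(2)] ST(4) by auto
    then have "inverse x = poly U a" using xT by (metis inverse_unique)
    then show ?thesis unfolding ext_def using U(1) by auto
  qed
  then show ?thesis using sub by (auto simp: subfield_of_def)
qed

lemma F_subset_ext: "F \<subseteq> ext"
proof
  fix x assume "x \<in> F"
  then have "[:x:] \<in> polys_over F" using subring_ofD(1)[OF subfield_ofD(1)[OF F]]
    by (auto simp: pCons_in_polys_over_iff zero_in_polys_over)
  then show "x \<in> ext" unfolding ext_def by (intro image_eqI[of _ _ "[:x:]"]) auto
qed

lemma X_over_F: "[:0, 1:] \<in> polys_over F"
  using subring_ofD(1,2)[OF subfield_ofD(1)[OF F]] subring_ofD(2)[OF ring]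
  by (auto simp: pCons_in_polys_over_iff zero_in_polys_over)

lemma a_in_ext: "a \<in> ext"
  unfolding ext_def using X_over_F by (intro image_eqI[of _ _ "[:0, 1:]"]) auto

lemma ext_least: "subfield_of L \<Longrightarrow> F \<subseteq> L \<Longrightarrow> a \<in> L \<Longrightarrow> ext \<subseteq> L"
proof
  assume L: "subfield_of L" "F \<subseteq> L" "a \<in> L"
  fix x assume "x \<in> ext"
  then obtain R where R: "x = poly R a" "R \<in> polys_over F" unfolding ext_def by auto
  then have "R \<in> polys_over L" using L(2) by (auto simp: polys_over_def)
  then show "x \<in> L" unfolding R(1) by (rule poly_in_subring[OF subfield_ofD(1)[OF L(1)] _ L(3)])
qed

text \<open>An element R(a) is sent to the value at a' of the transported R. Two choices of R differ
  by a multiple of m, whose image vanishes at a'.\<close>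

lemma extend_hom:
  assumes \<sigma>: "hom_on F \<sigma>" and a': "poly (map_poly \<sigma> m) a' = 0"
  obtains \<tau> where "hom_on ext \<tau>" "\<And>x. x \<in> F \<Longrightarrow> \<tau> x = \<sigma> x" "\<tau> a = a'"
proof -
  note h = hom_on_polys_over[OF \<sigma>]
  define \<tau> where "\<tau> y = poly (map_poly \<sigma> (SOME R. R \<in> polys_over F \<and> poly R a = y)) a'" for y
  have \<tau>: "\<tau> (poly R a) = poly (map_poly \<sigma> R) a'" if R: "R \<in> polys_over F" for R
  proof -
    define R' where "R' = (SOME R'. R' \<in> polys_over F \<and> poly R' a = poly R a)"
    have "R' \<in> polys_over F \<and> poly R' a = poly R a" unfolding R'_def by (rule someI) (use R in auto)
    then have R': "R' \<in> polys_over F" "poly R' a = poly R a" by auto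
    obtain S where S: "S \<in> polys_over F" "R' - R = m * S"
      by (rule root_imp_multiple[of "R' - R"]) (use subring_ofD(6)[OF ring R'(1) R] R'(2) in simp_all)
    have "map_poly \<sigma> R' - map_poly \<sigma> R = map_poly \<sigma> m * map_poly \<sigma> S"
      using hom_onD(7)[OF h R'(1) R] hom_onD(4)[OF h minpolyD(1) S(1)] S(2) by simp
    from arg_cong[OF this, of "\<lambda>f. poly f a'"] a' have "poly (map_poly \<sigma> R') a' = poly (map_poly \<sigma> R) a'" by simp
    then show ?thesis unfolding \<tau>_def R'_def .
  qed
  show thesis
  proof (rule that[of \<tau>])
    have "\<tau> 1 = 1" using \<tau>[OF subring_ofD(2)[OF ring]] hom_onD(2)[OF h] by simp
    moreover have "\<tau> (x + y) = \<tau> x + \<tau> y \<and> \<tau> (x * y) = \<tau> x * \<tau> y" if xy: "x \<in> ext" "y \<in> ext" for x y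
    proof -
      obtain R where R: "x = poly R a" "R \<in> polys_over F" using xy unfolding ext_def by auto
      obtain S where S: "y = poly S a" "S \<in> polys_over F" using xy unfolding ext_def by auto
      show ?thesis
        using \<tau>[OF subring_ofD(4)[OF ring R(2) S(2)]] \<tau>[OF subring_ofD(5)[OF ring R(2) S(2)]] \<tau>[OF R(2)] \<tau>[OF S(2)]
          hom_onD(3,4)[OF h R(2) S(2)] R(1) S(1) by simp
    qed
    ultimately show "hom_on ext \<tau>" using subfield_ofD(1)[OF subfield_ext] by (simp add: hom_on_def)
    show "\<tau> x = \<sigma> x" if x: "x \<in> F" for x
    proof -
      have "[:x:] \<in> polys_over F" using x subring_ofD(1)[OF subfield_ofD(1)[OF F]]
        by (auto simp: pCons_in_polys_over_iff zero_in_polys_over)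
      from \<tau>[OF this] show ?thesis
        by (cases "x = 0") (simp_all add: map_poly_pCons hom_onD(5)[OF \<sigma>])
    qed
    show "\<tau> a = a'" using \<tau>[OF X_over_F] by (simp add: map_poly_pCons hom_onD(2,5)[OF \<sigma>])
  qed
qed

end

text \<open>Roots are adjoined one at a time; the minimal polynomial, transported by the
  homomorphism built so far, has a complex root that serves as the next image. The last clause makes
  E the smallest such field, by which it is later recognized as the splitting field.\<close>

lemma extend_hom_finite:
  fixes f :: "int poly"
  assumes f: "f \<noteq> 0" and X: "finite X" "X \<subseteq> {a. ipoly f a = 0}"
    and F: "subfield_of F" "hom_on F \<sigma>"
  shows "\<exists>E \<tau>. subfield_of E \<and> F \<subseteq> E \<and> X \<subseteq> E \<and> hom_on E \<tau> \<and> (\<forall>x\<in>F. \<tau> x = \<sigma> x) \<and>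
     (\<forall>L. subfield_of L \<longrightarrow> F \<subseteq> L \<longrightarrow> X \<subseteq> L \<longrightarrow> E \<subseteq> L)"
  using X
proof (induction X rule: finite_induct)
  case empty
  then show ?case using F by (intro exI[of _ F] exI[of _ \<sigma>]) auto
next
  case (insert a X)
  then obtain E \<tau> where E: "subfield_of E" "F \<subseteq> E" "X \<subseteq> E" "hom_on E \<tau>" "\<forall>x\<in>F. \<tau> x = \<sigma> x"
    "\<And>L. subfield_of L \<Longrightarrow> F \<subseteq> L \<Longrightarrow> X \<subseteq> L \<Longrightarrow> E \<subseteq> L" by auto
  have "cpoly f \<in> polys_over E"
    by (auto simp: polys_over_def coeff_map_poly intro: subring_of_of_int[OF subfield_ofD(1)[OF E(1)]])
  then obtain m where m: "minpoly_over E a m"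
    using minpoly_over_exists[of "cpoly f" E a] insert.prems f by auto
  interpret simple_extension E a m by unfold_locales (use E m in auto)
  have "\<tau> (lead_coeff m) \<noteq> 0"
  proof
    assume "\<tau> (lead_coeff m) = 0"
    then have "lead_coeff m = 0"
      using inj_onD[OF hom_on_inj[OF E(1,4)], of "lead_coeff m" 0] hom_onD(5)[OF E(4)]
        polys_overD[OF minpolyD(1)] subring_ofD(1)[OF subfield_ofD(1)[OF E(1)]] by simp
    then show False using minpolyD(2) by simp
  qed
  then have "degree (map_poly \<tau> m) = degree m"
    using minpolyD(2) by (intro degree_map_poly) auto
  then have "\<not> constant (poly (map_poly \<tau> m))" using degree_minpoly by (simp add: constant_degree)
  then obtain a' where "poly (map_poly \<tau> m) a' = 0" using fundamental_theorem_of_algebra by blast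
  then obtain \<rho> where \<rho>: "hom_on ext \<rho>" "\<And>x. x \<in> E \<Longrightarrow> \<rho> x = \<tau> x"
    using extend_hom[OF E(4)] by blast
  show ?case
  proof (intro exI[of _ ext] exI[of _ \<rho>] conjI ballI allI impI)
    show "subfield_of ext" by (rule subfield_ext)
    show "F \<subseteq> ext" "insert a X \<subseteq> ext" using E(2,3) F_subset_ext a_in_ext by auto
    show "hom_on ext \<rho>" by (rule \<rho>(1))
    show "\<rho> x = \<sigma> x" if "x \<in> F" for x using that E(2,5) \<rho>(2) by auto
    show "ext \<subseteq> L" if "subfield_of L" "F \<subseteq> L" "insert a X \<subseteq> L" for L
      using that E(6)[of L] by (intro ext_least) auto
  qed
qed

section \<open>Splitting fields and their automorphisms\<close>

lemma complex_field_ops: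
  "\<one>\<^bsub>complex_field\<^esub> = 1" "\<zero>\<^bsub>complex_field\<^esub> = 0" "x \<oplus>\<^bsub>complex_field\<^esub> y = x + y"
  "x \<otimes>\<^bsub>complex_field\<^esub> y = x * y" "\<ominus>\<^bsub>complex_field\<^esub> x = - x" "x \<noteq> 0 \<Longrightarrow> inv\<^bsub>complex_field\<^esub> x = inverse x"
proof -
  show "\<one>\<^bsub>complex_field\<^esub> = 1" "\<zero>\<^bsub>complex_field\<^esub> = 0" "x \<oplus>\<^bsub>complex_field\<^esub> y = x + y"
    "x \<otimes>\<^bsub>complex_field\<^esub> y = x * y" by (simp_all add: complex_field_def)
  show "\<ominus>\<^bsub>complex_field\<^esub> x = - x"
    unfolding a_inv_def m_inv_def by (rule the_equality) (auto simp: complex_field_def eq_neg_iff_add_eq_0 add.commute)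
  show "inv\<^bsub>complex_field\<^esub> x = inverse x" if "x \<noteq> 0"
    unfolding m_inv_def by (rule the_equality) (use that in \<open>auto simp: complex_field_def inverse_unique\<close>)
qed

lemma subfield_splitting_field: "subfield_of (splitting_field f)"
proof -
  note rules = generate_field.intros[where R = complex_field and H = "{z. ipoly f z = 0}", folded splitting_field_def]
  have neg: "- x \<in> splitting_field f" if "x \<in> splitting_field f" for x
    using rules(3)[OF that] by (simp add: complex_field_ops)
  have add: "x + y \<in> splitting_field f" if "x \<in> splitting_field f" "y \<in> splitting_field f" for x y
    using rules(5)[OF that] by (simp add: complex_field_ops)
  have mult: "x * y \<in> splitting_field f" if "x \<in> splitting_field f" "y \<in> splitting_field f" for x y
    using rules(6)[OF that] by (simp add: complex_field_ops)
  have one: "1 \<in> splitting_field f" using rules(1) by (simp add: complex_field_ops)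
  have zero: "0 \<in> splitting_field f" using add[OF one neg[OF one]] by simp
  have inv: "inverse x \<in> splitting_field f" if "x \<in> splitting_field f" for x
    using rules(4)[OF that] zero by (cases "x = 0") (simp_all add: complex_field_ops)
  show ?thesis unfolding subfield_of_def subring_of_def by (intro conjI ballI zero one neg add mult inv)
qed

lemma roots_in_splitting_field: "ipoly f a = 0 \<Longrightarrow> a \<in> splitting_field f"
  unfolding splitting_field_def by (rule generate_field.incl) simp

lemma splitting_field_least:
  assumes L: "subfield_of L" and roots: "{a. ipoly f a = 0} \<subseteq> L"
  shows "splitting_field f \<subseteq> L"
proof
  fix x assume "x \<in> splitting_field f"
  then have "x \<in> generate_field complex_field {z. ipoly f z = 0}" by (simp add: splitting_field_def)
  then show "x \<in> L"
  proof (induction rule: generate_field.induct)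
    case one
    then show ?case by (simp add: complex_field_ops subring_ofD(2)[OF subfield_ofD(1)[OF L]])
  next
    case (incl h)
    then show ?case using roots by blast
  next
    case (a_inv h)
    then show ?case by (simp add: complex_field_ops subring_ofD(3)[OF subfield_ofD(1)[OF L]])
  next
    case (m_inv h)
    then show ?case by (simp add: complex_field_ops subfield_ofD(2)[OF L])
  next
    case (eng_add h1 h2)
    then show ?case by (simp add: complex_field_ops subring_ofD(4)[OF subfield_ofD(1)[OF L]])
  next
    case (eng_mult h1 h2)
    then show ?case by (simp add: complex_field_ops subring_ofD(5)[OF subfield_ofD(1)[OF L]])
  qed
qed

lemma hom_on_ipoly:
  assumes "hom_on K \<sigma>" "x \<in> K"
  shows "\<sigma> (ipoly f x) = ipoly f (\<sigma> x)"
proof -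
  have "cpoly f \<in> polys_over K"
    by (auto simp: polys_over_def coeff_map_poly intro: subring_of_of_int[OF hom_onD(1)[OF assms(1)]])
  from hom_on_poly[OF assms(1) this assms(2)]
  have "\<sigma> (ipoly f x) = poly (map_poly \<sigma> (cpoly f)) (\<sigma> x)" .
  also have "map_poly \<sigma> (cpoly f) = cpoly f"
    by (rule poly_eqI) (simp add: coeff_map_poly hom_onD(5)[OF assms(1)] hom_on_of_int[OF assms(1)])
  finally show ?thesis .
qed

lemma hom_on_permutes_roots:
  assumes f: "f \<noteq> 0" and \<sigma>: "hom_on (splitting_field f) \<sigma>"
  shows "\<sigma> ` {a. ipoly f a = 0} = {a. ipoly f a = 0}"
proof (rule endo_inj_surj)
  show "finite {a. ipoly f a = 0}" using poly_roots_finite[of "cpoly f"] f by simp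
  show "\<sigma> ` {a. ipoly f a = 0} \<subseteq> {a. ipoly f a = 0}"
  proof
    fix b assume "b \<in> \<sigma> ` {a. ipoly f a = 0}"
    then obtain a where a: "ipoly f a = 0" "b = \<sigma> a" by auto
    show "b \<in> {a. ipoly f a = 0}"
      using hom_on_ipoly[OF \<sigma> roots_in_splitting_field[OF a(1)], of f] a hom_onD(5)[OF \<sigma>] by simp
  qed
  show "inj_on \<sigma> {a. ipoly f a = 0}"
    by (rule inj_on_subset[OF hom_on_inj[OF subfield_splitting_field \<sigma>]]) (use roots_in_splitting_field in auto)
qed

text \<open>The elements of K mapped into K form a subfield containing the roots, and so does the
  image of K; by minimality each contains K.\<close>

lemma hom_on_splitting_field_bij:
  assumes f: "f \<noteq> 0" and \<sigma>: "hom_on (splitting_field f) \<sigma>"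
  shows "bij_betw \<sigma> (splitting_field f) (splitting_field f)"
proof -
  let ?K = "splitting_field f"
  note K = subfield_splitting_field[of f]
  note ringK = subring_ofD[OF subfield_ofD(1)[OF K]]
  note roots = hom_on_permutes_roots[OF assms]
  have "subfield_of {x \<in> ?K. \<sigma> x \<in> ?K}"
    unfolding subfield_of_def subring_of_def
    by (simp add: ringK(1-5) subfield_ofD(2)[OF K] hom_onD(2-6)[OF \<sigma>] hom_on_inverse[OF K \<sigma>])
  moreover have "{a. ipoly f a = 0} \<subseteq> {x \<in> ?K. \<sigma> x \<in> ?K}"
    using roots roots_in_splitting_field by blast
  ultimately have into: "?K \<subseteq> {x \<in> ?K. \<sigma> x \<in> ?K}" by (rule splitting_field_least)
  have "subfield_of (\<sigma> ` ?K)"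
    unfolding subfield_of_def subring_of_def
  proof (intro conjI ballI)
    show "0 \<in> \<sigma> ` ?K" using hom_onD(5)[OF \<sigma>] ringK(1) by (metis imageI)
    show "1 \<in> \<sigma> ` ?K" using hom_onD(2)[OF \<sigma>] ringK(2) by (metis imageI)
    fix x assume "x \<in> \<sigma> ` ?K"
    then obtain u where u: "u \<in> ?K" "x = \<sigma> u" by auto
    show "- x \<in> \<sigma> ` ?K" using hom_onD(6)[OF \<sigma> u(1)] u(2) ringK(3)[OF u(1)] by (metis imageI)
    show "inverse x \<in> \<sigma> ` ?K" using hom_on_inverse[OF K \<sigma> u(1)] u(2) subfield_ofD(2)[OF K u(1)] by (metis imageI)
    fix y assume "y \<in> \<sigma> ` ?K"
    then obtain v where v: "v \<in> ?K" "y = \<sigma> v" by auto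
    show "x + y \<in> \<sigma> ` ?K" using hom_onD(3)[OF \<sigma> u(1) v(1)] u(2) v(2) ringK(4)[OF u(1) v(1)] by (metis imageI)
    show "x * y \<in> \<sigma> ` ?K" using hom_onD(4)[OF \<sigma> u(1) v(1)] u(2) v(2) ringK(5)[OF u(1) v(1)] by (metis imageI)
  qed
  moreover have "{a. ipoly f a = 0} \<subseteq> \<sigma> ` ?K" using roots roots_in_splitting_field by blast
  ultimately have onto: "?K \<subseteq> \<sigma> ` ?K" by (rule splitting_field_least)
  show ?thesis unfolding bij_betw_def using hom_on_inj[OF K \<sigma>] into onto by blast
qed

lemma hom_on_cong:
  assumes "hom_on K \<sigma>" "\<And>x. x \<in> K \<Longrightarrow> \<tau> x = \<sigma> x"
  shows "hom_on K \<tau>"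
  using assms subring_ofD(2,4,5)[OF hom_onD(1)[OF assms(1)]] by (simp add: hom_on_def)

text \<open>A ring homomorphism on the splitting field is automatically bijective onto it and fixes
  the rationals. Membership in \<open>extensional\<close> comes from \<open>Bij\<close> and makes an
  automorphism determined by its values on the field.\<close>

lemma galois_group_carrier:
  assumes f: "f \<noteq> 0"
  shows "carrier (galois_group f) = {\<sigma> \<in> extensional (splitting_field f). hom_on (splitting_field f) \<sigma>}"
proof -
  let ?K = "splitting_field f"
  note K = subfield_splitting_field[of f]
  have "\<sigma> \<in> Bij ?K \<and> \<sigma> \<in> Ring.ring_hom (complex_field\<lparr>carrier := ?K\<rparr>) (complex_field\<lparr>carrier := ?K\<rparr>) \<and> (\<forall>q\<in>\<rat>. \<sigma> q = q)
     \<longleftrightarrow> \<sigma> \<in> extensional ?K \<and> hom_on ?K \<sigma>" for \<sigma>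
  proof
    assume "\<sigma> \<in> Bij ?K \<and> \<sigma> \<in> Ring.ring_hom (complex_field\<lparr>carrier := ?K\<rparr>) (complex_field\<lparr>carrier := ?K\<rparr>) \<and> (\<forall>q\<in>\<rat>. \<sigma> q = q)"
    then show "\<sigma> \<in> extensional ?K \<and> hom_on ?K \<sigma>"
      using subfield_ofD(1)[OF K] by (auto simp: Bij_def Ring.ring_hom_def hom_on_def complex_field_def)
  next
    assume \<sigma>: "\<sigma> \<in> extensional ?K \<and> hom_on ?K \<sigma>"
    then have h: "hom_on ?K \<sigma>" by simp
    have bij: "bij_betw \<sigma> ?K ?K" by (rule hom_on_splitting_field_bij[OF f h])
    have "\<sigma> q = q" if q: "q \<in> \<rat>" for q
    proof -
      obtain a b where ab: "q = of_int a / of_int b" using q by (auto elim: Rats_cases')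
      have "of_int a \<in> ?K" "of_int b \<in> ?K" using subring_of_of_int[OF subfield_ofD(1)[OF K]] by auto
      then show ?thesis unfolding ab divide_inverse
        using hom_onD(4)[OF h _ subfield_ofD(2)[OF K]] hom_on_inverse[OF K h] hom_on_of_int[OF h] by simp
    qed
    moreover have "\<sigma> \<in> Ring.ring_hom (complex_field\<lparr>carrier := ?K\<rparr>) (complex_field\<lparr>carrier := ?K\<rparr>)"
      using hom_onD[OF h] bij_betwE[OF bij] by (auto simp: Ring.ring_hom_def complex_field_def)
    ultimately show "\<sigma> \<in> Bij ?K \<and> \<sigma> \<in> Ring.ring_hom (complex_field\<lparr>carrier := ?K\<rparr>) (complex_field\<lparr>carrier := ?K\<rparr>) \<and> (\<forall>q\<in>\<rat>. \<sigma> q = q)"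
      using \<sigma> bij by (auto simp: Bij_def)
  qed
  then show ?thesis by (auto simp: galois_group_def Let_def)
qed

lemma restrict_in_galois_group:
  assumes "f \<noteq> 0" "hom_on (splitting_field f) \<sigma>"
  shows "restrict \<sigma> (splitting_field f) \<in> carrier (galois_group f)"
  unfolding galois_group_carrier[OF assms(1)]
  using hom_on_cong[OF assms(2), of "restrict \<sigma> (splitting_field f)"] by auto

text \<open>For irrational b the minimal polynomial has a second root b'; the embedding sending b to
  b' extends to the splitting field and moves b.\<close>

lemma galois_fixed_rational:
  assumes f: "f \<noteq> 0" and b: "b \<in> splitting_field f" "b \<in> alg_ints"
    and fixed: "\<And>\<sigma>. \<sigma> \<in> carrier (galois_group f) \<Longrightarrow> \<sigma> b = b"
  shows "b \<in> \<rat>"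
proof (rule ccontr)
  assume nb: "b \<notin> \<rat>"
  let ?K = "splitting_field f"
  obtain g where g: "ipoly g b = 0" "lead_coeff g = 1"
    using b(2) unfolding alg_ints_def algebraic_int_altdef_ipoly by blast
  have "g \<noteq> 0" using g(2) by auto
  moreover have "cpoly g \<in> polys_over \<rat>" by (auto simp: polys_over_def coeff_map_poly)
  ultimately obtain m where m: "minpoly_over \<rat> b m" using minpoly_over_exists[of "cpoly g" \<rat> b] g(1) by auto
  interpret simple_extension "\<rat> :: complex set" b m
    by unfold_locales (use subfield_of_Rats m in auto)
  obtain h where h: "m = [:- b, 1:] * h" using minpolyD(3) by (metis dvdE poly_eq_0_iff_dvd)
  have h0: "h \<noteq> 0" using h minpolyD(2) by auto
  have "degree h \<noteq> 0"
  proof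
    assume "degree h = 0"
    then obtain c where c: "h = [:c:]" by (metis degree_eq_zeroE)
    then have "m = [:- b * c, c:]" using h by simp
    then have "c \<in> \<rat>" "- b * c \<in> \<rat>" using polys_overD[OF minpolyD(1), of 1] polys_overD[OF minpolyD(1), of 0] by auto
    then have "- (- b * c) / c \<in> \<rat>" by (intro Rats_divide Rats_minus_iff[THEN iffD2])
    then show False using c h0 nb by simp
  qed
  then have "\<not> constant (poly h)" by (simp add: constant_degree)
  then obtain b' where b': "poly h b' = 0" using fundamental_theorem_of_algebra by blast
  \<comment> \<open>Separability in characteristic 0: a double root would also be a root of the
    derivative, of smaller degree than the minimal polynomial.\<close>
  have "b' \<noteq> b"
  proof
    assume "b' = b"
    have "pderiv m = [:- b, 1:] * pderiv h + h * pderiv [:- b, 1:]" unfolding h by (rule pderiv_mult)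
    then have "poly (pderiv m) b = 0" using b' \<open>b' = b\<close> by (simp add: pderiv_pCons)
    moreover have "pderiv m \<noteq> 0" using degree_minpoly by (simp add: pderiv_eq_0_iff)
    moreover have "pderiv m \<in> polys_over \<rat>"
      using polys_overD[OF minpolyD(1)] by (auto simp: polys_over_def coeff_pderiv)
    ultimately have "degree m \<le> degree (pderiv m)" by (intro minpolyD(4))
    then show False using degree_minpoly by (simp add: degree_pderiv)
  qed
  have "hom_on \<rat> (\<lambda>x::complex. x)" using subfield_ofD(1)[OF F] by (simp add: hom_on_def)
  moreover have "poly (map_poly (\<lambda>x. x) m) b' = 0" using b' h by (simp add: map_poly_id')
  ultimately obtain \<tau> where \<tau>: "hom_on ext \<tau>" "\<tau> b = b'" using extend_hom by blast
  have "finite {a. ipoly f a = 0}" using poly_roots_finite[of "cpoly f"] f by simp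
  from extend_hom_finite[OF f this subset_refl subfield_ext \<tau>(1)]
  obtain E \<rho> where E: "subfield_of E" "ext \<subseteq> E" "{a. ipoly f a = 0} \<subseteq> E" "hom_on E \<rho>" "\<forall>x\<in>ext. \<rho> x = \<tau> x"
    "\<And>L. subfield_of L \<Longrightarrow> ext \<subseteq> L \<Longrightarrow> {a. ipoly f a = 0} \<subseteq> L \<Longrightarrow> E \<subseteq> L" by blast
  \<comment> \<open>Minimality of \<open>E\<close> and minimality of the splitting field identify
    the two, so the extended homomorphism is a Galois element.\<close>
  have "E \<subseteq> ?K"
    using roots_in_splitting_field Rats_subset_subfield[OF subfield_splitting_field]
    by (intro E(6) subfield_splitting_field ext_least b(1)) auto
  moreover have "?K \<subseteq> E" by (rule splitting_field_least[OF E(1,3)])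
  ultimately have "E = ?K" by blast
  then have "restrict \<rho> ?K \<in> carrier (galois_group f)" using E(4) restrict_in_galois_group[OF f] by simp
  from fixed[OF this] have "\<rho> b = b" using b(1) by simp
  then show False using E(5) a_in_ext \<tau>(2) \<open>b' \<noteq> b\<close> by auto
qed

section \<open>Lifting Frobenius to the Galois group\<close>

lemma ideal_poly_in:
  assumes P: "ideal_of A P" and D: "D \<in> polys_over P" and x: "x \<in> A"
  shows "poly D x \<in> P"
  using D
proof (induction D)
  case (pCons a D)
  then have "a \<in> P" "D \<in> polys_over P" by (auto simp: pCons_in_polys_over_iff)
  then show ?case using pCons.IH ideal_ofD(4)[OF P] ideal_ofD(6)[OF P x] by simp
qed (simp add: ideal_ofD(3)[OF P])

text \<open>Substituting x^q only spaces the coefficients out, so it can be cancelled from a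
  congruence.\<close>

lemma pcompose_monom_in_polys_over_iff:
  fixes W :: "'a :: comm_ring_1 poly"
  assumes "q > 0" "0 \<in> P"
  shows "W \<circ>\<^sub>p monom 1 q \<in> polys_over P \<longleftrightarrow> W \<in> polys_over P"
proof
  assume W: "W \<circ>\<^sub>p monom 1 q \<in> polys_over P"
  show "W \<in> polys_over P"
    using polys_overD[OF W, of "q * i" for i] assms(1) coeff_pcompose_x_pow_n[of q W] by (intro polys_overI) simp
next
  assume W: "W \<in> polys_over P"
  show "W \<circ>\<^sub>p monom 1 q \<in> polys_over P"
  proof (rule polys_overI)
    fix i
    have i: "i = q * (i div q) + i mod q" "i mod q < q" using assms(1) by simp_all
    have "coeff (W \<circ>\<^sub>p monom 1 q) i = (if i mod q = 0 then coeff W (i div q) else 0)"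
      by (subst i(1), rule coeff_pcompose_monom[OF i(2)])
    then show "coeff (W \<circ>\<^sub>p monom 1 q) i \<in> P" using polys_overD[OF W] assms(2) by simp
  qed
qed

lemma cpoly_pcompose_monom: "cpoly (f \<circ>\<^sub>p monom 1 q) = cpoly f \<circ>\<^sub>p monom 1 q"
proof (induction f)
  case (pCons c f)
  have "cpoly (pCons c f) = pCons (of_int c) (cpoly f)"
    by (rule poly_eqI) (simp add: coeff_map_poly coeff_pCons split: nat.split)
  moreover have "cpoly (monom 1 q) = monom 1 q" by (rule poly_eqI) (simp add: coeff_map_poly)
  ultimately show ?case using pCons.IH by (simp only: pcompose_pCons cpoly_hom)
qed simp

lemma cpoly_power: "cpoly (f ^ k) = cpoly f ^ k"
  by (rule of_int_poly_hom.hom_power)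

context prime_above
begin

abbreviation (input) q :: nat where "q \<equiv> nat p"

lemma q_prime: "prime q" "q > 0" "q > 1" "of_nat q \<in> \<mm>" "int q = p"
proof -
  show "prime q" by (rule prime_nat_p)
  show "q > 0" "q > 1" using m1 by simp_all
  show "int q = p" by (rule prime_nat_p)
  then have "of_nat q = (of_int p :: complex)" by (metis of_int_of_nat_eq)
  then show "of_nat q \<in> \<mm>" using p_in by simp
qed

lemmas ringA = idealD(1)
lemmas idealX = ideal_of_polys_over[OF ideal]
lemmas primeX = prime_ideal_of_polys_over[OF prime_ideal]
lemmas ringX = ideal_ofD(1)[OF idealX]

lemma cpoly_power_cong: "cpoly c ^ q - cpoly c \<circ>\<^sub>p monom 1 q \<in> polys_over \<mm>"
proof -
  obtain k where k: "c ^ q = c \<circ>\<^sub>p monom 1 q + [:p:] * k"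
    using power_p_eq_m[of c] unfolding eq_m_iff by blast
  from arg_cong[OF this, of cpoly]
  have "cpoly c ^ q = cpoly c \<circ>\<^sub>p monom 1 q + [:of_int p:] * cpoly k"
    by (simp only: cpoly_hom cpoly_power cpoly_pcompose_monom)
  then have eq: "cpoly c ^ q - cpoly c \<circ>\<^sub>p monom 1 q = [:of_int p:] * cpoly k" by simp
  have "[:of_int p:] \<in> polys_over \<mm>"
    using p_in idealD(3) by (auto simp: pCons_in_polys_over_iff zero_in_polys_over)
  then show ?thesis unfolding eq by (rule ideal_ofD(5)[OF idealX _ cpoly_over_alg_ints])
qed

lemma ipoly_power_cong:
  assumes "x \<in> alg_ints"
  shows "ipoly f x ^ q - ipoly f (x ^ q) \<in> \<mm>"
  using ideal_poly_in[OF ideal cpoly_power_cong assms, of f] by (simp add: poly_pcompose poly_monom)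

text \<open>f(x) is the product of x - a over the roots a, and \<open>\<mm>\<close> is
  prime.\<close>

lemma root_mod_lift:
  assumes f: "lead_coeff f = 1" and x: "x \<in> alg_ints" "ipoly f x \<in> \<mm>"
  shows "\<exists>b. ipoly f b = 0 \<and> x - b \<in> \<mm>"
proof -
  have f0: "cpoly f \<noteq> 0" using f by auto
  have roots: "a \<in> alg_ints" "ipoly f a = 0" if "a \<in># proots (cpoly f)" for a
    using that f0 root_in_alg_ints[OF f] by auto
  have "(\<Prod>a\<in>#proots (cpoly f). x - a) \<in> \<mm>"
    using x(2) f by (subst (asm) poly_eq_prod_proots) simp
  then have "\<exists>y\<in>#{#x - a. a \<in># proots (cpoly f)#}. y \<in> \<mm>"
    by (intro prime_ideal_of_prod_mset[OF prime_ideal]) (auto intro: subring_ofD(6)[OF ringA x(1)] roots)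
  then show ?thesis using roots(2) by auto
qed

text \<open>Frobenius as a mere map on the roots: a^q is a root of \<open>f\<close> modulo
  \<open>\<mm>\<close>, hence congruent to an actual root. That an automorphism realizes it is the
  content of \<open>frobenius_lift\<close>.\<close>

lemma frobenius_on_roots:
  assumes f: "lead_coeff f = 1"
  obtains \<phi> where "\<And>a. ipoly f a = 0 \<Longrightarrow> ipoly f (\<phi> a) = 0 \<and> a ^ q - \<phi> a \<in> \<mm>"
proof -
  have "\<exists>b. ipoly f b = 0 \<and> a ^ q - b \<in> \<mm>" if a: "ipoly f a = 0" for a
  proof -
    have aA: "a \<in> alg_ints" by (rule root_in_alg_ints[OF f a])
    have "ipoly f (a ^ q) \<in> \<mm>"
      using ipoly_power_cong[OF aA, of f] a q_prime(2) idealD(7)[of "- ipoly f (a ^ q)"] by (simp add: power_0_left)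
    then show ?thesis by (rule root_mod_lift[OF f subring_of_power[OF ringA aA]])
  qed
  then show thesis using that by metis
qed

text \<open>Frobenius commutes with the evaluation of a polynomial whose coefficients are integer
  polynomials: taking q-th powers turns each coefficient c into c(x^q) and Y into Z(x^q), modulo
  \<open>\<mm>\<close>.\<close>

lemma eval_power_cong:
  assumes Y: "Y \<in> polys_over alg_ints" and Z: "Z \<in> polys_over alg_ints"
    and YZ: "Y ^ q - Z \<circ>\<^sub>p monom 1 q \<in> polys_over \<mm>"
  shows "poly (map_poly cpoly P) Y ^ q - poly (map_poly cpoly P) Z \<circ>\<^sub>p monom 1 q \<in> polys_over \<mm>"
proof (induction P)
  case 0
  then show ?case using q_prime(2) idealD(3) by (simp add: power_0_left zero_in_polys_over)
next
  case (pCons c P)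
  let ?ev = "\<lambda>Y. poly (map_poly cpoly P) Y"
  have ev: "poly (map_poly cpoly (pCons c P)) U = cpoly c + U * ?ev U" for U
  proof -
    have "map_poly cpoly (pCons c P) = pCons (cpoly c) (map_poly cpoly P)"
      by (rule poly_eqI) (simp add: coeff_map_poly coeff_pCons split: nat.split)
    then show ?thesis by simp
  qed
  have in_ring: "?ev U \<in> polys_over alg_ints" if "U \<in> polys_over alg_ints" for U
  proof (rule poly_in_subring[OF ringX _ that])
    show "map_poly cpoly P \<in> polys_over (polys_over alg_ints)"
      by (rule polys_overI) (simp add: coeff_map_poly cpoly_over_alg_ints)
  qed
  have comp: "U \<circ>\<^sub>p monom 1 q \<in> polys_over alg_ints" if "U \<in> polys_over alg_ints" for U
    using pcompose_monom_in_polys_over_iff[OF q_prime(2) subring_ofD(1)[OF ringA]] that by blast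
  have 1: "(cpoly c + Y * ?ev Y) ^ q - (cpoly c ^ q + (Y * ?ev Y) ^ q) \<in> polys_over \<mm>"
    by (intro ideal_cong_add_power[OF idealX q_prime(1)] of_nat_in_polys_over q_prime idealD(3)
        cpoly_over_alg_ints subring_ofD(5)[OF ringX] Y in_ring)
  have 2: "Y ^ q * ?ev Y ^ q - (Z \<circ>\<^sub>p monom 1 q) * (?ev Z \<circ>\<^sub>p monom 1 q) \<in> polys_over \<mm>"
    by (intro ideal_cong_mult[OF idealX YZ pCons.IH] comp Z subring_of_power[OF ringX] in_ring Y)
  have 3: "cpoly c ^ q + Y ^ q * ?ev Y ^ q - (cpoly c \<circ>\<^sub>p monom 1 q + (Z \<circ>\<^sub>p monom 1 q) * (?ev Z \<circ>\<^sub>p monom 1 q)) \<in> polys_over \<mm>"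
    by (rule ideal_cong_add[OF idealX cpoly_power_cong 2])
  show ?case unfolding ev
    using ideal_cong_trans[OF idealX 1[unfolded power_mult_distrib] 3]
    by (simp add: pcompose_add pcompose_mult)
qed

end

lemma galois_eqI:
  assumes f: "f \<noteq> 0" and \<sigma>: "\<sigma> \<in> carrier (galois_group f)" and \<tau>: "\<tau> \<in> carrier (galois_group f)"
    and eq: "\<And>a. ipoly f a = 0 \<Longrightarrow> \<sigma> a = \<tau> a"
  shows "\<sigma> = \<tau>"
proof (rule extensionalityI)
  let ?K = "splitting_field f"
  note K = subfield_splitting_field[of f]
  note ringK = subring_ofD[OF subfield_ofD(1)[OF K]]
  show "\<sigma> \<in> extensional ?K" "\<tau> \<in> extensional ?K" using \<sigma> \<tau> by (auto simp: galois_group_carrier[OF f])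
  have h: "hom_on ?K \<sigma>" "hom_on ?K \<tau>" using \<sigma> \<tau> by (auto simp: galois_group_carrier[OF f])
  have "subfield_of {x \<in> ?K. \<sigma> x = \<tau> x}"
    unfolding subfield_of_def subring_of_def
    by (simp add: ringK(1-5) subfield_ofD(2)[OF K] hom_onD(2-6)[OF h(1)] hom_onD(2-6)[OF h(2)]
        hom_on_inverse[OF K h(1)] hom_on_inverse[OF K h(2)])
  moreover have "{a. ipoly f a = 0} \<subseteq> {x \<in> ?K. \<sigma> x = \<tau> x}" using eq roots_in_splitting_field by auto
  ultimately have "?K \<subseteq> {x \<in> ?K. \<sigma> x = \<tau> x}" by (rule splitting_field_least)
  then show "\<sigma> x = \<tau> x" if "x \<in> ?K" for x using that by blast
qed

lemma galois_root:
  assumes "f \<noteq> 0" "\<sigma> \<in> carrier (galois_group f)" "ipoly f a = 0"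
  shows "ipoly f (\<sigma> a) = 0"
  using hom_on_permutes_roots[of f \<sigma>] assms by (auto simp: galois_group_carrier)

lemma galois_group_finite:
  assumes f: "f \<noteq> 0"
  shows "finite (carrier (galois_group f))"
proof -
  let ?R = "{a. ipoly f a = 0}" and ?K = "splitting_field f"
  have finR: "finite ?R" using poly_roots_finite[of "cpoly f"] f by simp
  have "inj_on (\<lambda>\<sigma>. restrict \<sigma> ?R) (carrier (galois_group f))"
  proof (rule inj_onI)
    fix \<sigma> \<tau> assume \<sigma>: "\<sigma> \<in> carrier (galois_group f)" and \<tau>: "\<tau> \<in> carrier (galois_group f)"
      and eq: "restrict \<sigma> ?R = restrict \<tau> ?R"
    show "\<sigma> = \<tau>"
    proof (rule galois_eqI[OF f \<sigma> \<tau>])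
      fix a assume "ipoly f a = 0"
      then show "\<sigma> a = \<tau> a" using fun_cong[OF eq, of a] by simp
    qed
  qed
  moreover have "(\<lambda>\<sigma>. restrict \<sigma> ?R) ` carrier (galois_group f) \<subseteq> PiE ?R (\<lambda>_. ?R)"
    by (auto simp: PiE_iff extensional_def restrict_def galois_root[OF f] split: if_splits)
  ultimately show ?thesis
    using finite_imageD finite_subset finite_PiE[OF finR finR] by (metis (no_types, lifting))
qed

lemma galois_compose:
  assumes f: "f \<noteq> 0" and \<sigma>: "\<sigma> \<in> carrier (galois_group f)" and \<tau>: "\<tau> \<in> carrier (galois_group f)"
  shows "compose (splitting_field f) \<tau> \<sigma> \<in> carrier (galois_group f)"
proof -
  let ?K = "splitting_field f"
  have h: "hom_on ?K \<sigma>" "hom_on ?K \<tau>" using \<sigma> \<tau> by (auto simp: galois_group_carrier[OF f])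
  have into: "\<sigma> x \<in> ?K" if "x \<in> ?K" for x
    using hom_on_splitting_field_bij[OF f h(1)] that by (auto simp: bij_betw_def)
  have "hom_on ?K (\<lambda>x. \<tau> (\<sigma> x))"
    unfolding hom_on_def
    by (simp add: hom_onD(1-4)[OF h(1)] hom_onD(2-4)[OF h(2)] into)
  then show ?thesis using restrict_in_galois_group[OF f] by (simp add: compose_def)
qed

text \<open>The indeterminate of \<open>\<Theta>\<close> separates the roots: a congruence between two such generic
  combinations is a congruence for every root at once, whereas \<open>\<bbbF>\<^sub>p\<close> may have too few elements for
  a separating combination with integer coefficients.\<close>

lemma galois_permuted_prod_integral:
  fixes f :: "int poly" and e :: "nat \<Rightarrow> complex"
  assumes f: "lead_coeff f = 1" and e: "\<And>i. i < n \<Longrightarrow> ipoly f (e i) = 0"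
  defines "\<Theta> \<equiv> \<lambda>\<sigma>. \<Sum>i<n. monom (\<sigma> (e i)) i"
  obtains P where "(\<Prod>\<sigma>\<in>carrier (galois_group f). [:- \<Theta> \<sigma>, 1:]) = map_poly cpoly P"
proof -
  let ?K = "splitting_field f" and ?G = "carrier (galois_group f)"
  have f0: "f \<noteq> 0" using f by auto
  define Q where "Q = (\<Prod>\<sigma>\<in>?G. [:- \<Theta> \<sigma>, 1:])"
  note K = subfield_splitting_field[of f]
  note ringK = subfield_ofD(1)[OF K]
  have hom: "hom_on ?K \<sigma>" if "\<sigma> \<in> ?G" for \<sigma> using that by (simp add: galois_group_carrier[OF f0])
  have img: "ipoly f (\<sigma> (e i)) = 0" if "\<sigma> \<in> ?G" "i < n" for \<sigma> i
    by (rule galois_root[OF f0 that(1) e[OF that(2)]])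
  have coeff_\<Theta>: "coeff (\<Theta> \<sigma>) i = (if i < n then \<sigma> (e i) else 0)" for \<sigma> i
    by (simp add: \<Theta>_def coeff_sum sum.delta')
  have \<Theta>_over: "\<Theta> \<sigma> \<in> polys_over A" if "\<sigma> \<in> ?G" "subring_of A" "{a. ipoly f a = 0} \<subseteq> A" for \<sigma> A
    using img[OF that(1)] that(3) subring_ofD(1)[OF that(2)] by (intro polys_overI) (auto simp: coeff_\<Theta>)
  have lin_over: "[:- \<Theta> \<sigma>, 1:] \<in> polys_over (polys_over A)" if "\<sigma> \<in> ?G" "subring_of A" "{a. ipoly f a = 0} \<subseteq> A" for \<sigma> A
  proof -
    note ringA = subring_of_polys_over[OF that(2)]
    show ?thesis
      by (intro pCons_in_polys_over subring_ofD(2,3)[OF ringA] zero_in_polys_over subring_ofD(1)[OF ringA] \<Theta>_over[OF that])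
  qed
  have Q_over: "Q \<in> polys_over (polys_over A)" if "subring_of A" "{a. ipoly f a = 0} \<subseteq> A" for A
    unfolding Q_def by (intro subring_of_prod subring_of_polys_over that lin_over)
  have rootsK: "{a. ipoly f a = 0} \<subseteq> ?K" using roots_in_splitting_field by auto
  \<comment> \<open>Applying \<tau> to the coefficients permutes the factors, through composition
    with \<tau>.\<close>
  have Q_fixed: "map_poly (map_poly \<tau>) Q = Q" if \<tau>: "\<tau> \<in> ?G" for \<tau>
  proof -
    note h1 = hom_on_polys_over[OF hom[OF \<tau>]]
    note h2 = hom_on_polys_over[OF h1]
    have "map_poly (map_poly \<tau>) Q = (\<Prod>\<sigma>\<in>?G. map_poly (map_poly \<tau>) [:- \<Theta> \<sigma>, 1:])"
      unfolding Q_def by (rule hom_on_prod[OF h2 lin_over[OF _ ringK rootsK]])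
    also have "\<dots> = (\<Prod>\<sigma>\<in>?G. [:- \<Theta> (compose ?K \<tau> \<sigma>), 1:])"
    proof (rule prod.cong[OF refl])
      fix \<sigma> assume \<sigma>: "\<sigma> \<in> ?G"
      have "map_poly \<tau> (\<Theta> \<sigma>) = \<Theta> (compose ?K \<tau> \<sigma>)"
        by (rule poly_eqI)
          (simp add: coeff_map_poly hom_onD(5)[OF hom[OF \<tau>]] coeff_\<Theta> compose_def roots_in_splitting_field e)
      then have neg: "map_poly \<tau> (- \<Theta> \<sigma>) = - \<Theta> (compose ?K \<tau> \<sigma>)"
        using hom_onD(6)[OF h1 \<Theta>_over[OF \<sigma> ringK rootsK]] by simp
      show "map_poly (map_poly \<tau>) [:- \<Theta> \<sigma>, 1:] = [:- \<Theta> (compose ?K \<tau> \<sigma>), 1:]"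
        by (rule poly_eqI)
          (simp add: coeff_map_poly hom_onD(5)[OF h1] hom_onD(2)[OF h1] neg coeff_pCons split: nat.split)
    qed
    also have "\<dots> = Q"
      unfolding Q_def
    proof (rule prod.reindex_bij_betw)
      have inj: "inj_on (compose ?K \<tau>) ?G"
      proof (rule inj_onI)
        fix \<sigma> \<rho> assume \<sigma>: "\<sigma> \<in> ?G" and \<rho>: "\<rho> \<in> ?G" and eq: "compose ?K \<tau> \<sigma> = compose ?K \<tau> \<rho>"
        show "\<sigma> = \<rho>"
        proof (rule galois_eqI[OF f0 \<sigma> \<rho>])
          fix a assume a: "ipoly f a = 0"
          have "\<tau> (\<sigma> a) = \<tau> (\<rho> a)"
            using fun_cong[OF eq, of a] roots_in_splitting_field[OF a] by (simp add: compose_def)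
          moreover have "\<sigma> a \<in> ?K" "\<rho> a \<in> ?K"
            using hom_on_splitting_field_bij[OF f0 hom[OF \<sigma>]] hom_on_splitting_field_bij[OF f0 hom[OF \<rho>]]
              roots_in_splitting_field[OF a] by (auto simp: bij_betw_def)
          ultimately show "\<sigma> a = \<rho> a" using hom_on_inj[OF K hom[OF \<tau>]] by (auto dest: inj_onD)
        qed
      qed
      moreover have "compose ?K \<tau> ` ?G \<subseteq> ?G" using galois_compose[OF f0 _ \<tau>] by auto
      ultimately show "bij_betw (compose ?K \<tau>) ?G ?G"
        using endo_inj_surj[OF galois_group_finite[OF f0]] by (auto simp: bij_betw_def)
    qed
    finally show ?thesis .
  qed
  \<comment> \<open>An algebraic integer in the splitting field that the Galois group fixes is
    rational, hence an integer.\<close>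
  have Q_int: "coeff (coeff Q k) j \<in> \<int>" for k j
  proof -
    have A: "coeff (coeff Q k) j \<in> alg_ints"
      using Q_over[OF subring_of_alg_ints] root_in_alg_ints[OF f] by (auto dest!: polys_overD)
    have inK: "coeff (coeff Q k) j \<in> ?K"
      using Q_over[OF ringK rootsK] by (auto dest!: polys_overD)
    have "\<tau> (coeff (coeff Q k) j) = coeff (coeff Q k) j" if \<tau>: "\<tau> \<in> ?G" for \<tau>
    proof -
      have "coeff (coeff (map_poly (map_poly \<tau>) Q) k) j = \<tau> (coeff (coeff Q k) j)"
        by (simp add: coeff_map_poly hom_onD(5)[OF hom[OF \<tau>]])
      then show ?thesis using Q_fixed[OF \<tau>] by simp
    qed
    then have "coeff (coeff Q k) j \<in> \<rat>" by (rule galois_fixed_rational[OF f0 inK A])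
    then show ?thesis using A rational_algebraic_int_is_int by (auto simp: alg_ints_def)
  qed
  \<comment> \<open>An inverse of \<open>of_int\<close> on the integers, with value 0 at 0 so that
    it can be applied coefficientwise.\<close>
  define g where "g z = \<lfloor>Re z\<rfloor>" for z
  have g: "of_int (g z) = z" if "z \<in> \<int>" for z using that by (auto simp: g_def elim: Ints_cases)
  have g0: "g 0 = 0" by (simp add: g_def)
  have "map_poly cpoly (map_poly (map_poly g) Q) = Q"
    by (rule poly_eqI, rule poly_eqI) (simp add: coeff_map_poly g0 g[OF Q_int])
  then show thesis using that[of "map_poly (map_poly g) Q"] unfolding Q_def by simp
qed

text \<open>The product over the Galois group vanishes at the generic combination Y of the roots.
  Frobenius carries Y to Z, the same combination of the roots \<phi> a congruent to their q-th
  powers, so the product at Z is 0 modulo \<open>\<mm>\<close>. Primality makes Z congruent to some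
  \<open>\<Theta> \<sigma>\<close>, and comparing coefficients identifies \<sigma> at every
  root.\<close>

lemma (in prime_above) frobenius_lift:
  assumes f: "lead_coeff f = 1"
  shows "\<exists>\<sigma>\<in>carrier (galois_group f). \<forall>a. ipoly f a = 0 \<longrightarrow> a ^ q - \<sigma> a \<in> \<mm>"
proof -
  let ?K = "splitting_field f" and ?G = "carrier (galois_group f)" and ?R = "{a. ipoly f a = 0}"
  have f0: "f \<noteq> 0" using f by auto
  have finR: "finite ?R" using poly_roots_finite[of "cpoly f"] f0 by simp
  obtain \<phi> where \<phi>: "\<And>a. ipoly f a = 0 \<Longrightarrow> ipoly f (\<phi> a) = 0 \<and> a ^ q - \<phi> a \<in> \<mm>"
    using frobenius_on_roots[OF f] by blast
  define n where "n = card ?R"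
  obtain e where e: "bij_betw e {..<n} ?R"
    using ex_bij_betw_nat_finite[OF finR] by (auto simp: n_def atLeast0LessThan)
  have eR: "ipoly f (e i) = 0" if "i < n" for i using e that by (auto simp: bij_betw_def)
  define \<Theta> where "\<Theta> \<sigma> = (\<Sum>i<n. monom (\<sigma> (e i)) i)" for \<sigma> :: "complex \<Rightarrow> complex"
  have coeff_\<Theta>: "coeff (\<Theta> \<sigma>) i = (if i < n then \<sigma> (e i) else 0)" for \<sigma> i
    by (simp add: \<Theta>_def coeff_sum sum.delta')
  have \<Theta>_over: "\<Theta> \<sigma> \<in> polys_over alg_ints" if "\<And>a. ipoly f a = 0 \<Longrightarrow> ipoly f (\<sigma> a) = 0" for \<sigma>
    using that[OF eR] root_in_alg_ints[OF f] subring_ofD(1)[OF ringA] by (intro polys_overI) (auto simp: coeff_\<Theta>)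
  obtain P where P: "(\<Prod>\<sigma>\<in>?G. [:- \<Theta> \<sigma>, 1:]) = map_poly cpoly P"
    using galois_permuted_prod_integral[OF f, of n e] eR unfolding \<Theta>_def by blast
  define Y where "Y = \<Theta> (\<lambda>x. x)"
  define Z where "Z = \<Theta> \<phi>"
  have Y: "Y \<in> polys_over alg_ints" unfolding Y_def by (rule \<Theta>_over) simp
  have Z: "Z \<in> polys_over alg_ints" unfolding Z_def using \<phi> by (intro \<Theta>_over) simp
  \<comment> \<open>The identity automorphism contributes the factor that vanishes at Y.\<close>
  have "restrict (\<lambda>x. x) ?K \<in> ?G"
    by (rule restrict_in_galois_group[OF f0]) (use subfield_ofD(1)[OF subfield_splitting_field[of f]] in \<open>simp add: hom_on_def\<close>)
  moreover have "\<Theta> (restrict (\<lambda>x. x) ?K) = Y"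
    unfolding Y_def \<Theta>_def by (rule sum.cong) (auto simp: roots_in_splitting_field eR)
  ultimately have PY: "poly (map_poly cpoly P) Y = 0"
    unfolding P[symmetric] poly_prod
    by (intro prod_zero[OF galois_group_finite[OF f0]] bexI[of _ "restrict (\<lambda>x. x) ?K"]) auto
  \<comment> \<open>Coefficientwise this says that a^q is congruent to \<phi> a; substituting x^q
    then relates the q-th power of Y to Z.\<close>
  have "map_poly (\<lambda>c. c ^ q) Y - Z \<in> polys_over \<mm>"
    using \<phi>[OF eR] q_prime(2) idealD(3) by (intro polys_overI) (auto simp: coeff_map_poly power_0_left Y_def Z_def coeff_\<Theta>)
  then have "(map_poly (\<lambda>c. c ^ q) Y - Z) \<circ>\<^sub>p monom 1 q \<in> polys_over \<mm>"
    using pcompose_monom_in_polys_over_iff[OF q_prime(2) idealD(3)] by blast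
  then have "Y ^ q - Z \<circ>\<^sub>p monom 1 q \<in> polys_over \<mm>"
    using ideal_cong_trans[OF idealX poly_power_prime_cong[OF ideal q_prime(1,4) Y]] by (simp add: pcompose_diff)
  from eval_power_cong[OF Y Z this, of P]
  have "- (poly (map_poly cpoly P) Z \<circ>\<^sub>p monom 1 q) \<in> polys_over \<mm>"
    using PY q_prime(2) by (simp add: power_0_left)
  then have "poly (map_poly cpoly P) Z \<circ>\<^sub>p monom 1 q \<in> polys_over \<mm>"
    using ideal_ofD(7)[OF idealX] by fastforce
  then have "poly (map_poly cpoly P) Z \<in> polys_over \<mm>"
    using pcompose_monom_in_polys_over_iff[OF q_prime(2) idealD(3)] by blast
  then have prod_in: "(\<Prod>\<sigma>\<in>?G. Z - \<Theta> \<sigma>) \<in> polys_over \<mm>"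
    unfolding P[symmetric] poly_prod by (simp add: algebra_simps)
  have img: "ipoly f (\<sigma> a) = 0" if "\<sigma> \<in> ?G" "ipoly f a = 0" for \<sigma> a
    by (rule galois_root[OF f0 that])
  obtain \<sigma> where \<sigma>: "\<sigma> \<in> ?G" "Z - \<Theta> \<sigma> \<in> polys_over \<mm>"
    using prime_ideal_of_prod[OF primeX galois_group_finite[OF f0] _ prod_in]
      subring_ofD(6)[OF ringX Z \<Theta>_over] img by blast
  show ?thesis
  proof (intro bexI[OF _ \<sigma>(1)] allI impI)
    fix a assume a: "ipoly f a = 0"
    then obtain i where i: "i < n" "a = e i" using e by (auto simp: bij_betw_def)
    have "\<phi> a - \<sigma> a \<in> \<mm>" using polys_overD[OF \<sigma>(2), of i] i by (simp add: Z_def coeff_\<Theta>)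
    then show "a ^ q - \<sigma> a \<in> \<mm>" using ideal_cong_trans[OF ideal] \<phi>[OF a] by blast
  qed
qed

section \<open>The cycle type of Frobenius\<close>

context prime_above
begin

text \<open>The polynomial x^q - x already has the p residues 0, ..., p - 1 as roots modulo
  \<open>\<mm>\<close>; a further root would exceed its degree.\<close>

lemma frobenius_fixed_imp_int:
  assumes x: "x \<in> alg_ints" "x ^ q - x \<in> \<mm>"
  shows "\<exists>c. x - of_int c \<in> \<mm>"
proof (rule ccontr)
  assume no: "\<nexists>c. x - of_int c \<in> \<mm>"
  define f :: "complex poly" where "f = monom 1 q - monom 1 1"
  have q1: "q > 1" by (rule q_prime)
  have fA: "f \<in> polys_over alg_ints"
    unfolding f_def by (intro subring_ofD(6)[OF ringX] monom_in_polys_over subring_ofD(1,2)[OF ringA])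
  have "coeff f q = 1" using q1 by (simp add: f_def)
  then have fm: "f \<notin> polys_over \<mm>" using prime_ideal_ofD(2)[OF prime_ideal] polys_overD by metis
  have deg: "degree f \<le> q" unfolding f_def using q1 by (intro degree_diff_le) (auto simp: degree_monom_le intro: order_trans[OF degree_monom_le])
  have incong: "(of_int c :: complex) - of_int d \<notin> \<mm>" if "c \<in> {0..<p}" "d \<in> {0..<p}" "c \<noteq> d" for c d
  proof -
    have "\<not> p dvd c - d" using that by (metis atLeastLessThan_iff mod_eq_dvd_iff mod_pos_pos_trivial)
    then show ?thesis using of_int_in_iff[of "c - d"] by simp
  qed
  let ?C = "insert x (of_int ` {0..<p})"
  have inj: "inj_on (of_int :: int \<Rightarrow> complex) {0..<p}" by (simp add: inj_on_def)
  have xn: "x \<notin> of_int ` {0..<p}" using no idealD(3) by (metis diff_self imageE)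
  have "card ?C \<le> degree f"
  proof (rule card_roots_mod_prime_ideal[OF prime_ideal fA fm])
    show "finite ?C" "?C \<subseteq> alg_ints" using x(1) subring_of_of_int[OF ringA] by auto
    fix c assume c: "c \<in> ?C"
    show "poly f c \<in> \<mm>"
    proof (cases "c = x")
      case True
      then show ?thesis using x(2) by (simp add: f_def poly_monom)
    next
      case False
      then obtain k where k: "c = of_int k" using c by auto
      have "p dvd k ^ q - k" using prime_dvd_power_minus[OF q_prime(1), of k] q_prime(5) by simp
      then have "of_int (k ^ q - k) \<in> \<mm>" by (simp only: of_int_in_iff)
      then show ?thesis by (simp add: f_def poly_monom k)
    qed
    fix d assume d: "d \<in> ?C" "c \<noteq> d"
    show "c - d \<notin> \<mm>"
    proof
      assume cd: "c - d \<in> \<mm>"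
      then have dc: "d - c \<in> \<mm>" by (rule ideal_cong_sym[OF ideal])
      show False using c d cd dc no incong by auto
    qed
  qed
  moreover have "card ?C = q + 1" using xn inj by (simp add: card_image)
  ultimately show False using deg by simp
qed

context
  fixes f :: "int poly" and \<sigma> :: "complex \<Rightarrow> complex"
  assumes f: "lead_coeff f = 1" and sf: "\<And>g. count (factors_m f) g \<le> 1"
    and \<sigma>: "\<sigma> \<in> carrier (galois_group f)" and frob: "\<And>a. ipoly f a = 0 \<Longrightarrow> a ^ q - \<sigma> a \<in> \<mm>"
begin

text \<open>The roots of \<open>f\<close> lying over \<open>g\<close>. For the irreducible factors
  of \<open>f\<close> these sets turn out to be the cycles of \<sigma>.\<close>

definition roots_mod :: "int poly \<Rightarrow> complex set" where
  "roots_mod g = {a. ipoly f a = 0 \<and> ipoly g a \<in> \<mm>}"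

lemma f_nonzero: "f \<noteq> 0"
  using f by auto

lemma finite_roots: "finite {a. ipoly f a = 0}"
  using poly_roots_finite[of "cpoly f"] f_nonzero by simp

lemma root_alg: "ipoly f a = 0 \<Longrightarrow> a \<in> alg_ints"
  by (rule root_in_alg_ints[OF f])

lemma inj_on_roots: "inj_on \<sigma> {a. ipoly f a = 0}"
proof -
  have h: "hom_on (splitting_field f) \<sigma>" using \<sigma> by (simp add: galois_group_carrier[OF f_nonzero])
  show ?thesis
    by (rule inj_on_subset[OF hom_on_inj[OF subfield_splitting_field h]]) (use roots_in_splitting_field in auto)
qed

text \<open>g(a^q) is congruent to g(a)^q, and \<sigma> a to a^q.\<close>

lemma roots_mod_stable: "\<sigma> ` roots_mod g \<subseteq> roots_mod g"
proof
  fix b assume "b \<in> \<sigma> ` roots_mod g"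
  then obtain a where a: "ipoly f a = 0" "ipoly g a \<in> \<mm>" "b = \<sigma> a" by (auto simp: roots_mod_def)
  note aA = root_alg[OF a(1)]
  have b0: "ipoly f b = 0" unfolding a(3) by (rule galois_root[OF f_nonzero \<sigma> a(1)])
  have "ipoly g a ^ q \<in> \<mm>" using a(2) q_prime(2) idealD(5)[OF a(2) subring_of_power[OF ringA ipoly_in_alg_ints[OF aA]], of g "q - 1"]
    by (cases q) auto
  then have "ipoly g (a ^ q) \<in> \<mm>" using ideal_cong_mem[OF ideal ipoly_power_cong[OF aA]] by blast
  moreover have "ipoly g (a ^ q) - ipoly g b \<in> \<mm>"
    unfolding a(3) using root_alg[OF b0] a(3)
    by (intro ideal_cong_poly[OF ideal cpoly_over_alg_ints subring_of_power[OF ringA aA] _ frob[OF a(1)]]) simp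
  ultimately have "ipoly g b \<in> \<mm>" using ideal_cong_mem[OF ideal] by blast
  then show "b \<in> roots_mod g" using b0 by (simp add: roots_mod_def)
qed

text \<open>The polynomial with root set \<open>C\<close> is fixed by Frobenius modulo \<open>\<mm>\<close>, hence congruent to
  an integer polynomial, which \<open>g\<close> must divide modulo \<open>p\<close>.\<close>

lemma degree_le_card_stable:
  assumes g: "g \<in> monic_irr" and C: "C \<subseteq> roots_mod g" "C \<noteq> {}" "\<sigma> ` C \<subseteq> C"
  shows "degree g \<le> card C"
proof -
  have CR: "C \<subseteq> {a. ipoly f a = 0}" using C(1) by (auto simp: roots_mod_def)
  have finC: "finite C" using CR finite_roots finite_subset by blast
  have CA: "a \<in> alg_ints" if "a \<in> C" for a using that CR root_alg by auto
  have bijC: "bij_betw \<sigma> C C"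
    using endo_inj_surj[OF finC C(3) inj_on_subset[OF inj_on_roots CR]] inj_on_subset[OF inj_on_roots CR]
    by (simp add: bij_betw_def)
  define h where "h = (\<Prod>a\<in>C. [:- a, 1:])"
  have lin: "[:- a, 1:] \<in> polys_over alg_ints" if "a \<in> alg_ints" for a
    by (intro pCons_in_polys_over zero_in_polys_over subring_ofD(1-3)[OF ringA] that)
  have hA: "h \<in> polys_over alg_ints" unfolding h_def by (intro subring_of_prod[OF ringX] lin CA)
  have comp: "U \<circ>\<^sub>p monom 1 q \<in> polys_over alg_ints" if "U \<in> polys_over alg_ints" for U
    using pcompose_monom_in_polys_over_iff[OF q_prime(2) subring_ofD(1)[OF ringA]] that by blast
  have lin_cong: "[:- a, 1:] ^ q - [:- \<sigma> a, 1:] \<circ>\<^sub>p monom 1 q \<in> polys_over \<mm>" if a: "a \<in> C" for a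
  proof -
    note aA = CA[OF a]
    \<comment> \<open>Additivity applied to a + (-a) = 0 makes (-a)^q congruent to -a^q for every
      prime, 2 included.\<close>
    have "(a + (- a)) ^ q - (a ^ q + (- a) ^ q) \<in> \<mm>"
      by (intro ideal_cong_add_power[OF ideal q_prime(1,4)] aA subring_ofD(3)[OF ringA])
    then have "- (a ^ q + (- a) ^ q) \<in> \<mm>" using q_prime(2) by (simp add: power_0_left)
    then have s: "a ^ q + (- a) ^ q \<in> \<mm>" by (metis idealD(7) minus_minus)
    have "a ^ q - \<sigma> a \<in> \<mm>" using frob CR a by auto
    from idealD(8)[OF s this] have d: "(- a) ^ q - (- \<sigma> a) \<in> \<mm>" by (simp add: algebra_simps)
    have "map_poly (\<lambda>c. c ^ q) [:- a, 1:] = [:(- a) ^ q, 1:]"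
      using q_prime(2) by (simp add: map_poly_pCons power_0_left)
    then have "map_poly (\<lambda>c. c ^ q) [:- a, 1:] - [:- \<sigma> a, 1:] = [:(- a) ^ q - (- \<sigma> a):]" by simp
    then have "map_poly (\<lambda>c. c ^ q) [:- a, 1:] - [:- \<sigma> a, 1:] \<in> polys_over \<mm>"
      using d idealD(3) by (simp add: pCons_in_polys_over_iff zero_in_polys_over)
    then have "(map_poly (\<lambda>c. c ^ q) [:- a, 1:] - [:- \<sigma> a, 1:]) \<circ>\<^sub>p monom 1 q \<in> polys_over \<mm>"
      using pcompose_monom_in_polys_over_iff[OF q_prime(2) idealD(3)] by blast
    then have "map_poly (\<lambda>c. c ^ q) [:- a, 1:] \<circ>\<^sub>p monom 1 q - [:- \<sigma> a, 1:] \<circ>\<^sub>p monom 1 q \<in> polys_over \<mm>"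
      by (simp only: pcompose_diff)
    from ideal_cong_trans[OF idealX poly_power_prime_cong[OF ideal q_prime(1,4) lin[OF aA]] this]
    show ?thesis .
  qed
  have "(\<Prod>a\<in>C. [:- a, 1:] ^ q) - (\<Prod>a\<in>C. [:- \<sigma> a, 1:] \<circ>\<^sub>p monom 1 q) \<in> polys_over \<mm>"
  proof (rule ideal_cong_prod[OF idealX _ _ lin_cong])
    fix a assume a: "a \<in> C"
    show "[:- a, 1:] ^ q \<in> polys_over alg_ints" by (intro subring_of_power[OF ringX] lin CA a)
    have "\<sigma> a \<in> C" using C(3) a by auto
    then show "[:- \<sigma> a, 1:] \<circ>\<^sub>p monom 1 q \<in> polys_over alg_ints" by (intro comp lin CA)
  qed
  also have "(\<Prod>a\<in>C. [:- \<sigma> a, 1:] \<circ>\<^sub>p monom 1 q) = (\<Prod>a\<in>C. [:- \<sigma> a, 1:]) \<circ>\<^sub>p monom 1 q"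
    by (rule pcompose_prod[symmetric])
  \<comment> \<open>As \<sigma> permutes \<open>C\<close>, the transported linear factors multiply
    to \<open>h\<close> again.\<close>
  also have "(\<Prod>a\<in>C. [:- \<sigma> a, 1:]) = h" unfolding h_def by (rule prod.reindex_bij_betw[OF bijC])
  finally have 1: "h ^ q - h \<circ>\<^sub>p monom 1 q \<in> polys_over \<mm>" by (simp add: h_def prod_power_distrib)
  have 2: "h ^ q - map_poly (\<lambda>c. c ^ q) h \<circ>\<^sub>p monom 1 q \<in> polys_over \<mm>"
    by (rule poly_power_prime_cong[OF ideal q_prime(1,4) hA])
  \<comment> \<open>Comparing the two congruences for the q-th power of \<open>h\<close> shows that
    each coefficient of \<open>h\<close> is fixed by Frobenius.\<close>
  have "(map_poly (\<lambda>c. c ^ q) h - h) \<circ>\<^sub>p monom 1 q \<in> polys_over \<mm>"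
    using ideal_cong_trans[OF idealX ideal_cong_sym[OF idealX 2] 1] by (simp only: pcompose_diff)
  then have 3: "map_poly (\<lambda>c. c ^ q) h - h \<in> polys_over \<mm>"
    using pcompose_monom_in_polys_over_iff[OF q_prime(2) idealD(3)] by blast
  have "\<exists>c. coeff h i - of_int c \<in> \<mm>" for i
    using polys_overD[OF 3, of i] q_prime(2)
    by (intro frobenius_fixed_imp_int polys_overD[OF hA]) (simp add: coeff_map_poly power_0_left)
  then obtain c where c: "coeff h i - of_int (c i) \<in> \<mm>" for i by metis
  define d where "d = card C"
  have h_lead: "lead_coeff h = 1" unfolding h_def by (simp add: lead_coeff_prod)
  have h_deg: "degree h = d" unfolding h_def d_def by (subst degree_prod_eq_sum_degree) auto
  \<comment> \<open>Setting the top coefficient to 1 makes \<open>H\<close> monic of degree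
    \<open>card C\<close>, on which the final degree comparison rests.\<close>
  define H where "H = (\<Sum>i<d. monom (c i) i) + monom 1 d"
  have cH: "coeff H i = (if i < d then c i else if i = d then 1 else 0)" for i
    by (simp add: H_def coeff_sum sum.delta')
  have dH: "degree H = d" by (rule antisym[OF degree_le le_degree]) (simp_all add: cH)
  have Hh: "h - cpoly H \<in> polys_over \<mm>"
  proof (rule polys_overI)
    fix i
    show "coeff (h - cpoly H) i \<in> \<mm>"
      using c[of i] idealD(3) h_lead h_deg
      by (cases i d rule: linorder_cases) (simp_all add: coeff_map_poly cH coeff_eq_0)
  qed
  obtain a where a: "a \<in> C" using C(2) by auto
  have "poly h a = 0" using a finC by (auto simp: h_def poly_prod)
  then have "- ipoly H a \<in> \<mm>" using ideal_poly_in[OF ideal Hh CA[OF a]] by simp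
  then have "ipoly H a \<in> \<mm>" by (metis idealD(7) minus_minus)
  then have "g dvdm H" using irr_root_not_root[OF g CA[OF a]] C(1) a by (auto simp: roots_mod_def)
  then obtain k where "Mp H = Mp (g * k)" by (auto simp: dvdm_def)
  from eq_m_monic_factor(2)[OF _ monic_irrD(2)[OF g] this] show ?thesis by (simp add: dH cH d_def)
qed

lemma factor_irr: "g \<in># factors_m f \<Longrightarrow> g \<in> monic_irr"
  using factors_m(1)[OF f] by auto

lemma Union_roots_mod: "(\<Union>g\<in>set_mset (factors_m f). roots_mod g) = {a. ipoly f a = 0}"
  using root_of_some_factor[OF f] by (fastforce simp: roots_mod_def)

lemma roots_mod_disjoint:
  "g \<in># factors_m f \<Longrightarrow> h \<in># factors_m f \<Longrightarrow> g \<noteq> h \<Longrightarrow> roots_mod g \<inter> roots_mod h = {}"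
  using irr_roots_disjoint[OF factor_irr factor_irr root_alg] by (auto simp: roots_mod_def)

text \<open>The sets over the distinct factors partition the roots, and each has at least deg g
  elements. Both totals equal deg f, so no inequality is strict.\<close>

lemma card_roots_mod:
  assumes g: "g \<in># factors_m f"
  shows "card (roots_mod g) = degree g"
proof -
  let ?S = "set_mset (factors_m f)"
  have fin: "finite (roots_mod g)" for g
    by (rule finite_subset[OF _ finite_roots]) (auto simp: roots_mod_def)
  have ge: "degree g \<le> card (roots_mod g)" if "g \<in># factors_m f" for g
    using factor_has_root[OF f that]
    by (intro degree_le_card_stable factor_irr that roots_mod_stable) (auto simp: roots_mod_def)
  have "(\<Sum>g\<in>?S. card (roots_mod g)) = card (\<Union>g\<in>?S. roots_mod g)"
    by (rule card_UN_disjoint[symmetric]) (use fin roots_mod_disjoint in auto)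
  also have "\<dots> = degree f" unfolding Union_roots_mod by (rule card_roots[OF f sf])
  also have "\<dots> = sum_mset (image_mset degree (mset_set ?S))"
    using factors_m(3)[OF f] mset_eq_mset_set[of "factors_m f"] sf by simp
  also have "\<dots> = (\<Sum>g\<in>?S. degree g)" by (simp add: sum_unfold_sum_mset)
  finally have eq: "(\<Sum>g\<in>?S. card (roots_mod g)) = (\<Sum>g\<in>?S. degree g)" .
  show ?thesis
  proof (rule ccontr)
    assume "card (roots_mod g) \<noteq> degree g"
    then have "degree g < card (roots_mod g)" using ge[OF g] by simp
    then have "(\<Sum>g\<in>?S. degree g) < (\<Sum>g\<in>?S. card (roots_mod g))"
      using g ge by (intro sum_strict_mono_ex1) auto
    then show False using eq by simp
  qed
qed

text \<open>A nonempty stable subset already has deg g elements, which is all of them: \<sigma> acts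
  on the roots over \<open>g\<close> as a single cycle.\<close>

lemma roots_mod_transitive:
  assumes g: "g \<in># factors_m f" and C: "C \<subseteq> roots_mod g" "C \<noteq> {}" "\<sigma> ` C \<subseteq> C"
  shows "C = roots_mod g"
proof (rule card_subset_eq)
  show "finite (roots_mod g)" by (rule finite_subset[OF _ finite_roots]) (auto simp: roots_mod_def)
  show "card C = card (roots_mod g)"
    using degree_le_card_stable[OF factor_irr[OF g] C] card_roots_mod[OF g]
      card_mono[OF \<open>finite (roots_mod g)\<close> C(1)] by simp
qed (rule C(1))

text \<open>The absence of proper stable subsets expresses an n-cycle without naming a cyclic order
  of the roots.\<close>

lemma single_cycle:
  assumes "image_mset degree (factors_m f) = {#n#}"
  shows "\<forall>C\<subseteq>{a. ipoly f a = 0}. C \<noteq> {} \<longrightarrow> \<sigma> ` C \<subseteq> C \<longrightarrow> C = {a. ipoly f a = 0}"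
proof -
  obtain g where g: "factors_m f = {#g#}" using msed_map_invR[OF assms] by auto
  have "roots_mod g = {a. ipoly f a = 0}" using Union_roots_mod g by simp
  then show ?thesis using roots_mod_transitive[of g] g by simp
qed

lemma cycle_with_fixed_point:
  assumes "image_mset degree (factors_m f) = {#1, n - 1#}"
  shows "\<exists>x. ipoly f x = 0 \<and> \<sigma> x = x \<and>
    (\<forall>C\<subseteq>{a. ipoly f a = 0} - {x}. C \<noteq> {} \<longrightarrow> \<sigma> ` C \<subseteq> C \<longrightarrow> C = {a. ipoly f a = 0} - {x})"
proof -
  obtain l B where l: "factors_m f = add_mset l B" "degree l = 1" "image_mset degree B = {#n - 1#}"
    using msed_map_invR[OF assms] by auto
  obtain g B' where g: "B = add_mset g B'" "degree g = n - 1" "image_mset degree B' = {#}"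
    using msed_map_invR[OF l(3)] by auto
  have fac: "factors_m f = {#l, g#}" using l g by simp
  \<comment> \<open>For n = 2 both factors are linear; squarefreeness still keeps them
    apart.\<close>
  have "l \<noteq> g" using sf[of l] fac by auto
  have disj: "roots_mod l \<inter> roots_mod g = {}" using roots_mod_disjoint[of l g] fac \<open>l \<noteq> g\<close> by simp
  have un: "roots_mod l \<union> roots_mod g = {a. ipoly f a = 0}" using Union_roots_mod fac by simp
  have "card (roots_mod l) = 1" using card_roots_mod[of l] fac l(2) by simp
  then obtain x where x: "roots_mod l = {x}" by (meson card_1_singletonE)
  have "\<sigma> x = x" using roots_mod_stable[of l] x by auto
  moreover have "roots_mod g = {a. ipoly f a = 0} - {x}" using un disj x by auto
  moreover have "ipoly f x = 0" using un x by auto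
  ultimately show ?thesis using roots_mod_transitive[of g] fac by (intro exI[of _ x]) simp
qed

text \<open>Linear factors give fixed roots, and over the quadratic factor a fixed root would be a
  proper stable subset.\<close>

lemma single_transposition:
  assumes "image_mset degree (factors_m f) = add_mset 2 (replicate_mset k 1)"
  shows "\<exists>a b. ipoly f a = 0 \<and> ipoly f b = 0 \<and> a \<noteq> b \<and> \<sigma> a = b \<and> \<sigma> b = a \<and>
    (\<forall>x. ipoly f x = 0 \<longrightarrow> x \<noteq> a \<longrightarrow> x \<noteq> b \<longrightarrow> \<sigma> x = x)"
proof -
  obtain g B where g: "factors_m f = add_mset g B" "degree g = 2" "image_mset degree B = replicate_mset k 1"
    using msed_map_invR[OF assms] by auto
  have "card (roots_mod g) = 2" using card_roots_mod[of g] g by simp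
  then obtain a b where ab: "roots_mod g = {a, b}" "a \<noteq> b" by (meson card_2_iff)
  have stab: "\<sigma> a \<in> {a, b}" "\<sigma> b \<in> {a, b}" using roots_mod_stable[of g] ab by auto
  have "\<sigma> a \<noteq> a" using roots_mod_transitive[of g "{a}"] g ab by auto
  moreover have "\<sigma> b \<noteq> b" using roots_mod_transitive[of g "{b}"] g ab by auto
  moreover have "\<sigma> x = x" if x: "ipoly f x = 0" "x \<noteq> a" "x \<noteq> b" for x
  proof -
    obtain h where h: "h \<in># factors_m f" "x \<in> roots_mod h" using Union_roots_mod x(1) by auto
    have "h \<noteq> g" using h(2) ab x by auto
    then have "h \<in># B" using h(1) g by simp
    then have "degree h \<in># replicate_mset k 1" using g(3) by (metis image_eqI multiset.set_map)
    then have "degree h = 1" by (simp split: if_splits)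
    then have "card (roots_mod h) = 1" using card_roots_mod[OF h(1)] by simp
    then obtain y where "roots_mod h = {y}" by (meson card_1_singletonE)
    then show ?thesis using h(2) roots_mod_stable[of h] by auto
  qed
  moreover have "ipoly f a = 0" "ipoly f b = 0" using ab(1) by (auto simp: roots_mod_def)
  ultimately show ?thesis using stab ab(2) by (intro exI[of _ a] exI[of _ b]) auto
qed

end

end

section \<open>Galois groups containing an n-cycle, an (n-1)-cycle and a transposition\<close>

text \<open>The forward orbit of \<open>a\<close> is nonempty and stable, hence all of
  \<open>X\<close>.\<close>

lemma stable_orbit_transitive:
  fixes s :: "'a \<Rightarrow> 'a"
  assumes s: "s ` X \<subseteq> X" and min: "\<forall>C\<subseteq>X. C \<noteq> {} \<longrightarrow> s ` C \<subseteq> C \<longrightarrow> C = X"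
    and a: "a \<in> X" and b: "b \<in> X"
  shows "\<exists>k. (s ^^ k) a = b"
proof -
  let ?C = "range (\<lambda>k. (s ^^ k) a)"
  have in_X: "(s ^^ k) a \<in> X" for k using s a by (induction k) auto
  have stable: "s ` ?C \<subseteq> ?C"
  proof
    fix y assume "y \<in> s ` ?C"
    then obtain k where "y = s ((s ^^ k) a)" by auto
    then have "y = (s ^^ Suc k) a" by simp
    then show "y \<in> ?C" by blast
  qed
  have "?C \<subseteq> X" using in_X by auto
  from min[rule_format, OF this _ stable] have "?C = X" by simp
  then show ?thesis using b by auto
qed

lemma transpose_conjugate:
  assumes "s permutes X"
  shows "s \<circ> Transposition.transpose a b \<circ> inv' s = Transposition.transpose (s a) (s b)"
proof -
  have inj: "s x = s y \<longleftrightarrow> x = y" for x y using permutes_inj[OF assms] by (auto dest: injD)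
  have "s \<circ> Transposition.transpose a b = Transposition.transpose (s a) (s b) \<circ> s"
    by (auto simp: fun_eq_iff Transposition.transpose_def inj)
  then have "s \<circ> Transposition.transpose a b \<circ> inv' s = Transposition.transpose (s a) (s b) \<circ> (s \<circ> inv' s)"
    by (simp add: comp_assoc)
  then show ?thesis using permutes_inv_o(1)[OF assms] by simp
qed

text \<open>A power of \<open>s1\<close> moves the transposition to one involving \<open>x\<close>;
  powers of \<open>s2\<close> fix \<open>x\<close> and move its partner to any other point;
  conjugation within this star of transpositions gives all of them.\<close>

lemma permutation_group_full:
  fixes \<Gamma> :: "('a \<Rightarrow> 'a) set"
  assumes X: "finite X" and \<Gamma>: "\<And>s. s \<in> \<Gamma> \<Longrightarrow> s permutes X"
    and id: "id \<in> \<Gamma>" and comp: "\<And>s t. s \<in> \<Gamma> \<Longrightarrow> t \<in> \<Gamma> \<Longrightarrow> s \<circ> t \<in> \<Gamma>"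
    and s1: "s1 \<in> \<Gamma>" "\<forall>C\<subseteq>X. C \<noteq> {} \<longrightarrow> s1 ` C \<subseteq> C \<longrightarrow> C = X"
    and s2: "s2 \<in> \<Gamma>" "x \<in> X" "s2 x = x" "\<forall>C\<subseteq>X - {x}. C \<noteq> {} \<longrightarrow> s2 ` C \<subseteq> C \<longrightarrow> C = X - {x}"
    and t: "Transposition.transpose a b \<in> \<Gamma>" "a \<in> X" "b \<in> X" "a \<noteq> b"
    and s: "s permutes X"
  shows "s \<in> \<Gamma>"
proof -
  have pow: "s ^^ k \<in> \<Gamma>" if "s \<in> \<Gamma>" for s k
    using that by (induction k) (auto intro: id comp)
  \<comment> \<open>Permutations of a finite set have finite order, so inverses are powers.\<close>
  have inv: "inv' s \<in> \<Gamma>" if s: "s \<in> \<Gamma>" for s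
  proof -
    have "permutation s" using \<Gamma>[OF s] X by (auto simp: permutation_permutes)
    then obtain k where k: "s ^^ k = id" "k > 0" by (rule permutation_is_nilpotent)
    then obtain j where j: "k = Suc j" by (cases k) auto
    have "s \<circ> s ^^ j = id" using k(1) unfolding j by simp
    moreover have "s ^^ j \<circ> s = id" using k(1) unfolding j funpow_Suc_right .
    ultimately have "inv' s = s ^^ j" by (intro inv_unique_comp) auto
    then show ?thesis using pow[OF s] by simp
  qed
  have conj: "Transposition.transpose (s a) (s b) \<in> \<Gamma>" if "s \<in> \<Gamma>" "Transposition.transpose a b \<in> \<Gamma>" for s a b
    using transpose_conjugate[OF \<Gamma>[OF that(1)], of a b] comp[OF comp[OF that] inv[OF that(1)]] by simp
  have img: "s ` X \<subseteq> X" if "s \<in> \<Gamma>" for s using permutes_image[OF \<Gamma>[OF that]] by simp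
  obtain k where k: "(s1 ^^ k) a = x"
    using stable_orbit_transitive[OF img[OF s1(1)] s1(2) t(2) s2(2)] by blast
  define y0 where "y0 = (s1 ^^ k) b"
  have g: "s1 ^^ k \<in> \<Gamma>" by (rule pow[OF s1(1)])
  have y0: "y0 \<in> X" "y0 \<noteq> x" "Transposition.transpose x y0 \<in> \<Gamma>"
    using img[OF g] t(3) permutes_inj[OF \<Gamma>[OF g]] t(4) k conj[OF g t(1)] unfolding y0_def by (auto dest: injD)
  have star: "Transposition.transpose x y \<in> \<Gamma>" if y: "y \<in> X" "y \<noteq> x" for y
  proof -
    have "s2 ` (X - {x}) \<subseteq> X - {x}"
      using img[OF s2(1)] permutes_inj[OF \<Gamma>[OF s2(1)]] s2(3) by (auto dest: injD)
    then obtain j where j: "(s2 ^^ j) y0 = y"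
      using stable_orbit_transitive[OF _ s2(4), of y0 y] y y0 by auto
    have "(s2 ^^ j) x = x" using s2(3) by (induction j) auto
    then show ?thesis using conj[OF pow[OF s2(1), of j] y0(3)] j by simp
  qed
  have all: "Transposition.transpose y z \<in> \<Gamma>" if yz: "y \<in> X" "z \<in> X" "y \<noteq> z" for y z
  proof (cases "y = x \<or> z = x")
    case True
    then show ?thesis using star yz by (metis transpose_commute)
  next
    case False
    then show ?thesis
      using conj[OF star[of y] star[of z]] yz by (simp add: Transposition.transpose_def)
  qed
  show ?thesis using s X
  proof (induction rule: permutes_induct)
    case (swap a b p)
    then show ?case using all comp by blast
  qed (rule id)
qed

text \<open>Numbering the roots transports automorphisms to permutations of 1..n. Injectivity holds
  because the roots generate the field; surjectivity is \<open>full\<close>.\<close>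

lemma galois_group_iso_sym_group:
  fixes f :: "int poly"
  assumes f: "f \<noteq> 0" and n: "card {a. ipoly f a = 0} = n"
    and full: "\<And>s. s permutes {a. ipoly f a = 0} \<Longrightarrow> \<exists>\<sigma>\<in>carrier (galois_group f). \<forall>a. ipoly f a = 0 \<longrightarrow> \<sigma> a = s a"
  shows "galois_group f \<cong> sym_group n"
proof -
  let ?R = "{a. ipoly f a = 0}" and ?G = "carrier (galois_group f)" and ?K = "splitting_field f"
  have finR: "finite ?R" using poly_roots_finite[of "cpoly f"] f by simp
  obtain e where e: "bij_betw e {1..n} ?R"
    using ex_bij_betw_nat_finite_1[OF finR] n by auto
  define e' where "e' = inv_into {1..n} e"
  have e'e: "e' (e i) = i" if "i \<in> {1..n}" for i
    unfolding e'_def using bij_betw_inv_into_left[OF e that] .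
  have ee': "e (e' a) = a" if "ipoly f a = 0" for a
    unfolding e'_def using bij_betw_inv_into_right[OF e] that by simp
  have eR: "ipoly f (e i) = 0" if "i \<in> {1..n}" for i using bij_betwE[OF e] that by auto
  have e'N: "e' a \<in> {1..n}" if "ipoly f a = 0" for a
    unfolding e'_def using bij_betwE[OF bij_betw_inv_into[OF e]] that by auto
  \<comment> \<open>Continued by the identity outside 1..n, as \<open>permutes\<close>
    demands.\<close>
  define \<Psi> where "\<Psi> \<sigma> = (\<lambda>i. if i \<in> {1..n} then e' (\<sigma> (e i)) else i)" for \<sigma> :: "complex \<Rightarrow> complex"
  have \<Psi>_in: "\<Psi> \<sigma> i = e' (\<sigma> (e i))" if "i \<in> {1..n}" for \<sigma> i using that by (simp only: \<Psi>_def if_True)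
  have \<Psi>_out: "\<Psi> \<sigma> i = i" if "i \<notin> {1..n}" for \<sigma> i using that by (simp only: \<Psi>_def if_False)
  have root: "ipoly f (\<sigma> a) = 0" if "\<sigma> \<in> ?G" "ipoly f a = 0" for \<sigma> a by (rule galois_root[OF f that])
  have hom: "hom_on ?K \<sigma>" if "\<sigma> \<in> ?G" for \<sigma> using that by (simp add: galois_group_carrier[OF f])
  have \<Psi>_perm: "\<Psi> \<sigma> permutes {1..n}" if \<sigma>: "\<sigma> \<in> ?G" for \<sigma>
  proof (rule bij_imp_permutes)
    have inj: "inj_on \<sigma> ?R"
      by (rule inj_on_subset[OF hom_on_inj[OF subfield_splitting_field hom[OF \<sigma>]]]) (use roots_in_splitting_field in auto)
    have "inj_on (\<Psi> \<sigma>) {1..n}"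
    proof (rule inj_onI)
      fix i j assume ij: "i \<in> {1..n}" "j \<in> {1..n}" "\<Psi> \<sigma> i = \<Psi> \<sigma> j"
      then have "e (e' (\<sigma> (e i))) = e (e' (\<sigma> (e j)))" by (simp add: \<Psi>_in del: atLeastAtMost_iff)
      then have "\<sigma> (e i) = \<sigma> (e j)" using ee' root[OF \<sigma>] eR ij by simp
      then have "e i = e j" using inj_onD[OF inj] eR ij by simp
      then show "i = j" using e'e ij by metis
    qed
    moreover have "\<Psi> \<sigma> ` {1..n} \<subseteq> {1..n}" using e'N root[OF \<sigma>] eR by (auto simp: \<Psi>_in simp del: atLeastAtMost_iff)
    ultimately show "bij_betw (\<Psi> \<sigma>) {1..n} {1..n}"
      using endo_inj_surj[of "{1..n}" "\<Psi> \<sigma>"] by (simp add: bij_betw_def)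
  qed (rule \<Psi>_out)
  have Bij: "\<sigma> \<in> Bij ?K" if "\<sigma> \<in> ?G" for \<sigma>
    using that by (simp add: galois_group_def Let_def)
  have mult: "\<sigma> \<otimes>\<^bsub>galois_group f\<^esub> \<tau> = compose ?K \<sigma> \<tau>" if "\<sigma> \<in> ?G" "\<tau> \<in> ?G" for \<sigma> \<tau>
    using Bij[OF that(1)] Bij[OF that(2)] by (simp add: galois_group_def Let_def BijGroup_def)
  have "\<Psi> \<in> iso (galois_group f) (sym_group n)"
    unfolding iso_def
  proof (intro CollectI conjI)
    show "\<Psi> \<in> hom (galois_group f) (sym_group n)"
    proof (rule homI)
      show "\<Psi> \<sigma> \<in> carrier (sym_group n)" if "\<sigma> \<in> ?G" for \<sigma>
        using \<Psi>_perm[OF that] by (simp add: sym_group_def)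
      fix \<sigma> \<tau> assume \<sigma>: "\<sigma> \<in> ?G" and \<tau>: "\<tau> \<in> ?G"
      show "\<Psi> (\<sigma> \<otimes>\<^bsub>galois_group f\<^esub> \<tau>) = \<Psi> \<sigma> \<otimes>\<^bsub>sym_group n\<^esub> \<Psi> \<tau>"
      proof
        fix i
        show "\<Psi> (\<sigma> \<otimes>\<^bsub>galois_group f\<^esub> \<tau>) i = (\<Psi> \<sigma> \<otimes>\<^bsub>sym_group n\<^esub> \<Psi> \<tau>) i"
        proof (cases "i \<in> {1..n}")
          case True
          have "e (e' (\<tau> (e i))) = \<tau> (e i)" using ee' root[OF \<tau>] eR True by simp
          moreover have "e' (\<tau> (e i)) \<in> {1..n}" using e'N root[OF \<tau>] eR True by simp
          ultimately show ?thesis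
            unfolding mult[OF \<sigma> \<tau>] using True roots_in_splitting_field[OF eR[OF True]]
            by (simp add: \<Psi>_in sym_group_def compose_def del: atLeastAtMost_iff)
        next
          case False
          then show ?thesis by (simp add: \<Psi>_out sym_group_def del: atLeastAtMost_iff)
        qed
      qed
    qed
    show "bij_betw \<Psi> ?G (carrier (sym_group n))"
      unfolding bij_betw_def
    proof (intro conjI inj_onI equalityI subsetI)
      fix \<sigma> \<tau> assume \<sigma>: "\<sigma> \<in> ?G" and \<tau>: "\<tau> \<in> ?G" and eq: "\<Psi> \<sigma> = \<Psi> \<tau>"
      show "\<sigma> = \<tau>"
      proof (rule galois_eqI[OF f \<sigma> \<tau>])
        fix a assume a: "ipoly f a = 0"
        have "e' (\<sigma> a) = e' (\<tau> a)" using fun_cong[OF eq, of "e' a"] e'N[OF a] ee'[OF a] by (simp add: \<Psi>_in del: atLeastAtMost_iff)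
        then show "\<sigma> a = \<tau> a" using ee'[OF root[OF \<sigma> a]] ee'[OF root[OF \<tau> a]] by metis
      qed
    next
      fix s assume "s \<in> \<Psi> ` ?G"
      then show "s \<in> carrier (sym_group n)" using \<Psi>_perm by (auto simp: sym_group_def)
    next
      fix s assume "s \<in> carrier (sym_group n)"
      then have s: "s permutes {1..n}" by (simp add: sym_group_def)
      define t where "t a = (if ipoly f a = 0 then e (s (e' a)) else a)" for a
      have sN: "s i \<in> {1..n}" if "i \<in> {1..n}" for i using permutes_in_image[OF s] that by simp
      have "t permutes ?R"
      proof (rule bij_imp_permutes)
        have "inj_on t ?R"
        proof (rule inj_onI)
          fix a b assume ab: "a \<in> ?R" "b \<in> ?R" "t a = t b"
          then have "e' (e (s (e' a))) = e' (e (s (e' b)))" by (simp add: t_def)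
          then have "s (e' a) = s (e' b)" using e'e sN e'N ab by simp
          then have "e' a = e' b" using permutes_inj[OF s] by (auto dest: injD)
          then show "a = b" using ee' ab by (metis mem_Collect_eq)
        qed
        moreover have "t ` ?R \<subseteq> ?R" using eR sN e'N by (auto simp: t_def)
        ultimately show "bij_betw t ?R ?R" using endo_inj_surj[OF finR] by (simp add: bij_betw_def)
      qed (simp add: t_def)
      from full[OF this] obtain \<sigma> where \<sigma>: "\<sigma> \<in> ?G" "\<And>a. ipoly f a = 0 \<Longrightarrow> \<sigma> a = t a" by blast
      have "\<Psi> \<sigma> = s"
      proof
        fix i
        show "\<Psi> \<sigma> i = s i"
        proof (cases "i \<in> {1..n}")
          case True
          then show ?thesis using \<sigma>(2)[OF eR[OF True]] eR[OF True] e'e[OF True] e'e[OF sN[OF True]]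
            by (simp add: \<Psi>_in t_def del: atLeastAtMost_iff)
        next
          case False
          then show ?thesis using permutes_not_in[OF s] by (simp add: \<Psi>_out del: atLeastAtMost_iff)
        qed
      qed
      then show "s \<in> \<Psi> ` ?G" using \<sigma>(1) by blast
    qed
  qed
  then show ?thesis by (rule is_isoI)
qed

text \<open>The factorization multiset keeps multiplicities, so this one predicate covers both the
  discriminant condition and the splitting type.\<close>

definition squarefree_type_mod :: "int \<Rightarrow> nat multiset \<Rightarrow> int poly \<Rightarrow> bool" where
  "squarefree_type_mod p \<mu> f \<longleftrightarrow> (\<forall>g. count (poly_mod_prime.factors_m p f) g \<le> 1) \<and>
     image_mset degree (poly_mod_prime.factors_m p f) = \<mu>"

text \<open>Each prime supplies one Frobenius element. The prime ideals above the three primes are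
  unrelated, but all three elements act on the same set of complex roots.\<close>

theorem galois_group_symmetric:
  fixes f :: "int poly"
  assumes f: "lead_coeff f = 1" "degree f = n"
    and t1: "prime p1" "squarefree_type_mod p1 {#n#} f"
    and t2: "prime p2" "squarefree_type_mod p2 {#1, n - 1#} f"
    and t3: "prime p3" "squarefree_type_mod p3 (add_mset 2 (replicate_mset (n - 2) 1)) f"
  shows "galois_group f \<cong> sym_group n"
proof -
  let ?R = "{a. ipoly f a = 0}" and ?G = "carrier (galois_group f)"
  have f0: "f \<noteq> 0" using f(1) by auto
  have above: "\<exists>\<mm>. prime_above p \<mm>" if prime_p: "prime p" for p :: int
  proof -
    obtain P where P: "prime_ideal_of alg_ints P" "of_int p \<in> P" using exists_prime_ideal_above[OF prime_p] by blast
    have "prime_above p P" by unfold_locales (use prime_p P in auto)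
    then show ?thesis by blast
  qed
  obtain m1 m2 m3 where "prime_above p1 m1" "prime_above p2 m2" "prime_above p3 m3"
    using above t1(1) t2(1) t3(1) by blast
  then interpret P1: prime_above p1 m1 + P2: prime_above p2 m2 + P3: prime_above p3 m3 by auto
  have sf: "\<And>g. count (P1.factors_m f) g \<le> 1" "\<And>g. count (P2.factors_m f) g \<le> 1" "\<And>g. count (P3.factors_m f) g \<le> 1"
    and type: "image_mset degree (P1.factors_m f) = {#n#}" "image_mset degree (P2.factors_m f) = {#1, n - 1#}"
      "image_mset degree (P3.factors_m f) = add_mset 2 (replicate_mset (n - 2) 1)"
    using t1(2) t2(2) t3(2) by (auto simp: squarefree_type_mod_def)
  obtain \<sigma>1 where \<sigma>1: "\<sigma>1 \<in> ?G" "\<And>a. ipoly f a = 0 \<Longrightarrow> a ^ nat p1 - \<sigma>1 a \<in> m1"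
    using P1.frobenius_lift[OF f(1)] by blast
  obtain \<sigma>2 where \<sigma>2: "\<sigma>2 \<in> ?G" "\<And>a. ipoly f a = 0 \<Longrightarrow> a ^ nat p2 - \<sigma>2 a \<in> m2"
    using P2.frobenius_lift[OF f(1)] by blast
  obtain \<sigma>3 where \<sigma>3: "\<sigma>3 \<in> ?G" "\<And>a. ipoly f a = 0 \<Longrightarrow> a ^ nat p3 - \<sigma>3 a \<in> m3"
    using P3.frobenius_lift[OF f(1)] by blast
  have cyc1: "\<forall>C\<subseteq>?R. C \<noteq> {} \<longrightarrow> \<sigma>1 ` C \<subseteq> C \<longrightarrow> C = ?R"
    by (rule P1.single_cycle[OF f(1) sf(1) \<sigma>1 type(1)])
  obtain x where x: "ipoly f x = 0" "\<sigma>2 x = x" "\<forall>C\<subseteq>?R - {x}. C \<noteq> {} \<longrightarrow> \<sigma>2 ` C \<subseteq> C \<longrightarrow> C = ?R - {x}"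
    using P2.cycle_with_fixed_point[OF f(1) sf(2) \<sigma>2 type(2)] by blast
  obtain a b where ab: "ipoly f a = 0" "ipoly f b = 0" "a \<noteq> b" "\<sigma>3 a = b" "\<sigma>3 b = a"
    "\<And>x. ipoly f x = 0 \<Longrightarrow> x \<noteq> a \<Longrightarrow> x \<noteq> b \<Longrightarrow> \<sigma>3 x = x"
    using P3.single_transposition[OF f(1) sf(3) \<sigma>3 type(3)] by blast
  have finR: "finite ?R" using poly_roots_finite[of "cpoly f"] f0 by simp
  define \<Gamma> where "\<Gamma> = {s. s permutes ?R \<and> (\<exists>\<sigma>\<in>?G. \<forall>a. ipoly f a = 0 \<longrightarrow> \<sigma> a = s a)}"
  define ext where "ext \<sigma> = (\<lambda>a. if ipoly f a = 0 then \<sigma> a else a)" for \<sigma> :: "complex \<Rightarrow> complex"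
  have ext_in: "ext \<sigma> \<in> \<Gamma>" if \<sigma>: "\<sigma> \<in> ?G" for \<sigma>
  proof -
    have h: "hom_on (splitting_field f) \<sigma>" using \<sigma> by (simp add: galois_group_carrier[OF f0])
    have "inj_on \<sigma> ?R"
      by (rule inj_on_subset[OF hom_on_inj[OF subfield_splitting_field h]]) (use roots_in_splitting_field in auto)
    then have "bij_betw \<sigma> ?R ?R" using hom_on_permutes_roots[OF f0 h] by (simp add: bij_betw_def)
    then have "bij_betw (ext \<sigma>) ?R ?R" by (rule bij_betw_cong[THEN iffD1, rotated]) (simp add: ext_def)
    then have "ext \<sigma> permutes ?R" by (rule bij_imp_permutes) (simp add: ext_def)
    then show ?thesis unfolding \<Gamma>_def using \<sigma> by (auto simp: ext_def)
  qed
  have ext_img: "ext \<sigma> ` C = \<sigma> ` C" if "C \<subseteq> ?R" for \<sigma> C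
    using that by (intro image_cong) (auto simp: ext_def)
  have full: "s \<in> \<Gamma>" if s: "s permutes ?R" for s
  proof (rule permutation_group_full[OF finR])
    show "s permutes ?R" if "s \<in> \<Gamma>" for s using that by (simp add: \<Gamma>_def)
    have "restrict (\<lambda>x. x) (splitting_field f) \<in> ?G"
      by (rule restrict_in_galois_group[OF f0]) (use subfield_ofD(1)[OF subfield_splitting_field[of f]] in \<open>simp add: hom_on_def\<close>)
    moreover have "ext (restrict (\<lambda>x. x) (splitting_field f)) = id"
      by (auto simp: ext_def fun_eq_iff roots_in_splitting_field)
    ultimately show "id \<in> \<Gamma>" using ext_in by metis
    show "s \<circ> t \<in> \<Gamma>" if st: "s \<in> \<Gamma>" "t \<in> \<Gamma>" for s t
    proof -
      obtain \<sigma> where \<sigma>: "\<sigma> \<in> ?G" "\<And>a. ipoly f a = 0 \<Longrightarrow> \<sigma> a = s a" using st by (auto simp: \<Gamma>_def)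
      obtain \<tau> where \<tau>: "\<tau> \<in> ?G" "\<And>a. ipoly f a = 0 \<Longrightarrow> \<tau> a = t a" using st by (auto simp: \<Gamma>_def)
      have "compose (splitting_field f) \<sigma> \<tau> a = s (t a)" if a: "ipoly f a = 0" for a
        using roots_in_splitting_field[OF a] \<tau>(2)[OF a] \<sigma>(2) galois_root[OF f0 \<tau>(1) a] by (simp add: compose_def)
      moreover have "compose (splitting_field f) \<sigma> \<tau> \<in> ?G" by (rule galois_compose[OF f0 \<tau>(1) \<sigma>(1)])
      moreover have "s \<circ> t permutes ?R" using st by (simp add: \<Gamma>_def permutes_compose)
      ultimately show ?thesis unfolding \<Gamma>_def by auto
    qed
    show "ext \<sigma>1 \<in> \<Gamma>" "ext \<sigma>2 \<in> \<Gamma>" by (rule ext_in, rule \<sigma>1, rule ext_in, rule \<sigma>2)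
    show "\<forall>C\<subseteq>?R. C \<noteq> {} \<longrightarrow> ext \<sigma>1 ` C \<subseteq> C \<longrightarrow> C = ?R" using cyc1 ext_img by simp
    show "x \<in> ?R" "ext \<sigma>2 x = x" using x by (simp_all add: ext_def)
    show "\<forall>C\<subseteq>?R - {x}. C \<noteq> {} \<longrightarrow> ext \<sigma>2 ` C \<subseteq> C \<longrightarrow> C = ?R - {x}"
    proof (intro allI impI)
      fix C assume C: "C \<subseteq> ?R - {x}" "C \<noteq> {}" "ext \<sigma>2 ` C \<subseteq> C"
      then have "\<sigma>2 ` C \<subseteq> C" using ext_img[of C \<sigma>2] by auto
      then show "C = ?R - {x}" using x(3) C by blast
    qed
    have "ext \<sigma>3 = Transposition.transpose a b"
      using ab by (auto simp: ext_def fun_eq_iff Transposition.transpose_def)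
    then show "Transposition.transpose a b \<in> \<Gamma>" using ext_in[OF \<sigma>3(1)] by simp
    show "a \<in> ?R" "b \<in> ?R" "a \<noteq> b" using ab by auto
    show "s permutes ?R" by (rule s)
  qed
  have "card ?R = n" using P1.card_roots[OF f(1) sf(1)] f(2) by simp
  then show ?thesis
    by (rule galois_group_iso_sym_group[OF f0]) (use full in \<open>auto simp: \<Gamma>_def\<close>)
qed

section \<open>Densities\<close>

context poly_mod_prime
begin

lemma weighted_alphabet_irr: "weighted_alphabet monic_irr degree (nat p)"
proof
  show "degree g > 0" if "g \<in> monic_irr" for g by (rule monic_irrD(5)[OF that])
  show "nat p > 0" using m1 by simp
  show "card {A. set_mset A \<subseteq> monic_irr \<and> sum_mset (image_mset degree A) = n} = nat p ^ n" for n
    using bij_betw_same_card[OF bij_betw_factors_m[of n]] card_monic_reduced[of n] by simp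
qed

sublocale irr: weighted_alphabet monic_irr degree "nat p"
  by (rule weighted_alphabet_irr)

lemma card_monic_reduced_factors:
  "card {f \<in> monic_reduced n. Q (factors_m f)} = card {A \<in> irr.words n. Q A}"
proof -
  have "bij_betw factors_m (monic_reduced n) (irr.words n)"
    using bij_betw_factors_m[of n] by (simp add: irr.words_def)
  then have "bij_betw factors_m {f \<in> monic_reduced n. Q (factors_m f)} {A \<in> irr.words n. Q A}"
    by (auto simp: bij_betw_def inj_on_def)
  then show ?thesis by (rule bij_betw_same_card)
qed

lemma card_reduced_squarefree:
  assumes "n \<ge> 2"
  shows "card {f \<in> monic_reduced n. \<forall>g. count (factors_m f) g \<le> 1} = nat p ^ n - nat p ^ (n - 1)"
  using card_monic_reduced_factors[of n "\<lambda>A. \<forall>g. count A g \<le> 1"] irr.card_squarefree_words[OF assms]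
  by (simp add: irr.squarefree_words_def)

lemma card_reduced_type:
  assumes "nat_partition n \<mu>"
  shows "card {f \<in> monic_reduced n. squarefree_type_mod p \<mu> f} = (\<Prod>i=1..n. card (irr.letters i) choose count \<mu> i)"
proof -
  have "{A \<in> irr.words n. (\<forall>g. count A g \<le> 1) \<and> image_mset degree A = \<mu>} = {A \<in> irr.squarefree_words n. image_mset degree A = \<mu>}"
    by (auto simp: irr.squarefree_words_def)
  then show ?thesis
    using card_monic_reduced_factors[of n "\<lambda>A. (\<forall>g. count A g \<le> 1) \<and> image_mset degree A = \<mu>"]
      irr.card_squarefree_words_of_type[OF assms]
    by (simp add: squarefree_type_mod_def)
qed

lemma card_letters_necklace: "i > 0 \<Longrightarrow> real (card (irr.letters i)) = necklace i (real (nat p))"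
  by (rule necklace_unique) (rule irr.sum_divisors_letters)

lemma dvd_discriminant_iff_squarefree:
  assumes "lead_coeff f = 1" "degree f > 0"
  shows "p dvd discriminant f \<longleftrightarrow> \<not> (\<forall>g. count (factors_m f) g \<le> 1)"
proof -
  obtain P where P: "prime_ideal_of alg_ints P" "of_int p \<in> P" using exists_prime_ideal_above[OF prime] by blast
  interpret prime_above p P by unfold_locales (use P in auto)
  show ?thesis by (rule dvd_discriminant_iff[OF assms])
qed

lemma monic_irreducible_factors_eq:
  assumes "lead_coeff f = 1"
  shows "{g. Mp g = g \<and> lead_coeff g = 1 \<and> irreducible_m g \<and> g dvdm f} = set_mset (factors_m f)"
  using monic_irr_dvdm_iff[OF assms] factors_m(1)[OF assms] by (auto simp: monic_irr_def)

lemma Mp_in_monic_reduced: "lead_coeff f = 1 \<Longrightarrow> degree f = n \<Longrightarrow> Mp f \<in> monic_reduced n"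
  using monic_Mp[of f] by (simp add: monic_reduced_def)

lemma squarefree_type_mod_Mp: "squarefree_type_mod p \<mu> (Mp f) \<longleftrightarrow> squarefree_type_mod p \<mu> f"
  by (simp add: squarefree_type_mod_def factors_m_Mp)

text \<open>In q^i, the sum of d N_d over the divisors d of i, the proper divisors contribute at
  most the sum of q^d for d < i, which is at most q^i / 2 once q \<ge> 3. So N_i is at least q^i /
  (2 i).\<close>

lemma card_letters_ge:
  assumes "i > 0" "nat p \<ge> 3"
  shows "nat p ^ i \<le> 2 * (i * card (irr.letters i))"
proof -
  let ?q = "nat p"
  have fin: "finite {d. d dvd i}" using assms(1) by simp
  have "(\<Sum>d\<in>{d. d dvd i} - {i}. d * card (irr.letters d)) \<le> (\<Sum>d<i. ?q ^ d)"
  proof -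
    have "(\<Sum>d\<in>{d. d dvd i} - {i}. d * card (irr.letters d)) \<le> (\<Sum>d\<in>{d. d dvd i} - {i}. ?q ^ d)"
    proof (rule sum_mono)
      fix d assume "d \<in> {d. d dvd i} - {i}"
      then have d: "d > 0" using assms(1) by (auto intro!: Nat.gr0I)
      have "d * card (irr.letters d) \<le> (\<Sum>e | e dvd d. e * card (irr.letters e))"
        by (rule member_le_sum) (use d in auto)
      then show "d * card (irr.letters d) \<le> ?q ^ d" using irr.sum_divisors_letters[OF d] by simp
    qed
    also have "\<dots> \<le> (\<Sum>d<i. ?q ^ d)"
    proof (rule sum_mono2)
      show "{d. d dvd i} - {i} \<subseteq> {..<i}"
      proof
        fix d assume "d \<in> {d. d dvd i} - {i}"
        then have "d \<le> i" "d \<noteq> i" using assms(1) by (auto intro: dvd_imp_le)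
        then show "d \<in> {..<i}" by simp
      qed
    qed simp_all
    finally show ?thesis .
  qed
  moreover have "2 * (\<Sum>d<i. ?q ^ d) \<le> ?q ^ i"
  proof (induction i)
    case (Suc i)
    have "2 * (\<Sum>d<Suc i. ?q ^ d) = 2 * (\<Sum>d<i. ?q ^ d) + 2 * ?q ^ i" by simp
    also have "\<dots> \<le> 3 * ?q ^ i" using Suc by simp
    also have "\<dots> \<le> ?q ^ Suc i" using assms(2) by simp
    finally show ?case .
  qed simp
  moreover have "?q ^ i = i * card (irr.letters i) + (\<Sum>d\<in>{d. d dvd i} - {i}. d * card (irr.letters d))"
    using irr.sum_divisors_letters[OF assms(1)] fin by (simp add: sum.remove[of _ i])
  ultimately show ?thesis by linarith
qed

end

lemma nat_partition_sum:
  assumes "nat_partition n \<mu>"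
  shows "(\<Sum>i=1..n. count \<mu> i * i) = n"
proof -
  have "set_mset \<mu> \<subseteq> {1..n}"
    using assms unfolding nat_partition_def by (auto dest!: multi_member_split simp: Suc_le_eq intro: Nat.gr0I)
  from sum_mset_image_eq_sum_count[OF _ this, of "\<lambda>i. i"] assms show ?thesis
    by (simp add: nat_partition_def)
qed

section \<open>Local proportions and lower bounds uniform in the prime\<close>

definition type_residues :: "nat \<Rightarrow> nat multiset \<Rightarrow> nat \<Rightarrow> int poly set" where
  "type_residues n \<mu> q = {f \<in> poly_mod_prime.monic_reduced (int q) n. squarefree_type_mod (int q) \<mu> f}"

definition squarefree_residues :: "nat \<Rightarrow> nat \<Rightarrow> int poly set" where
  "squarefree_residues n q = {f \<in> poly_mod_prime.monic_reduced (int q) n.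
     \<forall>g. count (poly_mod_prime.factors_m (int q) f) g \<le> 1}"

lemma poly_mod_prime_int: "prime q \<Longrightarrow> poly_mod_prime (int q)"
  by unfold_locales simp

lemma card_squarefree_residues:
  assumes q: "prime q" and n: "n \<ge> 2"
  shows "real (card (squarefree_residues n q)) / real q ^ n = 1 - 1 / real q"
proof -
  interpret poly_mod_prime "int q" by (rule poly_mod_prime_int[OF q])
  have "card (squarefree_residues n q) = q ^ n - q ^ (n - 1)"
    using card_reduced_squarefree[OF n] by (simp add: squarefree_residues_def)
  moreover have "q ^ (n - 1) \<le> q ^ n" using prime_gt_0_nat[OF q] by (intro power_increasing) auto
  ultimately have "real (card (squarefree_residues n q)) = real q ^ n - real q ^ (n - 1)"
    by (simp add: of_nat_diff)
  moreover have "real q ^ n = real q * real q ^ (n - 1)" using n by (cases n) auto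
  ultimately show ?thesis using prime_gt_0_nat[OF q] by (simp add: field_simps)
qed

text \<open>The normalization of \<open>nu_star\<close> is the number of squarefree monic
  polynomials, so its value is a proportion among these; the factor 1 - 1/q converts it to a
  proportion among all monic ones.\<close>

lemma card_type_residues:
  assumes q: "prime q" and n: "n \<ge> 2" and \<mu>: "nat_partition n \<mu>"
  shows "real (card (type_residues n \<mu> q)) / real q ^ n = (1 - 1 / real q) * nu_star n q \<mu>"
proof -
  interpret poly_mod_prime "int q" by (rule poly_mod_prime_int[OF q])
  have "real (card (type_residues n \<mu> q)) = (\<Prod>i=1..n. real (card (irr.letters i) choose count \<mu> i))"
    using card_reduced_type[OF \<mu>] by (simp add: type_residues_def)
  also have "\<dots> = (\<Prod>i=1..n. necklace i (real q) gchoose count \<mu> i)"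
    by (rule prod.cong) (use card_letters_necklace in \<open>auto simp: binomial_gbinomial\<close>)
  finally have *: "real (card (type_residues n \<mu> q)) = (\<Prod>i=1..n. necklace i (real q) gchoose count \<mu> i)" .
  have "real q > 1" using prime_gt_1_nat[OF q] by simp
  moreover have "real q ^ n = real q * real q ^ (n - 1)" using n by (cases n) auto
  ultimately show ?thesis unfolding * nu_star_def by (simp add: field_simps)
qed

text \<open>A lower bound for the proportion of type \<mu> in which q no longer occurs: the binomial
  of N over c is at least (N/c)^c, with N \<ge> q^i / (2 i), and is divided by q^(c i). For c = 0
  the exponent 0 makes the factor 1 despite the division by 0.\<close>

definition type_bound :: "nat \<Rightarrow> nat multiset \<Rightarrow> real" where
  "type_bound n \<mu> = (\<Prod>i=1..n. (1 / (2 * real i * real (count \<mu> i))) ^ count \<mu> i)"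

lemma type_bound_pos: "type_bound n \<mu> > 0"
  unfolding type_bound_def
proof (rule prod_pos)
  fix i assume "i \<in> {1..n}"
  then show "0 < (1 / (2 * real i * real (count \<mu> i))) ^ count \<mu> i"
    by (cases "count \<mu> i = 0") auto
qed

text \<open>The parts sum to n, so the powers of q cancel. The bound 2n + 3 gives q \<ge> 3 for the
  count of irreducibles, and q \<ge> 2n so that at least \<open>count \<mu> i\<close> irreducibles
  of degree i exist.\<close>

lemma card_type_residues_ge:
  assumes q: "prime q" "q \<ge> 2 * n + 3" and \<mu>: "nat_partition n \<mu>"
  shows "type_bound n \<mu> \<le> real (card (type_residues n \<mu> q)) / real q ^ n"
proof -
  interpret poly_mod_prime "int q" by (rule poly_mod_prime_int[OF q(1)])
  let ?N = "\<lambda>i. card (irr.letters i)" and ?c = "count \<mu>"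
  have part: "(\<Sum>i=1..n. ?c i * i) = n" by (rule nat_partition_sum[OF \<mu>])
  have "type_bound n \<mu> \<le> (\<Prod>i=1..n. real (?N i choose ?c i) / real q ^ (?c i * i))"
    unfolding type_bound_def
  proof (rule prod_mono, intro conjI)
    fix i assume i: "i \<in> {1..n}"
    show "0 \<le> (1 / (2 * real i * real (?c i))) ^ ?c i" by simp
    show "(1 / (2 * real i * real (?c i))) ^ ?c i \<le> real (?N i choose ?c i) / real q ^ (?c i * i)"
    proof (cases "?c i = 0")
      case False
      have N: "q ^ i \<le> 2 * (i * ?N i)" using card_letters_ge[of i] i q(2) by simp
      have "?c i * i \<le> (\<Sum>i=1..n. ?c i * i)" by (rule member_le_sum[OF i]) auto
      then have "2 * (i * ?c i) \<le> q" using part q(2) by (simp add: mult.commute)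
      also have "q \<le> q ^ i" using i q(2) by (intro self_le_power) auto
      also note N
      finally have "?c i \<le> ?N i" using i by simp
      then have "(real (?N i) / real (?c i)) ^ ?c i \<le> real (?N i choose ?c i)"
        by (rule binomial_ge_n_over_k_pow_k)
      moreover have "(real q ^ i / (2 * real i * real (?c i))) ^ ?c i \<le> (real (?N i) / real (?c i)) ^ ?c i"
      proof (rule power_mono)
        have "real q ^ i \<le> 2 * (real i * real (?N i))" using N by (metis of_nat_le_iff of_nat_mult of_nat_numeral of_nat_power)
        then show "real q ^ i / (2 * real i * real (?c i)) \<le> real (?N i) / real (?c i)"
          using i False by (simp add: field_simps)
      qed auto
      ultimately have "(real q ^ i / (2 * real i * real (?c i))) ^ ?c i \<le> real (?N i choose ?c i)" by linarith
      moreover have "(real q ^ i / (2 * real i * real (?c i))) ^ ?c i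
         = (1 / (2 * real i * real (?c i))) ^ ?c i * real q ^ (?c i * i)"
        by (simp add: power_divide power_mult[symmetric] mult.commute)
      moreover have "real q ^ (?c i * i) > 0" using q by (simp add: prime_gt_0_nat)
      ultimately show ?thesis by (simp add: pos_le_divide_eq)
    qed simp
  qed
  also have "\<dots> = (\<Prod>i=1..n. real (?N i choose ?c i)) / real q ^ (\<Sum>i=1..n. ?c i * i)"
    by (simp add: prod_dividef power_sum)
  also have "\<dots> = real (card (type_residues n \<mu> q)) / real q ^ n"
    unfolding part using card_reduced_type[OF \<mu>] by (simp add: type_residues_def)
  finally show ?thesis .
qed

lemma residues_subset:
  "type_residues n \<mu> q \<subseteq> poly_mod_prime.monic_reduced (int q) n"
  "squarefree_residues n q \<subseteq> poly_mod_prime.monic_reduced (int q) n"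
  by (auto simp: type_residues_def squarefree_residues_def)

lemma monic_boxD:
  assumes "f \<in> monic_box n B"
  shows "degree f = n" "lead_coeff f = 1"
  using assms by (auto simp: monic_box_def)

lemma Mp_type_residues_iff:
  assumes "prime q" "lead_coeff f = 1" "degree f = n"
  shows "poly_mod.Mp (int q) f \<in> type_residues n \<mu> q \<longleftrightarrow> squarefree_type_mod (int q) \<mu> f"
proof -
  interpret poly_mod_prime "int q" by (rule poly_mod_prime_int[OF assms(1)])
  show ?thesis using Mp_in_monic_reduced[OF assms(2,3)] squarefree_type_mod_Mp by (simp add: type_residues_def)
qed

lemma Mp_squarefree_residues_iff:
  assumes "prime q" "lead_coeff f = 1" "degree f = n" "n > 0"
  shows "poly_mod.Mp (int q) f \<in> squarefree_residues n q \<longleftrightarrow> \<not> int q dvd discriminant f"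
proof -
  interpret poly_mod_prime "int q" by (rule poly_mod_prime_int[OF assms(1)])
  show ?thesis using Mp_in_monic_reduced[OF assms(2,3)] dvd_discriminant_iff_squarefree[OF assms(2)] assms(3,4)
    by (simp add: squarefree_residues_def factors_m_Mp)
qed

text \<open>For a squarefree reduction the set of factors carries the whole multiset, so ignoring
  multiplicities in \<open>splitting_type\<close> loses nothing.\<close>

lemma squarefree_type_mod_iff:
  assumes "prime q" "lead_coeff f = 1" "degree f > 0"
  shows "squarefree_type_mod (int q) \<mu> f \<longleftrightarrow> \<not> int q dvd discriminant f \<and> splitting_type q f = \<mu>"
proof -
  interpret poly_mod_prime "int q" by (rule poly_mod_prime_int[OF assms(1)])
  have "splitting_type q f = image_mset degree (factors_m f)" if "\<forall>g. count (factors_m f) g \<le> 1"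
    using that mset_eq_mset_set[of "factors_m f"] monic_irreducible_factors_eq[OF assms(2)]
    by (simp add: splitting_type_def monic_irreducible_factors_mod_def)
  then show ?thesis using dvd_discriminant_iff_squarefree[OF assms(2,3)] by (auto simp: squarefree_type_mod_def)
qed

section \<open>The sieve for the Galois group\<close>

text \<open>Missing the type at the primes of \<open>Q\<close> amounts to independent conditions,
  each of proportion at most \<open>1 - type_bound n \<mu>\<close>.\<close>

lemma non_type_density:
  assumes n: "n \<ge> 2" and \<mu>: "nat_partition n \<mu>" and Q: "finite Q" "\<And>q. q \<in> Q \<Longrightarrow> prime q \<and> q \<ge> 2 * n + 3"
  shows "\<exists>L \<le> (1 - type_bound n \<mu>) ^ card Q.
    (\<lambda>B. real (card {f \<in> monic_box n B. \<forall>q\<in>Q. \<not> squarefree_type_mod (int q) \<mu> f}) / real (card (monic_box n B))) \<longlonglongrightarrow> L"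
proof -
  define S where "S q = poly_mod_prime.monic_reduced (int q) n - type_residues n \<mu> q" for q
  have card_S: "real (card (S q)) / real q ^ n = 1 - real (card (type_residues n \<mu> q)) / real q ^ n" if q: "q \<in> Q" for q
  proof -
    interpret poly_mod_prime "int q" by (rule poly_mod_prime_int) (use Q(2)[OF q] in simp)
    have q0: "q > 0" using Q(2)[OF q] by simp
    have c: "card (monic_reduced n) = q ^ n" using card_monic_reduced by simp
    then have "finite (monic_reduced n)" using q0 by (intro card_ge_0_finite) simp
    then have "card (S q) = q ^ n - card (type_residues n \<mu> q)" "card (type_residues n \<mu> q) \<le> q ^ n"
      unfolding S_def using residues_subset(1)[of n \<mu> q] c
      by (simp_all add: card_Diff_subset finite_subset flip: c) (auto intro: card_mono)
    then show ?thesis using q0 by (simp add: of_nat_diff diff_divide_distrib)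
  qed
  have eq: "{f \<in> monic_box n B. \<forall>q\<in>Q. \<not> squarefree_type_mod (int q) \<mu> f}
     = {f \<in> monic_box n B. \<forall>q\<in>Q. poly_mod.Mp (int q) f \<in> S q}" for B
  proof -
    have "poly_mod.Mp (int q) f \<in> S q \<longleftrightarrow> \<not> squarefree_type_mod (int q) \<mu> f" if "q \<in> Q" "f \<in> monic_box n B" for q f
      using Mp_type_residues_iff[of q f n \<mu>] monic_boxD[OF that(2)] Q(2)[OF that(1)]
        poly_mod_prime.Mp_in_monic_reduced[OF poly_mod_prime_int, of q f n] by (auto simp: S_def)
    then show ?thesis by blast
  qed
  let ?L = "\<Prod>q\<in>Q. real (card (S q)) / real q ^ n"
  have "?L \<le> (\<Prod>q\<in>Q. 1 - type_bound n \<mu>)"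
  proof (rule prod_mono, intro conjI)
    fix q assume q: "q \<in> Q"
    show "0 \<le> real (card (S q)) / real q ^ n" by simp
    show "real (card (S q)) / real q ^ n \<le> 1 - type_bound n \<mu>"
      unfolding card_S[OF q] using card_type_residues_ge[OF _ _ \<mu>, of q] Q(2)[OF q] by simp
  qed
  moreover have "(\<lambda>B. real (card {f \<in> monic_box n B. \<forall>q\<in>Q. poly_mod.Mp (int q) f \<in> S q}) / real (card (monic_box n B))) \<longlonglongrightarrow> ?L"
    by (rule monic_box_density) (use Q in \<open>auto simp: S_def\<close>)
  ultimately show ?thesis unfolding eq by (intro exI[of _ ?L]) auto
qed

text \<open>A polynomial showing all three types at primes of a finite set \<open>Q\<close> has the
  full symmetric group, so an exceptional one misses some type at every prime of \<open>Q\<close>.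
  Enlarging \<open>Q\<close> makes that density arbitrarily small.\<close>

lemma galois_group_not_symmetric_density:
  assumes n: "n \<ge> 2"
  shows "(\<lambda>B. real (card {f \<in> monic_box n B. \<not> galois_group f \<cong> sym_group n}) / real (card (monic_box n B))) \<longlonglongrightarrow> 0"
proof -
  let ?bad = "\<lambda>B. {f \<in> monic_box n B. \<not> galois_group f \<cong> sym_group n}"
  define \<mu>s where "\<mu>s = [{#n#}, {#1, n - 1#}, add_mset 2 (replicate_mset (n - 2) 1)]"
  have part: "nat_partition n \<mu>" if "\<mu> \<in> set \<mu>s" for \<mu>
    using that n by (auto simp: \<mu>s_def nat_partition_def split: if_splits)
  define \<delta> where "\<delta> = Min (type_bound n ` set \<mu>s)"
  have \<delta>_le: "\<delta> \<le> type_bound n \<mu>" if "\<mu> \<in> set \<mu>s" for \<mu> using that by (auto simp: \<delta>_def)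
  have \<delta>_pos: "\<delta> > 0" using type_bound_pos by (auto simp: \<delta>_def \<mu>s_def)
  have inf: "infinite {q::nat. prime q \<and> q \<ge> 2 * n + 3}"
  proof
    assume "finite {q::nat. prime q \<and> q \<ge> 2 * n + 3}"
    moreover have "{q::nat. prime q} \<subseteq> {q. prime q \<and> q \<ge> 2 * n + 3} \<union> {..<2 * n + 3}" by auto
    ultimately have "finite {q::nat. prime q}" by (metis finite_Un finite_lessThan finite_subset)
    then show False using primes_infinite by blast
  qed
  have "\<forall>\<^sub>F B in sequentially. real (card (?bad B)) / real (card (monic_box n B)) < \<epsilon>" if \<epsilon>: "\<epsilon> > 0" for \<epsilon> :: real
  proof -
    \<comment> \<open>A lower bound for a proportion is at most 1; hence
      \<open>1 - type_bound n \<mu>\<close> is a nonnegative base and its powers can be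
      compared.\<close>
    have tb_le: "type_bound n \<mu> \<le> 1" if "\<mu> \<in> set \<mu>s" for \<mu>
    proof -
      obtain q where q: "prime q" "q \<ge> 2 * n + 3" using inf not_finite_existsD by blast
      interpret poly_mod_prime "int q" by (rule poly_mod_prime_int[OF q(1)])
      have c: "card (monic_reduced n) = q ^ n" using card_monic_reduced by simp
      then have "finite (monic_reduced n)" using q(2) by (intro card_ge_0_finite) simp
      then have "card (type_residues n \<mu> q) \<le> q ^ n" using card_mono[OF _ residues_subset(1)] c by metis
      then have "real (card (type_residues n \<mu> q)) / real q ^ n \<le> 1"
        using q(2) by (simp add: divide_le_eq_1 flip: of_nat_power)
      then show ?thesis using card_type_residues_ge[OF q part[OF that]] by linarith
    qed
    have "{#n#} \<in> set \<mu>s" by (simp add: \<mu>s_def)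
    then have \<delta>_1: "\<delta> \<le> 1" using \<delta>_le tb_le by force
    \<comment> \<open>Each of the three types is allotted a third of \<epsilon>.\<close>
    obtain m where m: "(1 - \<delta>) ^ m < \<epsilon> / 3"
      using real_arch_pow_inv[of "\<epsilon> / 3" "1 - \<delta>"] \<epsilon> \<delta>_pos by auto
    obtain Q where Q: "Q \<subseteq> {q. prime q \<and> q \<ge> 2 * n + 3}" "finite Q" "card Q = m"
      using infinite_arbitrarily_large[OF inf] by blast
    define E where "E \<mu> B = {f \<in> monic_box n B. \<forall>q\<in>Q. \<not> squarefree_type_mod (int q) \<mu> f}" for \<mu> B
    have E_lim: "\<forall>\<^sub>F B in sequentially. real (card (E \<mu> B)) / real (card (monic_box n B)) < \<epsilon> / 3" if \<mu>: "\<mu> \<in> set \<mu>s" for \<mu>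
    proof -
      obtain L where L: "L \<le> (1 - type_bound n \<mu>) ^ card Q"
        "(\<lambda>B. real (card (E \<mu> B)) / real (card (monic_box n B))) \<longlonglongrightarrow> L"
        using non_type_density[OF n part[OF \<mu>] Q(2)] Q(1) unfolding E_def by blast
      have "(1 - type_bound n \<mu>) ^ card Q \<le> (1 - \<delta>) ^ m"
        unfolding Q(3) using \<delta>_le[OF \<mu>] tb_le[OF \<mu>] by (intro power_mono) auto
      then have "L < \<epsilon> / 3" using L(1) m by linarith
      then show ?thesis using order_tendstoD(2)[OF L(2)] by blast
    qed
    have bad_sub: "?bad B \<subseteq> E (\<mu>s ! 0) B \<union> (E (\<mu>s ! 1) B \<union> E (\<mu>s ! 2) B)" for B
    proof
      fix f assume f: "f \<in> ?bad B"
      show "f \<in> E (\<mu>s ! 0) B \<union> (E (\<mu>s ! 1) B \<union> E (\<mu>s ! 2) B)"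
      proof (rule ccontr)
        assume "f \<notin> E (\<mu>s ! 0) B \<union> (E (\<mu>s ! 1) B \<union> E (\<mu>s ! 2) B)"
        then obtain q1 q2 q3 where q: "q1 \<in> Q" "squarefree_type_mod (int q1) {#n#} f"
          "q2 \<in> Q" "squarefree_type_mod (int q2) {#1, n - 1#} f"
          "q3 \<in> Q" "squarefree_type_mod (int q3) (add_mset 2 (replicate_mset (n - 2) 1)) f"
          using f by (auto simp: E_def \<mu>s_def numeral_2_eq_2)
        then have "prime (int q1)" "prime (int q2)" "prime (int q3)" using Q(1) by auto
        then have "galois_group f \<cong> sym_group n"
          using galois_group_symmetric[of f n "int q1" "int q2" "int q3"] q f monic_boxD[of f n B] by auto
        then show False using f by simp
      qed
    qed
    have card_bad: "real (card (?bad B)) \<le> real (card (E (\<mu>s ! 0) B)) + (real (card (E (\<mu>s ! 1) B)) + real (card (E (\<mu>s ! 2) B)))" for B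
    proof -
      have fin: "finite (E \<mu> B)" for \<mu> unfolding E_def using finite_monic_box by simp
      have "card (?bad B) \<le> card (E (\<mu>s ! 0) B \<union> (E (\<mu>s ! 1) B \<union> E (\<mu>s ! 2) B))"
        by (rule card_mono[OF _ bad_sub]) (simp add: fin)
      also have "\<dots> \<le> card (E (\<mu>s ! 0) B) + card (E (\<mu>s ! 1) B \<union> E (\<mu>s ! 2) B)" by (rule card_Un_le)
      also have "\<dots> \<le> card (E (\<mu>s ! 0) B) + (card (E (\<mu>s ! 1) B) + card (E (\<mu>s ! 2) B))"
        by (intro add_left_mono card_Un_le)
      finally show ?thesis by (simp flip: of_nat_add)
    qed
    have mem: "\<mu>s ! 0 \<in> set \<mu>s" "\<mu>s ! 1 \<in> set \<mu>s" "\<mu>s ! 2 \<in> set \<mu>s" by (simp_all add: \<mu>s_def)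
    show ?thesis using E_lim[OF mem(1)] E_lim[OF mem(2)] E_lim[OF mem(3)]
    proof eventually_elim
      case (elim B)
      have "real (card (?bad B)) / real (card (monic_box n B))
         \<le> (real (card (E (\<mu>s ! 0) B)) + (real (card (E (\<mu>s ! 1) B)) + real (card (E (\<mu>s ! 2) B)))) / real (card (monic_box n B))"
        by (rule divide_right_mono[OF card_bad]) simp
      then show ?case using elim unfolding add_divide_distrib by linarith
    qed
  qed
  then show ?thesis
    by (intro order_tendstoI) (auto intro!: always_eventually simp: less_le_trans[OF _ divide_nonneg_nonneg])
qed

theorem theorem5p2:
  fixes n r :: nat and p :: "nat \<Rightarrow> nat" and \<mu> :: "nat \<Rightarrow> nat multiset"
  assumes "n \<ge> 2"
    and "\<And>i. i \<in> {1..r} \<Longrightarrow> prime (p i)"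
    and "inj_on p {1..r}"
    and "\<And>i. i \<in> {1..r} \<Longrightarrow> nat_partition n (\<mu> i)"
  shows "(\<lambda>B. real (card (monic_box_coprime n r p B)) / real (card (monic_box n B)))
           \<longlonglongrightarrow> (\<Prod>i=1..r. 1 - 1 / real (p i))
       \<and> (\<lambda>B. real (card (monic_box_split n r p \<mu> B)) / real (card (monic_box_coprime n r p B)))
           \<longlonglongrightarrow> (\<Prod>i=1..r. nu_star n (p i) (\<mu> i))"
proof -
  define Q where "Q = p ` {1..r}"
  define idx where "idx = the_inv_into {1..r} p"
  have idx: "idx (p i) = i" if "i \<in> {1..r}" for i
    unfolding idx_def by (rule the_inv_into_f_f[OF assms(3) that])
  have Q: "finite Q" "\<And>q. q \<in> Q \<Longrightarrow> prime q" using assms(2) by (auto simp: Q_def)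
  have reindex: "(\<Prod>q\<in>Q. h q) = (\<Prod>i=1..r. h (p i))" for h :: "nat \<Rightarrow> real"
    unfolding Q_def using prod.reindex[OF assms(3), of h] by (simp add: o_def)
  let ?box = "\<lambda>B. real (card (monic_box n B))"
  \<comment> \<open>Coprimality to the product becomes a separate condition at each prime, as the
    count by residues requires.\<close>
  have coprime_iff: "gcd (discriminant f) (\<Prod>i=1..r. int (p i)) = 1 \<longleftrightarrow> (\<forall>i\<in>{1..r}. \<not> int (p i) dvd discriminant f)" for f
  proof -
    have "gcd (discriminant f) (\<Prod>i=1..r. int (p i)) = 1 \<longleftrightarrow> (\<forall>i\<in>{1..r}. Rings.coprime (discriminant f) (int (p i)))"
      unfolding coprime_iff_gcd_eq_1[symmetric]
    proof
      assume cop: "Rings.coprime (discriminant f) (\<Prod>i=1..r. int (p i))"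
      show "\<forall>i\<in>{1..r}. Rings.coprime (discriminant f) (int (p i))"
      proof
        fix i assume "i \<in> {1..r}"
        then have "int (p i) dvd (\<Prod>i=1..r. int (p i))" by (intro dvd_prodI) auto
        then show "Rings.coprime (discriminant f) (int (p i))" using cop coprime_divisors dvd_refl by blast
      qed
    qed (auto intro: prod_coprime_right)
    also have "\<dots> \<longleftrightarrow> (\<forall>i\<in>{1..r}. \<not> int (p i) dvd discriminant f)"
    proof (rule ball_cong[OF refl])
      fix i assume "i \<in> {1..r}"
      then have pr: "prime (int (p i))" using assms(2) by simp
      show "Rings.coprime (discriminant f) (int (p i)) \<longleftrightarrow> \<not> int (p i) dvd discriminant f"
      proof
        assume cop: "Rings.coprime (discriminant f) (int (p i))"
        show "\<not> int (p i) dvd discriminant f"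
        proof
          assume dvd: "int (p i) dvd discriminant f"
          have "is_unit (int (p i))" by (rule coprime_common_divisor[OF cop dvd dvd_refl])
          from not_prime_unit[OF this] pr show False by contradiction
        qed
      next
        assume "\<not> int (p i) dvd discriminant f"
        from prime_imp_coprime[OF pr this] show "Rings.coprime (discriminant f) (int (p i))"
          unfolding coprime_iff_gcd_eq_1 by (subst gcd.commute)
      qed
    qed
    finally show ?thesis .
  qed
  have sqf: "poly_mod.Mp (int (p i)) f \<in> squarefree_residues n (p i) \<longleftrightarrow> \<not> int (p i) dvd discriminant f"
    if "i \<in> {1..r}" "f \<in> monic_box n B" for i f B
    using Mp_squarefree_residues_iff[OF assms(2)[OF that(1)] monic_boxD(2,1)[OF that(2)]] assms(1) by simp
  have type: "poly_mod.Mp (int (p i)) f \<in> type_residues n \<nu> (p i) \<longleftrightarrow> \<not> int (p i) dvd discriminant f \<and> splitting_type (p i) f = \<nu>"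
    if "i \<in> {1..r}" "f \<in> monic_box n B" for i f B \<nu>
    using Mp_type_residues_iff[OF assms(2)[OF that(1)] monic_boxD(2,1)[OF that(2)]]
      squarefree_type_mod_iff[OF assms(2)[OF that(1)] monic_boxD(2)[OF that(2)]] monic_boxD(1)[OF that(2)] assms(1) by simp
  have coprime_eq: "monic_box_coprime n r p B = {f \<in> monic_box n B. \<forall>q\<in>Q. poly_mod.Mp (int q) f \<in> squarefree_residues n q}" for B
    unfolding monic_box_coprime_def coprime_iff Q_def using sqf by auto
  have lim1: "(\<lambda>B. real (card (monic_box_coprime n r p B)) / ?box B) \<longlonglongrightarrow> (\<Prod>i=1..r. 1 - 1 / real (p i))"
  proof -
    have "(\<Prod>q\<in>Q. real (card (squarefree_residues n q)) / real q ^ n) = (\<Prod>i=1..r. 1 - 1 / real (p i))"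
      unfolding reindex by (rule prod.cong) (use card_squarefree_residues assms in auto)
    then show ?thesis unfolding coprime_eq using monic_box_density[OF Q residues_subset(2), of n] by metis
  qed
  \<comment> \<open>The conditions at the primes alone, without the Galois condition;
    \<open>idx\<close> recovers the index of a prime, which injectivity of \<open>p\<close>
    allows.\<close>
  define T where "T B = {f \<in> monic_box n B. \<forall>q\<in>Q. poly_mod.Mp (int q) f \<in> type_residues n (\<mu> (idx q)) q}" for B
  have limT: "(\<lambda>B. real (card (T B)) / ?box B) \<longlonglongrightarrow> (\<Prod>i=1..r. (1 - 1 / real (p i)) * nu_star n (p i) (\<mu> i))"
  proof -
    have "(\<Prod>q\<in>Q. real (card (type_residues n (\<mu> (idx q)) q)) / real q ^ n) = (\<Prod>i=1..r. (1 - 1 / real (p i)) * nu_star n (p i) (\<mu> i))"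
      unfolding reindex by (rule prod.cong) (use card_type_residues assms idx in auto)
    then show ?thesis unfolding T_def
      using monic_box_density[OF Q, of "\<lambda>q. type_residues n (\<mu> (idx q)) q" n] residues_subset(1) by simp
  qed
  define bad where "bad B = {f \<in> monic_box n B. \<not> galois_group f \<cong> sym_group n}" for B
  have lim_bad: "(\<lambda>B. real (card (bad B)) / ?box B) \<longlonglongrightarrow> 0"
    unfolding bad_def by (rule galois_group_not_symmetric_density[OF assms(1)])
  have split_eq: "monic_box_split n r p \<mu> B = T B - bad B" for B
    unfolding monic_box_split_def T_def bad_def monic_box_coprime_def coprime_iff Q_def
    using type idx by auto
  have fin: "finite (T B)" "finite (bad B)" for B
    using finite_monic_box by (auto simp: T_def bad_def)
  \<comment> \<open>Squeezed between the count for \<open>T\<close> and that count less the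
    exceptional set, which has density 0.\<close>
  have lim2: "(\<lambda>B. real (card (monic_box_split n r p \<mu> B)) / ?box B) \<longlonglongrightarrow> (\<Prod>i=1..r. (1 - 1 / real (p i)) * nu_star n (p i) (\<mu> i))"
  proof (rule tendsto_sandwich[OF _ _ _ limT])
    show "(\<lambda>B. real (card (T B)) / ?box B - real (card (bad B)) / ?box B) \<longlonglongrightarrow> (\<Prod>i=1..r. (1 - 1 / real (p i)) * nu_star n (p i) (\<mu> i))"
      using tendsto_diff[OF limT lim_bad] by simp
    have "card (T B) \<le> card (T B - bad B) + card (bad B)" for B
      using diff_card_le_card_Diff[OF fin(2)[of B], of "T B"] by simp
    then have "real (card (T B)) \<le> real (card (T B - bad B)) + real (card (bad B))" for B
      by (metis of_nat_add of_nat_le_iff)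
    then have "(real (card (T B)) - real (card (bad B))) / ?box B \<le> real (card (T B - bad B)) / ?box B" for B
      by (intro divide_right_mono) (simp_all add: algebra_simps)
    then show "\<forall>\<^sub>F B in sequentially. real (card (T B)) / ?box B - real (card (bad B)) / ?box B \<le> real (card (monic_box_split n r p \<mu> B)) / ?box B"
      unfolding split_eq by (intro always_eventually) (simp add: diff_divide_distrib)
    show "\<forall>\<^sub>F B in sequentially. real (card (monic_box_split n r p \<mu> B)) / ?box B \<le> real (card (T B)) / ?box B"
      unfolding split_eq using fin by (intro always_eventually allI divide_right_mono) (auto intro: card_mono)
  qed
  \<comment> \<open>Every prime exceeds 1, so the first limit is nonzero and the factors 1 - 1/p can
    be cancelled in the quotient of the limits.\<close>
  have pos: "(\<Prod>i=1..r. 1 - 1 / real (p i)) \<noteq> 0"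
    using assms(2) prime_gt_1_nat by (fastforce simp: prod_zero_iff)
  have "(\<lambda>B. (real (card (monic_box_split n r p \<mu> B)) / ?box B) / (real (card (monic_box_coprime n r p B)) / ?box B))
     \<longlonglongrightarrow> (\<Prod>i=1..r. (1 - 1 / real (p i)) * nu_star n (p i) (\<mu> i)) / (\<Prod>i=1..r. 1 - 1 / real (p i))"
    by (rule tendsto_divide[OF lim2 lim1 pos])
  also have "(\<Prod>i=1..r. (1 - 1 / real (p i)) * nu_star n (p i) (\<mu> i)) / (\<Prod>i=1..r. 1 - 1 / real (p i)) = (\<Prod>i=1..r. nu_star n (p i) (\<mu> i))"
    using pos by (simp add: prod.distrib)
  finally have "(\<lambda>B. (real (card (monic_box_split n r p \<mu> B)) / ?box B) / (real (card (monic_box_coprime n r p B)) / ?box B))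
     \<longlonglongrightarrow> (\<Prod>i=1..r. nu_star n (p i) (\<mu> i))" .
  \<comment> \<open>For B > 0 the box is nonempty and its size cancels from the quotient.\<close>
  moreover have "\<forall>\<^sub>F B in sequentially. (real (card (monic_box_split n r p \<mu> B)) / ?box B) / (real (card (monic_box_coprime n r p B)) / ?box B)
      = real (card (monic_box_split n r p \<mu> B)) / real (card (monic_box_coprime n r p B))"
    using eventually_gt_at_top[of 0] by eventually_elim (simp add: card_monic_box)
  ultimately have "(\<lambda>B. real (card (monic_box_split n r p \<mu> B)) / real (card (monic_box_coprime n r p B)))
     \<longlonglongrightarrow> (\<Prod>i=1..r. nu_star n (p i) (\<mu> i))"
    by (rule Lim_transform_eventually)
  with lim1 show ?thesis by (rule conjI)
qed

end
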